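(* Let $p(n)$ denote the number of partitions of the positive integer $n$, and for $n\geq 1$ let $$u_n=\frac{p(n+1)\,p(n-1)}{p(n)^2}.$$ Then for every integer $n\geq 95$, $$4(1-u_n)(1-u_{n+1})-(1-u_n u_{n+1})^2>0.$$
   Context: A partition of a positive integer $n$ is a nonincreasing sequence of positive integers summing to $n$; $p(n)$ is the number of such partitions, with $p(0)=1$. *)

theory Defs
  imports Complex_Main
begin

definition partitions :: "nat \<Rightarrow> nat list set" where
  "partitions n = {xs. sorted_wrt (\<ge>) xs \<and> (\<forall>x\<in>set xs. 0 < x) \<and> sum_list xs = n}"

definition num_partitions :: "nat \<Rightarrow> nat" where
  "num_partitions n = card (partitions n)"

text \<open>The library's \<^const>\<open>card\<close> is 0 on infinite sets, so finiteness matters here.\<close>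

lemma finite_partitions: "finite (partitions n)"
proof (rule finite_subset)
  have "length xs \<le> sum_list xs" if "\<forall>x\<in>set xs. 0 < x" for xs :: "nat list"
    using that by (induction xs) auto
  then show "partitions n \<subseteq> {xs. set xs \<subseteq> {..n} \<and> length xs \<le> n}"
    unfolding partitions_def using member_le_sum_list by fastforce
  show "finite {xs. set xs \<subseteq> {..n} \<and> length xs \<le> n}"
    by (rule finite_lists_length_le) simp
qed

lemma num_partitions_0: "num_partitions 0 = 1"
proof -
  have "xs = []" if "\<forall>x\<in>set xs. 0 < x" "sum_list xs = 0" for xs :: "nat list"
    using that by (cases xs) auto
  then have "partitions 0 = {[]}"
    unfolding partitions_def by auto
  then show ?thesis
    by (simp add: num_partitions_def)
qed

definition u_seq :: "nat \<Rightarrow> real" where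
  "u_seq n = real (num_partitions (n + 1)) * real (num_partitions (n - 1)) / (real (num_partitions n))\<^sup>2"

end

theory Submission
  imports Defs "HOL-Complex_Analysis.Complex_Analysis" "HOL-Probability.Distributions"
begin

text \<open>
  Write \<open>a = 1 - u\<^sub>n\<close> and \<open>b = 1 - u\<^sub>n\<^sub>+\<^sub>1\<close>. The expression in question equals \<open>a b (2 (a + b) - a b) - (a - b)\<^sup>2\<close>,
  and asymptotically \<open>a\<close> is a constant times \<open>n\<close> to the power \<open>-3/2\<close> while \<open>a - b\<close> has order \<open>-5/2\<close>; so it suffices to
  know \<open>p(n)\<close> up to a relative error of order \<open>-5/2\<close>, and no second term of the Hardy-Ramanujan-Rademacher series is needed.

  The generating function \<open>P(e\<^sup>-\<^sup>z)\<close> satisfies the modular relation under \<open>z \<mapsto> 4 \<pi>\<^sup>2 / z\<close>. For real \<open>z\<close> this is obtained from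
  the partial fractions of the hyperbolic cotangent by interchanging a conditionally convergent double sum; it extends to
  \<open>Re z > 0\<close> by analytic continuation. Cauchy's formula for \<open>p(n)\<close> is then evaluated on the line \<open>Re z = r\<close> through the saddle
  point, with the middle part of the line replaced by an arc of the circle \<open>|z| = r\<close>: there the integrand without the
  dual factor is \<open>exp (2 B cos \<phi>) exp (3 i \<phi> / 2)\<close>, and \<open>\<tau> = sin (\<phi> / 2)\<close> turns the integral into a Gaussian one. Away from the
  real axis a factor \<open>exp (-0.95 / r)\<close> is gained already from the first term of \<open>log |P|\<close>.

  This settles \<open>n \<ge> 1795\<close>. The remaining values are computed with the pentagonal number recurrence, which is
  proved through the finite identity of Shanks.
\<close>

section \<open>Partial fractions of the hyperbolic cotangent\<close>

text \<open>The terms of order -3 in \<open>4 * (1 - u) * (1 - v)\<close> and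
  \<open>(1 - u * v)^2\<close> cancel. What remains is a product of order -9/2 against
  \<open>(a - b)^2\<close> of order -5, a margin of only one factor \<open>sqrt n\<close>, so
  explicit constants decide where the analytic part begins. A relative error of order -5/2 in p(n)
  means \<open>r^5\<close>, where \<open>r\<close> is the saddle point; as the main term is about
  \<open>r^2 * exp (2 * B)\<close>, every other contribution has to stay below a small multiple of
  \<open>r^7 * exp (2 * B)\<close>. This is proved for \<open>r <= 1 / 33\<close>, which holds from
  n = 1794 on, and u_n involves p(n - 1). The circle is chosen because both halves of the exponent
  are conjugate there, so it is real. The arc ends at the angle pi/3: there
  \<open>sin (\<phi> / 2) = 1 / 2\<close>, the weight \<open>1 - 4 * s^2\<close> of the Gaussian
  integrand vanishes, and \<open>Re z = r / 2\<close> is still large enough to keep the dual factor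
  harmless. Straight segments lead from there to \<open>r * (1 + 5 * \<i>)\<close> and its
  conjugate, from where the gain on the vertical line is sufficient.\<close>

lemma sinh_product_formula:
  fixes x :: real
  shows "(\<lambda>n. x * (\<Prod>k=1..n. 1 + x\<^sup>2 / (pi * real k)\<^sup>2)) \<longlonglongrightarrow> sinh x"
proof -
  \<comment> \<open>Euler's sine product at the imaginary point \<open>\<i> * x / pi\<close>; the
    prefactor turns \<open>sin (\<i> * x)\<close> into \<open>sinh x\<close>.\<close>
  have "(\<lambda>n. -\<i> * (of_real pi * (\<i> * of_real (x / pi)) * (\<Prod>k=1..n. 1 - (\<i> * of_real (x / pi))^2 / of_nat k^2)))
      \<longlonglongrightarrow> -\<i> * sin (of_real pi * (\<i> * of_real (x / pi)))"
    by (intro tendsto_intros sin_product_formula_complex)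
  also have "(\<lambda>n. -\<i> * (of_real pi * (\<i> * of_real (x / pi)) * (\<Prod>k=1..n. 1 - (\<i> * of_real (x / pi))^2 / of_nat k^2)))
      = (\<lambda>n. complex_of_real (x * (\<Prod>k=1..n. 1 + x\<^sup>2 / (pi * real k)\<^sup>2)))"
    by (auto simp: power_mult_distrib power_divide mult.assoc [of \<i>] mult.assoc [of "- \<i>"] simp flip: mult.assoc [of \<i> \<i>] intro!: ext)
  also have "-\<i> * sin (of_real pi * (\<i> * of_real (x / pi))) = complex_of_real (sinh x)"
    by (simp add: sin_i_times sinh_field_def exp_minus flip: exp_of_real)
  finally show ?thesis
    by (subst (asm) tendsto_of_real_iff)
qed

lemma sums_ln_sinh:
  fixes x :: real
  assumes "x > 0"
  shows "(\<lambda>k. ln (1 + x\<^sup>2 / (pi * real (Suc k))\<^sup>2)) sums ln (sinh x / x)"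
proof -
  have "(\<lambda>n. x * (\<Prod>k=1..n. 1 + x\<^sup>2 / (pi * real k)\<^sup>2) / x) \<longlonglongrightarrow> sinh x / x"
    by (intro tendsto_intros sinh_product_formula) (use assms in auto)
  then have "(\<lambda>n. ln (\<Prod>k=1..n. 1 + x\<^sup>2 / (pi * real k)\<^sup>2)) \<longlonglongrightarrow> ln (sinh x / x)"
    using assms by (intro tendsto_ln) auto
  also have "(\<lambda>n. ln (\<Prod>k=1..n. 1 + x\<^sup>2 / (pi * real k)\<^sup>2)) = (\<lambda>n. \<Sum>k<n. ln (1 + x\<^sup>2 / (pi * real (Suc k))\<^sup>2))"
  proof
    fix n
    have "1 + x\<^sup>2 / (pi * real k)\<^sup>2 > 0" for k
      by (intro add_pos_nonneg) auto
    then show "ln (\<Prod>k=1..n. 1 + x\<^sup>2 / (pi * real k)\<^sup>2) = (\<Sum>k<n. ln (1 + x\<^sup>2 / (pi * real (Suc k))\<^sup>2))"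
      by (subst ln_prod) (auto simp: sum.atLeast1_atMost_eq less_imp_neq [symmetric] simp del: of_nat_Suc)
  qed
  finally show ?thesis
    by (simp add: sums_def)
qed

lemma summable_inverse_Suc_squared: "summable (\<lambda>k. 1 / (real (Suc k))\<^sup>2)"
  using inverse_squares_sums by (simp add: sums_iff add.commute)

text \<open>Logarithmic derivative of the product for sinh. Termwise differentiation needs a uniform
  majorant near \<open>x\<close>; on the neighbourhood \<open>S\<close> the k-th derivative is at
  most \<open>4 * x / k^2\<close>.\<close>

lemma sums_coth:
  fixes x :: real
  assumes "x > 0"
  shows "(\<lambda>k. 2 * x / (x\<^sup>2 + (pi * real (Suc k))\<^sup>2)) sums (cosh x / sinh x - 1 / x)"
proof -
  define S where "S = {0<..<2 * x}"
  define f where "f = (\<lambda>k (t::real). ln (1 + t\<^sup>2 / (pi * real (Suc k))\<^sup>2))"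
  define f' where "f' = (\<lambda>k (t::real). 2 * t / (t\<^sup>2 + (pi * real (Suc k))\<^sup>2))"
  have pos: "1 + t\<^sup>2 / (pi * real (Suc k))\<^sup>2 > 0" "t\<^sup>2 + (pi * real (Suc k))\<^sup>2 > 0" for t k
    by (intro add_pos_nonneg add_nonneg_pos; simp)+
  have deriv: "(f k has_field_derivative f' k t) (at t within S)" for k t
  proof -
    have "1 + t\<^sup>2 / (pi * real (Suc k))\<^sup>2 = (t\<^sup>2 + (pi * real (Suc k))\<^sup>2) / (pi * real (Suc k))\<^sup>2"
      by (simp add: field_simps del: of_nat_Suc)
    then have "inverse (1 + t\<^sup>2 / (pi * real (Suc k))\<^sup>2) * (2 * t / (pi * real (Suc k))\<^sup>2) = f' k t"
      by (simp add: f'_def del: of_nat_Suc)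
    then show ?thesis
      unfolding f_def using pos(1)[of t k]
      by (auto intro!: derivative_eq_intros simp: divide_inverse simp del: of_nat_Suc)
  qed
  have bound: "norm (f' k t) \<le> 4 * x * (1 / (real (Suc k))\<^sup>2)" if "t \<in> S" for k t
  proof -
    have "1 * (real (Suc k))\<^sup>2 \<le> pi\<^sup>2 * (real (Suc k))\<^sup>2"
      using pi_gt3 by (intro mult_right_mono) (auto simp: power2_eq_square intro: order_trans[OF _ mult_mono[of 1 pi 1 pi]])
    then have "(real (Suc k))\<^sup>2 \<le> t\<^sup>2 + (pi * real (Suc k))\<^sup>2"
      by (simp only: power_mult_distrib mult_1 add_increasing zero_le_power2)
    then have "2 * t / (t\<^sup>2 + (pi * real (Suc k))\<^sup>2) \<le> 4 * x / (real (Suc k))\<^sup>2"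
      using that assms by (intro frac_le) (auto simp: S_def)
    then show ?thesis
      using that pos[of t k] by (simp add: f'_def S_def del: of_nat_Suc)
  qed
  have summable: "summable (\<lambda>k. 4 * x * (1 / (real (Suc k))\<^sup>2))"
    by (intro summable_mult summable_inverse_Suc_squared)
  have unif: "uniformly_convergent_on S (\<lambda>n t. \<Sum>i<n. f' i t)"
    by (rule Weierstrass_m_test'[OF _ summable]) (rule bound)
  have x: "x \<in> S" "x \<in> interior S"
    using assms by (auto simp: S_def)
  have "((\<lambda>t. \<Sum>k. f k t) has_field_derivative (\<Sum>k. f' k x)) (at x)"
    using has_field_derivative_series'(2)[OF _ deriv unif x(1) _ x(2)] sums_ln_sinh[OF assms]
    by (auto simp: S_def f_def sums_iff)
  moreover have "eventually (\<lambda>t. (\<Sum>k. f k t) = ln (sinh t / t)) (nhds x)"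
    using eventually_nhds_in_open[of S x] x
    by (auto simp: S_def f_def sums_iff elim!: eventually_mono dest: sums_ln_sinh)
  ultimately have "((\<lambda>t. ln (sinh t / t)) has_field_derivative (\<Sum>k. f' k x)) (at x)"
    using DERIV_cong_ev[OF refl _ refl, THEN iffD1] by fast
  moreover have "((\<lambda>t. ln (sinh t / t)) has_field_derivative (cosh x / sinh x - 1 / x)) (at x)"
  proof -
    have "eventually (\<lambda>t. ln (sinh t) - ln t = ln (sinh t / t)) (nhds x)"
      using eventually_nhds_in_open[of S x] x
      by (auto simp: S_def ln_div elim!: eventually_mono)
    moreover have "((\<lambda>t. ln (sinh t) - ln t) has_field_derivative (cosh x / sinh x - 1 / x)) (at x)"
      using assms by (auto intro!: derivative_eq_intros)
    ultimately show ?thesis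
      using DERIV_cong_ev[OF refl _ refl, THEN iffD1] by fast
  qed
  ultimately have "(\<Sum>k. f' k x) = cosh x / sinh x - 1 / x"
    by (rule DERIV_unique)
  moreover have "summable (\<lambda>k. f' k x)"
    by (rule summable_comparison_test'[OF summable]) (rule bound[OF x(1)])
  ultimately show ?thesis
    by (simp add: f'_def sums_iff)
qed

lemma sums_inverse_exp_minus_1:
  fixes x :: real
  assumes "x > 0"
  shows "(\<lambda>k. 2 * x / (x\<^sup>2 + (2 * pi * real (Suc k))\<^sup>2)) sums (1 / (exp x - 1) - 1 / x + 1 / 2)"
proof -
  have "(\<lambda>k. 1 / 2 * (2 * (x / 2) / ((x / 2)\<^sup>2 + (pi * real (Suc k))\<^sup>2))) sums
     (1 / 2 * (cosh (x / 2) / sinh (x / 2) - 1 / (x / 2)))"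
    by (intro sums_mult sums_coth) (use assms in auto)
  moreover have "1 / 2 * (2 * (x / 2) / ((x / 2)\<^sup>2 + (pi * real (Suc k))\<^sup>2)) = 2 * x / (x\<^sup>2 + (2 * pi * real (Suc k))\<^sup>2)" for k
    by (simp add: power_divide power_mult_distrib divide_simps del: of_nat_Suc)
  moreover have "cosh (x / 2) / sinh (x / 2) = 1 + 2 / (exp x - 1)"
  proof -
    define e where "e = exp (x / 2)"
    have e: "e > 1" "e * e > 1" "exp x = e * e"
      using assms by (auto simp: e_def less_1_mult simp flip: exp_add)
    have "cosh (x / 2) / sinh (x / 2) = ((e + 1 / e) / 2) / ((e - 1 / e) / 2)"
      by (simp only: e_def cosh_field_def sinh_field_def exp_minus inverse_eq_divide)
    also have "\<dots> = (e * e + 1) / (e * e - 1)"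
      using e by (simp add: field_simps)
    also have "\<dots> = 1 + 2 / (exp x - 1)"
      using e by (simp add: field_simps)
    finally show ?thesis .
  qed
  ultimately show ?thesis
    by (simp add: algebra_simps)
qed

section \<open>Reciprocity for the logarithm of the Euler product\<close>

text \<open>Integral test for a decreasing rational function. The primitive \<open>G\<close> is
  written with the reciprocal argument so that it vanishes at infinity; by the mean value theorem
  its unit increments lie between consecutive terms.\<close>

lemma arctan_tail_bounds:
  fixes a b k :: real and N :: nat
  assumes pos_params: "a > 0" "b > 0" "k > 0" "N > 0"
  defines "h \<equiv> \<lambda>m. a * b / pi / ((a * k)\<^sup>2 + (b * real m)\<^sup>2)"
  shows "summable (\<lambda>m. h (N + Suc m))"
    and "(\<Sum>m. h (N + Suc m)) \<le> arctan (a * k / (b * real N)) / (pi * k)"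
    and "arctan (a * k / (b * real N)) / (pi * k) \<le> (\<Sum>m. h (N + Suc m)) + h N"
proof -
  define G where "G = (\<lambda>v. - arctan (a * k / (b * v)) / (pi * k))"
  define h' where "h' = (\<lambda>v. a * b / pi / ((a * k)\<^sup>2 + (b * v)\<^sup>2))"
  have pos: "(a * k)\<^sup>2 + (b * v)\<^sup>2 > 0" for v
    using pos_params by (intro add_pos_nonneg) auto
  have deriv: "(G has_real_derivative h' v) (at v)" if "v > 0" for v
  proof -
    define Q where "Q = (a * k)\<^sup>2 + (b * v)\<^sup>2"
    have "1 + (a * k / (b * v))\<^sup>2 = Q / (b * v)\<^sup>2"
      using that \<open>b > 0\<close> by (simp add: Q_def power_divide add_divide_distrib)
    moreover have "a * k / (b * v\<^sup>2) / (Q / (b * v)\<^sup>2) / (pi * k) = a * b / pi / Q"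
      using that \<open>a > 0\<close> \<open>b > 0\<close> \<open>k > 0\<close> pos[of v] by (simp add: Q_def[symmetric] field_simps power2_eq_square)
    ultimately have "a * k / (b * v\<^sup>2) / (1 + (a * k / (b * v))\<^sup>2) / (pi * k) = h' v"
      by (simp add: h'_def Q_def)
    moreover have "(G has_real_derivative - (- (a * k / (b * v\<^sup>2)) / (1 + (a * k / (b * v))\<^sup>2)) / (pi * k)) (at v)"
      unfolding G_def using that \<open>b > 0\<close>
      by (auto intro!: derivative_eq_intros simp: power2_eq_square divide_inverse)
    ultimately show ?thesis
      by simp
  qed
  have mono: "h' w \<le> h' v" if "0 < v" "v \<le> w" for v w
    unfolding h'_def using that pos_params pos
    by (intro divide_left_mono add_left_mono power_mono mult_left_mono mult_pos_pos) auto
  have step: "h (Suc m) \<le> G (Suc m) - G m \<and> G (Suc m) - G m \<le> h m" if "m > 0" for m :: nat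
  proof -
    have "\<exists>z>real m. z < real (Suc m) \<and> G (real (Suc m)) - G (real m) = (real (Suc m) - real m) * h' z"
      using that by (intro MVT2 deriv) auto
    then obtain z where z: "z > real m" "z < real (Suc m)" "G (real (Suc m)) - G (real m) = h' z"
      by auto
    have "h' (real (Suc m)) \<le> h' z" "h' z \<le> h' (real m)"
      using z that by (auto intro!: mono)
    then show ?thesis
      using z(3) by (simp add: h_def h'_def)
  qed
  have nonneg: "h m \<ge> 0" for m
    unfolding h_def using pos_params pos by (simp add: less_imp_le)
  have "(\<lambda>m. G (real (N + m))) \<longlonglongrightarrow> - arctan 0 / (pi * k)"
  proof -
    have "(\<lambda>m. a * k / (b * real (N + m))) \<longlonglongrightarrow> 0"
      using LIMSEQ_ignore_initial_segment[OF lim_const_over_n[of "a * k / b"], of N]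
      by (simp add: add.commute)
    from tendsto_divide[OF tendsto_minus[OF tendsto_arctan[OF this]] tendsto_const[of "pi * k"]]
    show ?thesis
      unfolding G_def using pos_params by simp
  qed
  then have sums: "(\<lambda>m. G (real (N + Suc m)) - G (real (N + m))) sums (- G N)"
    using telescope_sums[of "\<lambda>m. G (real (N + m))" 0] by simp
  have step': "h (N + Suc m) \<le> G (real (N + Suc m)) - G (real (N + m))"
     "G (real (N + Suc m)) - G (real (N + m)) \<le> h (N + m)" for m
    using step[of "N + m"] pos_params by simp_all
  show sm: "summable (\<lambda>m. h (N + Suc m))"
    by (rule summable_comparison_test'[where N = 0, OF sums_summable[OF sums]])
       (use step' nonneg in auto)
  show "(\<Sum>m. h (N + Suc m)) \<le> arctan (a * k / (b * real N)) / (pi * k)"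
    using suminf_le[OF step'(1) sm sums_summable[OF sums]] sums_unique[OF sums] by (simp add: G_def)
  have sm': "summable (\<lambda>m. h (N + m))"
    using sm summable_iff_shift[of "\<lambda>m. h (N + m)" 1] by simp
  have "(\<Sum>m. h (N + m)) = (\<Sum>m. h (N + Suc m)) + h N"
    using suminf_split_head[OF sm'] by simp
  then show "arctan (a * k / (b * real N)) / (pi * k) \<le> (\<Sum>m. h (N + Suc m)) + h N"
    using suminf_le[OF step'(2) sums_summable[OF sums] sm'] sums_unique[OF sums] by (simp add: G_def)
qed

text \<open>On each subinterval the increment of the primitive is the length times a value of
  \<open>g\<close> at an intermediate point; uniform continuity moves that point to the right
  end.\<close>

lemma riemann_sum_tendsto_integral:
  fixes g :: "real \<Rightarrow> real"
  assumes "c > 0" "continuous_on {0..c} g"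
  shows "(\<lambda>N. \<Sum>k<N. c / real N * g (c * real (Suc k) / real N)) \<longlonglongrightarrow> integral {0..c} g"
proof (rule LIMSEQ_I)
  fix e :: real
  assume "e > 0"
  define G where "G = (\<lambda>x. integral {0..x} g)"
  have "uniformly_continuous_on {0..c} g"
    using assms compact_uniformly_continuous by blast
  then obtain d where d: "d > 0" "\<And>x y. x \<in> {0..c} \<Longrightarrow> y \<in> {0..c} \<Longrightarrow> dist x y < d \<Longrightarrow> dist (g x) (g y) < e / (2 * c)"
    unfolding uniformly_continuous_on_def using \<open>e > 0\<close> \<open>c > 0\<close>
    by (metis divide_pos_pos dist_commute mult_pos_pos zero_less_numeral)
  obtain N0 where N0: "real N0 > c / d"
    using reals_Archimedean2 by blast
  have "norm ((\<Sum>k<N. c / real N * g (c * real (Suc k) / real N)) - integral {0..c} g) < e" if "N \<ge> N0" "N > 0" for N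
  proof -
    define t where "t = (\<lambda>k. c * real k / real N)"
    have Nd: "c / real N < d"
    proof -
      have "c / d < real N"
        using N0 that by linarith
      then show ?thesis
        using d(1) that by (simp add: field_simps)
    qed
    have t_step: "t (Suc k) - t k = c / real N" for k
      using that by (simp add: t_def field_simps)
    have t_range: "t k \<in> {0..c}" if "k \<le> N" for k
      using that \<open>c > 0\<close> \<open>N > 0\<close> by (auto simp: t_def field_simps)
    have est: "\<bar>c / real N * g (t (Suc k)) - (G (t (Suc k)) - G (t k))\<bar> \<le> c / real N * (e / (2 * c))" if "k < N" for k
    proof -
      have lt: "t k < t (Suc k)"
        using t_step[of k] \<open>c > 0\<close> \<open>N > 0\<close> by (metis diff_gt_0_iff_gt divide_pos_pos of_nat_0_less_iff)
      have mem: "t k \<in> {0..c}" "t (Suc k) \<in> {0..c}"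
        using t_range that by auto
      have "\<exists>z\<in>{t k<..<t (Suc k)}. G (t (Suc k)) - G (t k) = (\<lambda>h. g z * h) (t (Suc k) - t k)"
      proof (rule mvt_simple[OF lt])
        fix x assume "t k \<le> x" "x \<le> t (Suc k)"
        then have "x \<in> {0..c}" using mem by auto
        then have "(G has_real_derivative g x) (at x within {0..c})"
          unfolding G_def by (rule integral_has_real_derivative[OF assms(2)])
        then show "(G has_derivative (\<lambda>h. g x * h)) (at x within {t k..t (Suc k)})"
          unfolding has_field_derivative_def using mem by (elim has_derivative_subset) auto
      qed
      then obtain z where z: "t k < z" "z < t (Suc k)" "G (t (Suc k)) - G (t k) = g z * (c / real N)"
        unfolding t_step by auto
      have "dist (t (Suc k)) z < d"
        using z t_step[of k] Nd by (auto simp: dist_real_def)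
      then have "dist (g (t (Suc k))) (g z) < e / (2 * c)"
        using z mem by (intro d) auto
      then have "\<bar>c / real N\<bar> * \<bar>g (t (Suc k)) - g z\<bar> \<le> c / real N * (e / (2 * c))"
        using \<open>c > 0\<close> by (intro mult_mono) (auto simp: dist_real_def)
      then show ?thesis
        unfolding z(3) abs_mult[symmetric] by (simp add: algebra_simps)
    qed
    have "integral {0..c} g = G (t N) - G (t 0)"
      using \<open>N > 0\<close> by (simp add: G_def t_def)
    also have "\<dots> = (\<Sum>k<N. G (t (Suc k)) - G (t k))"
      by (simp add: sum_lessThan_telescope[of "\<lambda>k. G (t k)"])
    finally have "\<bar>(\<Sum>k<N. c / real N * g (t (Suc k))) - integral {0..c} g\<bar>
        \<le> (\<Sum>k<N. \<bar>c / real N * g (t (Suc k)) - (G (t (Suc k)) - G (t k))\<bar>)"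
      by (simp flip: sum_subtractf)
    also have "\<dots> \<le> (\<Sum>k<N. c / real N * (e / (2 * c)))"
      by (intro sum_mono est) auto
    also have "\<dots> < e"
      using \<open>N > 0\<close> \<open>c > 0\<close> \<open>e > 0\<close> by simp
    finally show ?thesis
      by (simp add: t_def)
  qed
  then show "\<exists>no. \<forall>N\<ge>no. norm ((\<Sum>k<N. c / real N * g (c * real (Suc k) / real N)) - integral {0..c} g) < e"
    by (intro exI[of _ "max N0 1"]) auto
qed

text \<open>The value at 0 is the limit, which keeps the integrand continuous on intervals starting
  at 0.\<close>

definition arctan_quot :: "real \<Rightarrow> real" where
  "arctan_quot t = (if t = 0 then 1 else arctan t / t)"

lemma continuous_on_arctan_quot: "continuous_on A arctan_quot"
proof -
  have "isCont arctan_quot t" for t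
  proof (cases "t = 0")
    case True
    have "(arctan has_real_derivative 1) (at 0)"
      by (auto intro!: derivative_eq_intros)
    then have "((\<lambda>h. arctan h / h) \<longlongrightarrow> 1) (at 0)"
      by (simp add: DERIV_def)
    then have "(arctan_quot \<longlongrightarrow> 1) (at 0)"
      by (rule Lim_transform_eventually) (auto simp: arctan_quot_def eventually_at_filter)
    then show ?thesis
      using True by (simp add: isCont_def arctan_quot_def)
  next
    case False
    then have ev: "eventually (\<lambda>s. arctan_quot s = arctan s / s) (nhds t)"
      using t1_space_nhds[of t 0] by (auto simp: arctan_quot_def elim!: eventually_mono)
    have "isCont (\<lambda>s. arctan s / s) t"
      using False by (intro continuous_intros) auto
    then show ?thesis
      using isCont_cong[OF ev] by simp
  qed
  then show ?thesis
    by (simp add: continuous_at_imp_continuous_on)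
qed

text \<open>Both sides have derivative \<open>pi / (2 * c)\<close>, because
  \<open>arctan c + arctan (1 / c) = pi / 2\<close>, and both vanish at \<open>c = 1\<close>. This
  is the origin of the logarithm in the reciprocity law.\<close>

lemma arctan_quot_integral_diff:
  assumes "c > 0"
  shows "integral {0..c} arctan_quot - integral {0..1 / c} arctan_quot = pi / 2 * ln c"
proof -
  define G where "G = (\<lambda>x. integral {0..x} arctan_quot)"
  have G: "(G has_real_derivative arctan t / t) (at t)" if "t > 0" for t
  proof -
    have "(G has_real_derivative arctan_quot t) (at t within {0..2 * t})"
      unfolding G_def using that
      by (intro integral_has_real_derivative continuous_on_arctan_quot) auto
    moreover have "at t within {0..2 * t} = at t"
      using that by (intro at_within_interior) auto
    ultimately show ?thesis
      using that by (simp add: arctan_quot_def)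
  qed
  define D where "D = (\<lambda>c. G c - G (1 / c) - pi / 2 * ln c)"
  have "(D has_real_derivative 0) (at c)" if "c > 0" for c
  proof -
    have "((\<lambda>c. 1 / c) has_real_derivative - 1 / c\<^sup>2) (at c)"
      using that by (auto intro!: derivative_eq_intros simp: power2_eq_square)
    then have "((\<lambda>c. G (1 / c)) has_real_derivative (arctan (1 / c) / (1 / c)) * (- 1 / c\<^sup>2)) (at c)"
      using that by (intro DERIV_chain2[where f = G] G) auto
    moreover have "((\<lambda>c. pi / 2 * ln c) has_real_derivative pi / 2 * (1 / c)) (at c)"
      using that by (auto intro!: derivative_eq_intros)
    ultimately have "(D has_real_derivative (arctan c / c - (arctan (1 / c) / (1 / c)) * (- 1 / c\<^sup>2) - pi / 2 * (1 / c))) (at c)"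
      unfolding D_def using that by (intro DERIV_diff G)
    moreover have "arctan (1 / c) = pi / 2 - arctan c"
      using arctan_inverse[of c] that by (simp add: inverse_eq_divide)
    ultimately show ?thesis
      using that by (simp add: field_simps power2_eq_square)
  qed
  then have "\<exists>C. \<forall>x\<in>{0<..}. D x = C"
    by (intro has_field_derivative_zero_constant) (auto intro: has_field_derivative_at_within)
  then have "D c = D 1"
    using assms by force
  then show ?thesis
    by (simp add: D_def G_def)
qed

text \<open>The logarithm of the Euler product at \<open>exp (- x)\<close>: expanding each
  \<open>- ln (1 - exp (- j * x))\<close> in powers and summing the geometric series over
  \<open>j\<close> leaves this single series.\<close>

definition lambert_log :: "real \<Rightarrow> real" where
  "lambert_log x = (\<Sum>k. 1 / (real (Suc k) * (exp (real (Suc k) * x) - 1)))"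

lemma lambert_log_term_bounds:
  assumes "x > 0"
  shows "0 \<le> 1 / (real (Suc k) * (exp (real (Suc k) * x) - 1))"
    and "1 / (real (Suc k) * (exp (real (Suc k) * x) - 1)) \<le> 1 / x * (1 / (real (Suc k))\<^sup>2)"
proof -
  have *: "real (Suc k) * x \<le> exp (real (Suc k) * x) - 1" "real (Suc k) * x > 0"
    using exp_ge_add_one_self[of "real (Suc k) * x"] assms by (linarith, simp)
  then show "0 \<le> 1 / (real (Suc k) * (exp (real (Suc k) * x) - 1))"
    by (simp del: of_nat_Suc)
  have "1 / (real (Suc k) * (exp (real (Suc k) * x) - 1)) \<le> 1 / (real (Suc k) * (real (Suc k) * x))"
    using * assms by (intro divide_left_mono mult_left_mono mult_pos_pos) (auto simp del: of_nat_Suc)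
  then show "1 / (real (Suc k) * (exp (real (Suc k) * x) - 1)) \<le> 1 / x * (1 / (real (Suc k))\<^sup>2)"
    by (simp add: power2_eq_square mult_ac del: of_nat_Suc)
qed

lemma summable_lambert_log:
  assumes "x > 0"
  shows "summable (\<lambda>k. 1 / (real (Suc k) * (exp (real (Suc k) * x) - 1)))"
  by (rule summable_comparison_test'[OF summable_mult[OF summable_inverse_Suc_squared, of "1 / x"], where N = 0])
     (use lambert_log_term_bounds[OF assms] in \<open>simp del: of_nat_Suc\<close>)

text \<open>Each row tail is an arctangent up to an error \<open>C / N^2\<close>, so
  \<open>N\<close> rows err by \<open>C / N\<close> in total. The arctangents themselves form a
  Riemann sum for \<open>arctan_quot\<close> on the interval from 0 to \<open>a / b\<close>.\<close>

lemma tail_sum_tendsto: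
  fixes a b :: real
  assumes "a > 0" "b > 0"
  shows "(\<lambda>N. \<Sum>i<N. \<Sum>m. a * b / pi / ((a * real (Suc i))\<^sup>2 + (b * real (N + Suc m))\<^sup>2))
     \<longlonglongrightarrow> integral {0..a / b} arctan_quot / pi"
proof -
  define T where "T = (\<lambda>N. \<Sum>i<N. \<Sum>m. a * b / pi / ((a * real (Suc i))\<^sup>2 + (b * real (N + Suc m))\<^sup>2))"
  define R where "R = (\<lambda>N. (\<Sum>k<N. a / b / real N * arctan_quot (a / b * real (Suc k) / real N)) / pi)"
  define C where "C = a / (pi * b)"
  have "R \<longlonglongrightarrow> integral {0..a / b} arctan_quot / pi"
    unfolding R_def using assms
    by (intro tendsto_divide riemann_sum_tendsto_integral continuous_on_arctan_quot tendsto_const) auto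
  moreover have "(\<lambda>N. T N - R N) \<longlonglongrightarrow> 0"
  proof (rule Lim_null_comparison)
    show "(\<lambda>N. C / real N) \<longlonglongrightarrow> 0"
      by (rule lim_const_over_n)
    show "\<forall>\<^sub>F N in sequentially. norm (T N - R N) \<le> C / real N"
      using eventually_gt_at_top[of 0]
    proof eventually_elim
      case (elim N)
      have R: "R N = (\<Sum>i<N. arctan (a * real (Suc i) / (b * real N)) / (pi * real (Suc i)))"
        unfolding R_def sum_divide_distrib
        by (rule sum.cong) (use elim assms in \<open>auto simp: arctan_quot_def field_simps simp del: of_nat_Suc\<close>)
      note tail = arctan_tail_bounds[OF assms _ elim, of "real (Suc i)" for i]
      have "norm (T N - R N) \<le> (\<Sum>i<N. norm ((\<Sum>m. a * b / pi / ((a * real (Suc i))\<^sup>2 + (b * real (N + Suc m))\<^sup>2))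
          - arctan (a * real (Suc i) / (b * real N)) / (pi * real (Suc i))))"
        unfolding T_def R sum_subtractf[symmetric] by (rule norm_sum)
      also have "\<dots> \<le> (\<Sum>i<N. C / (real N)\<^sup>2)"
      proof (rule sum_mono)
        fix i
        have "a * b / pi / ((a * real (Suc i))\<^sup>2 + (b * real N)\<^sup>2) \<le> a * b / pi / (b * real N)\<^sup>2"
          using assms elim by (intro divide_left_mono mult_pos_pos add_nonneg_pos) auto
        also have "\<dots> = C / (real N)\<^sup>2"
          using assms by (simp add: C_def power2_eq_square)
        finally show "norm ((\<Sum>m. a * b / pi / ((a * real (Suc i))\<^sup>2 + (b * real (N + Suc m))\<^sup>2))
          - arctan (a * real (Suc i) / (b * real N)) / (pi * real (Suc i))) \<le> C / (real N)\<^sup>2"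
          using tail(2,3)[of i] by (simp del: of_nat_Suc of_nat_add)
      qed
      also have "\<dots> = C / real N"
        using elim by (simp add: power2_eq_square)
      finally show ?case .
    qed
  qed
  ultimately have "(\<lambda>N. R N + (T N - R N)) \<longlonglongrightarrow> integral {0..a / b} arctan_quot / pi + 0"
    by (rule tendsto_add)
  then show ?thesis
    by (simp add: T_def)
qed

text \<open>Replacing \<open>x\<close> by \<open>y\<close> transposes the array \<open>h\<close>.
  Its terms are positive and both iterated sums diverge, since each row and each column carries
  \<open>1 / (2 * k)\<close>; hence only \<open>N\<close> rows are compared with \<open>N\<close>
  columns. The harmonic parts and the common square of size \<open>N\<close> cancel, and the tails
  \<open>T1 - T2\<close> supply the logarithm.\<close>

theorem lambert_log_reciprocity:
  assumes "x > 0"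
  shows "lambert_log x - lambert_log (4 * pi\<^sup>2 / x) = pi\<^sup>2 / (6 * x) - x / 24 + ln (x / (2 * pi)) / 2"
proof -
  define y where "y = 4 * pi\<^sup>2 / x"
  have y: "y > 0"
    using assms by (simp add: y_def)
  define t where "t = (\<lambda>x k. 1 / (real (Suc k) * (exp (real (Suc k) * x) - 1)))"
  define h where "h = (\<lambda>k m. 2 * x / ((x * real k)\<^sup>2 + (2 * pi * real m)\<^sup>2))"
  have t_sums: "(\<lambda>m. 2 * z / ((z * real (Suc i))\<^sup>2 + (2 * pi * real (Suc m))\<^sup>2)) sums
      (t z i - 1 / z * (1 / (real (Suc i))\<^sup>2) + 1 / (2 * real (Suc i)))" if "z > 0" for z i
  proof -
    define k where "k = real (Suc i)"
    have k: "k > 0" by (simp add: k_def)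
    have "(\<lambda>m. 1 / k * (2 * (k * z) / ((k * z)\<^sup>2 + (2 * pi * real (Suc m))\<^sup>2))) sums
       (1 / k * (1 / (exp (k * z) - 1) - 1 / (k * z) + 1 / 2))"
      using k that by (intro sums_mult sums_inverse_exp_minus_1) auto
    moreover have "1 / k * (2 * (k * z) / ((k * z)\<^sup>2 + (2 * pi * real (Suc m))\<^sup>2)) =
        2 * z / ((z * k)\<^sup>2 + (2 * pi * real (Suc m))\<^sup>2)" for m
      using k by (simp add: mult_ac)
    moreover have "1 / k * (1 / (exp (k * z) - 1) - 1 / (k * z) + 1 / 2) = t z i - 1 / z * (1 / k\<^sup>2) + 1 / (2 * k)"
      using k that by (simp add: t_def k_def[symmetric] ring_distribs power2_eq_square mult_ac del: of_nat_Suc)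
    ultimately show ?thesis
      by (simp only: k_def)
  qed
  have h_y: "2 * y / ((y * real k)\<^sup>2 + (2 * pi * real m)\<^sup>2) = h m k" for k m
  proof -
    have "(y * real k)\<^sup>2 + (2 * pi * real m)\<^sup>2 = (y / x) * ((x * real m)\<^sup>2 + (2 * pi * real k)\<^sup>2)"
      using assms by (simp add: y_def field_simps power2_eq_square)
    then show ?thesis
      using assms y by (simp add: h_def)
  qed
  have row: "(\<lambda>m. h (Suc i) (Suc m)) sums (t x i - 1 / x * (1 / (real (Suc i))\<^sup>2) + 1 / (2 * real (Suc i)))" for i
    using t_sums[OF assms] by (simp add: h_def)
  have col: "(\<lambda>k. h (Suc k) (Suc i)) sums (t y i - 1 / y * (1 / (real (Suc i))\<^sup>2) + 1 / (2 * real (Suc i)))" for i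
    using t_sums[OF y, of i] by (simp only: h_y)
  define T1 where "T1 = (\<lambda>N. \<Sum>i<N. \<Sum>m. h (Suc i) (N + Suc m))"
  define T2 where "T2 = (\<lambda>N. \<Sum>i<N. \<Sum>k. h (N + Suc k) (Suc i))"
  have eq: "(\<Sum>i<N. t x i) - (\<Sum>i<N. t y i) = (1 / x - 1 / y) * (\<Sum>i<N. 1 / (real (Suc i))\<^sup>2) + (T1 N - T2 N)" for N
  proof -
    have 1: "(\<Sum>m. h (Suc i) (N + Suc m)) = t x i - 1 / x * (1 / (real (Suc i))\<^sup>2) + 1 / (2 * real (Suc i)) - (\<Sum>m<N. h (Suc i) (Suc m))" for i
      using suminf_minus_initial_segment[OF sums_summable[OF row[of i]], of N] sums_unique[OF row[of i]]
      by (simp add: add.commute)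
    have 2: "(\<Sum>k. h (N + Suc k) (Suc i)) = t y i - 1 / y * (1 / (real (Suc i))\<^sup>2) + 1 / (2 * real (Suc i)) - (\<Sum>k<N. h (Suc k) (Suc i))" for i
      using suminf_minus_initial_segment[OF sums_summable[OF col[of i]], of N] sums_unique[OF col[of i]]
      by (simp add: add.commute)
    have 3: "(\<Sum>i<N. \<Sum>m<N. h (Suc i) (Suc m)) = (\<Sum>i<N. \<Sum>k<N. h (Suc k) (Suc i))"
      by (rule sum.swap)
    show ?thesis
      unfolding T1_def T2_def 1 2 sum_subtractf sum.distrib 3 sum_distrib_left[symmetric] left_diff_distrib
      by linarith
  qed
  have "2 * x = x * (2 * pi) / pi"
    by simp
  then have lim1: "T1 \<longlonglongrightarrow> integral {0..x / (2 * pi)} arctan_quot / pi"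
    unfolding T1_def h_def using tail_sum_tendsto[OF assms, of "2 * pi"] by (simp only:) simp
  have "2 * x = 2 * pi * x / pi"
    by simp
  then have "T2 \<longlonglongrightarrow> integral {0..2 * pi / x} arctan_quot / pi"
    unfolding T2_def h_def using tail_sum_tendsto[OF _ assms, of "2 * pi"]
    by (simp only: add.commute[of "(x * _)\<^sup>2"]) simp
  with lim1 have "(\<lambda>N. T1 N - T2 N) \<longlonglongrightarrow> (integral {0..x / (2 * pi)} arctan_quot - integral {0..2 * pi / x} arctan_quot) / pi"
    unfolding diff_divide_distrib by (rule tendsto_diff)
  also have "integral {0..x / (2 * pi)} arctan_quot - integral {0..2 * pi / x} arctan_quot = pi / 2 * ln (x / (2 * pi))"
    using arctan_quot_integral_diff[of "x / (2 * pi)"] assms by simp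
  finally have lim2: "(\<lambda>N. T1 N - T2 N) \<longlonglongrightarrow> ln (x / (2 * pi)) / 2"
    by simp
  have squares: "(\<lambda>N. \<Sum>i<N. 1 / (real (Suc i))\<^sup>2) \<longlonglongrightarrow> pi\<^sup>2 / 6"
    using inverse_squares_sums by (simp add: sums_def add.commute)
  have "(\<lambda>N. (\<Sum>i<N. t x i) - (\<Sum>i<N. t y i)) \<longlonglongrightarrow> (1 / x - 1 / y) * (pi\<^sup>2 / 6) + ln (x / (2 * pi)) / 2"
    unfolding eq by (intro tendsto_intros squares lim2)
  moreover have "(\<lambda>N. (\<Sum>i<N. t x i) - (\<Sum>i<N. t y i)) \<longlonglongrightarrow> lambert_log x - lambert_log y"
    unfolding lambert_log_def t_def
    by (intro tendsto_diff summable_LIMSEQ summable_lambert_log assms y)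
  ultimately have "lambert_log x - lambert_log y = (1 / x - 1 / y) * (pi\<^sup>2 / 6) + ln (x / (2 * pi)) / 2"
    using LIMSEQ_unique by blast
  also have "(1 / x - 1 / y) * (pi\<^sup>2 / 6) = pi\<^sup>2 / (6 * x) - x / 24"
    using assms by (simp add: y_def field_simps)
  finally show ?thesis
    by (simp add: y_def)
qed

section \<open>The generating function of the partition numbers\<close>

definition partitions_le :: "nat \<Rightarrow> nat \<Rightarrow> nat list set" where
  "partitions_le k n = {xs \<in> partitions n. \<forall>x\<in>set xs. x \<le> k}"

definition num_partitions_le :: "nat \<Rightarrow> nat \<Rightarrow> nat" where
  "num_partitions_le k n = card (partitions_le k n)"

lemma finite_partitions_le: "finite (partitions_le k n)"
  by (simp add: partitions_le_def finite_partitions)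

lemma num_partitions_le_0: "num_partitions_le 0 n = (if n = 0 then 1 else 0)"
proof -
  have "partitions_le 0 n = (if n = 0 then {[]} else {})"
  proof (rule set_eqI)
    fix xs
    show "xs \<in> partitions_le 0 n \<longleftrightarrow> xs \<in> (if n = 0 then {[]} else {})"
      by (cases xs) (auto simp: partitions_le_def partitions_def)
  qed
  then show ?thesis
    by (simp add: num_partitions_le_def)
qed

text \<open>Either no part equals \<open>Suc k\<close>, or the nonincreasing list begins with it and
  that entry can be removed.\<close>

lemma num_partitions_le_Suc:
  "num_partitions_le (Suc k) n = num_partitions_le k n +
     (if Suc k \<le> n then num_partitions_le (Suc k) (n - Suc k) else 0)"
proof -
  define A where "A = (if Suc k \<le> n then (#) (Suc k) ` partitions_le (Suc k) (n - Suc k) else {})"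
  have "partitions_le (Suc k) n = partitions_le k n \<union> A"
  proof (intro equalityI subsetI)
    fix xs assume xs: "xs \<in> partitions_le (Suc k) n"
    show "xs \<in> partitions_le k n \<union> A"
    proof (cases xs)
      case Nil
      then show ?thesis using xs by (auto simp: partitions_le_def)
    next
      case (Cons y ys)
      show ?thesis
      proof (cases "y = Suc k")
        case True
        then show ?thesis
          using xs Cons by (auto simp: A_def partitions_le_def partitions_def)
      next
        case False
        then have "xs \<in> partitions_le k n"
          using xs Cons by (force simp: partitions_le_def partitions_def)
        then show ?thesis by blast
      qed
    qed
  next
    fix xs assume "xs \<in> partitions_le k n \<union> A"
    then show "xs \<in> partitions_le (Suc k) n"
      by (auto simp: A_def partitions_le_def partitions_def split: if_splits)
  qed
  moreover have "partitions_le k n \<inter> A = {}"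
    by (auto simp: A_def partitions_le_def)
  moreover have "card A = (if Suc k \<le> n then num_partitions_le (Suc k) (n - Suc k) else 0)"
    by (auto simp: A_def num_partitions_le_def card_image)
  moreover have "finite A"
    by (simp add: A_def finite_partitions_le)
  ultimately show ?thesis
    by (simp add: num_partitions_le_def card_Un_disjoint finite_partitions_le)
qed

lemma num_partitions_le_le: "num_partitions_le k n \<le> num_partitions n"
  unfolding num_partitions_le_def num_partitions_def partitions_le_def
  by (intro card_mono finite_partitions) auto

lemma num_partitions_le_eq:
  assumes "n \<le> k"
  shows "num_partitions_le k n = num_partitions n"
proof -
  have "partitions_le k n = partitions n"
    using assms by (auto simp: partitions_le_def partitions_def dest: member_le_sum_list)
  then show ?thesis
    by (simp add: num_partitions_le_def num_partitions_def)
qed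

lemma num_partitions_pos: "num_partitions n > 0"
proof -
  have "replicate n 1 \<in> partitions n"
    by (auto simp: partitions_def sum_list_replicate sorted_wrt_iff_nth_less)
  then show ?thesis
    using finite_partitions[of n] by (auto simp: num_partitions_def card_gt_0_iff)
qed

text \<open>Multiplying the recursion by \<open>x ^ n\<close> and enlarging the shifted range bounds
  the partial sum \<open>S\<close> by the previous one plus \<open>x ^ Suc k * S\<close>. Partial
  sums are used because convergence is a consequence of this bound.\<close>

lemma sum_num_partitions_le_le:
  fixes x :: real
  assumes "0 \<le> x" "x < 1"
  shows "(\<Sum>n<m. real (num_partitions_le k n) * x ^ n) \<le> (\<Prod>j<k. 1 / (1 - x ^ Suc j))"
proof (induction k)
  case 0
  have "(\<Sum>n<m. real (num_partitions_le 0 n) * x ^ n) = (\<Sum>n<m. if n = 0 then 1 else 0)"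
    by (intro sum.cong) (auto simp: num_partitions_le_0)
  then show ?case
    by simp
next
  case (Suc k)
  define S where "S = (\<Sum>n<m. real (num_partitions_le (Suc k) n) * x ^ n)"
  have lt: "x ^ Suc k < 1"
    using assms by (intro power_less_one_iff[THEN iffD2]) auto
  have "S = (\<Sum>n<m. real (num_partitions_le k n) * x ^ n) +
      (\<Sum>n<m. (if Suc k \<le> n then real (num_partitions_le (Suc k) (n - Suc k)) * x ^ n else 0))"
    unfolding S_def sum.distrib[symmetric]
    by (intro sum.cong refl) (subst num_partitions_le_Suc, simp add: ring_distribs)
  also have "(\<Sum>n<m. (if Suc k \<le> n then real (num_partitions_le (Suc k) (n - Suc k)) * x ^ n else 0)) =
      (\<Sum>n\<in>{Suc k..<m}. real (num_partitions_le (Suc k) (n - Suc k)) * x ^ n)"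
    by (auto simp: sum.If_cases intro!: sum.cong)
  also have "\<dots> = (\<Sum>n<m - Suc k. x ^ Suc k * (real (num_partitions_le (Suc k) n) * x ^ n))"
    by (subst sum.atLeastLessThan_shift_0) (simp add: power_add atLeast0LessThan mult_ac)
  also have "\<dots> \<le> (\<Sum>n<m. x ^ Suc k * (real (num_partitions_le (Suc k) n) * x ^ n))"
    using assms by (intro sum_mono2) auto
  also have "\<dots> = x ^ Suc k * S"
    by (simp add: S_def sum_distrib_left)
  finally have "(1 - x ^ Suc k) * S \<le> (\<Prod>j<k. 1 / (1 - x ^ Suc j))"
    using Suc.IH by (simp add: algebra_simps)
  then show ?case
    using lt by (simp add: S_def field_simps)
qed

lemma partitions_le_gf:
  fixes q :: complex
  assumes "norm q < 1"
  shows "summable (\<lambda>n. norm (of_nat (num_partitions_le k n) * q ^ n))"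
    and "(\<Sum>n. of_nat (num_partitions_le k n) * q ^ n) = (\<Prod>j<k. 1 / (1 - q ^ Suc j))"
proof -
  have summable: "summable (\<lambda>n. norm (of_nat (num_partitions_le k n) * q ^ n))" for k
  proof (rule bounded_imp_summable)
    show "(\<Sum>n\<le>m. norm (of_nat (num_partitions_le k n) * q ^ n)) \<le> (\<Prod>j<k. 1 / (1 - norm q ^ Suc j))" for m
      using sum_num_partitions_le_le[of "norm q" k "Suc m"] assms
      by (simp add: norm_mult norm_power lessThan_Suc_atMost del: power_Suc)
  qed auto
  then show "summable (\<lambda>n. norm (of_nat (num_partitions_le k n) * q ^ n))" .
  show "(\<Sum>n. of_nat (num_partitions_le k n) * q ^ n) = (\<Prod>j<k. 1 / (1 - q ^ Suc j))"
  proof (induction k)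
    case 0
    have "(\<lambda>n. of_nat (num_partitions_le 0 n) * q ^ n) sums (\<Sum>n\<in>{0}. of_nat (num_partitions_le 0 n) * q ^ n)"
      by (rule sums_finite) (auto simp: num_partitions_le_0)
    then show ?case
      by (simp add: num_partitions_le_0 sums_iff)
  next
    case (Suc k)
    define S where "S = (\<lambda>k. \<Sum>n. of_nat (num_partitions_le k n) * q ^ n)"
    have sums: "(\<lambda>n. of_nat (num_partitions_le k n) * q ^ n) sums S k" for k
      unfolding S_def by (rule summable_sums[OF summable_norm_cancel[OF summable]])
    have "(\<lambda>n. if n + Suc k < Suc k then 0 else q ^ Suc k * (of_nat (num_partitions_le (Suc k) (n + Suc k - Suc k)) * q ^ (n + Suc k - Suc k))) sums (q ^ Suc k * S (Suc k))"
      using sums_mult[OF sums[of "Suc k"], of "q ^ Suc k"] by simp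
    then have "(\<lambda>n. if n < Suc k then 0 else q ^ Suc k * (of_nat (num_partitions_le (Suc k) (n - Suc k)) * q ^ (n - Suc k))) sums (q ^ Suc k * S (Suc k))"
      by (subst (asm) sums_zero_iff_shift) auto
    with sums[of k] have "(\<lambda>n. of_nat (num_partitions_le k n) * q ^ n +
        (if n < Suc k then 0 else q ^ Suc k * (of_nat (num_partitions_le (Suc k) (n - Suc k)) * q ^ (n - Suc k)))) sums (S k + q ^ Suc k * S (Suc k))"
      by (rule sums_add)
    also have "(\<lambda>n. of_nat (num_partitions_le k n) * q ^ n +
        (if n < Suc k then 0 else q ^ Suc k * (of_nat (num_partitions_le (Suc k) (n - Suc k)) * q ^ (n - Suc k)))) =
        (\<lambda>n. of_nat (num_partitions_le (Suc k) n) * q ^ n)"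
    proof
      fix n
      have "q ^ n = q ^ Suc k * q ^ (n - Suc k)" if "Suc k \<le> n"
        using that by (metis le_add_diff_inverse power_add)
      then show "of_nat (num_partitions_le k n) * q ^ n +
        (if n < Suc k then 0 else q ^ Suc k * (of_nat (num_partitions_le (Suc k) (n - Suc k)) * q ^ (n - Suc k))) =
        of_nat (num_partitions_le (Suc k) n) * q ^ n"
        by (subst (2) num_partitions_le_Suc) (auto simp: ring_distribs mult_ac simp del: power_Suc)
    qed
    finally have "S k + q ^ Suc k * S (Suc k) = S (Suc k)"
      using sums_unique2[OF _ sums] by blast
    then have "S (Suc k) * (1 - q ^ Suc k) = S k"
      by (simp add: algebra_simps)
    moreover have "q ^ Suc k \<noteq> 1"
    proof
      assume "q ^ Suc k = 1"
      then have "norm q ^ Suc k = 1"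
        by (metis norm_one norm_power)
      then show False
        using assms power_less_one_iff[of "norm q" "Suc k"] by simp
    qed
    ultimately have "S (Suc k) = S k / (1 - q ^ Suc k)"
      by (simp add: eq_divide_eq del: power_Suc)
    then show ?case
      using Suc.IH by (simp add: S_def del: power_Suc)
  qed
qed

section \<open>Numerical bounds for pi\<close>

lemma arctan_Taylor_bounds:
  fixes t :: real
  assumes "0 \<le> t"
  shows "t - t ^ 3 / 3 + t ^ 5 / 5 - t ^ 7 / 7 \<le> arctan t" "arctan t \<le> t - t ^ 3 / 3 + t ^ 5 / 5"
proof -
  have "arctan 0 - (0 - 0 ^ 3 / 3 + 0 ^ 5 / 5 - 0 ^ 7 / 7) \<le> arctan t - (t - t ^ 3 / 3 + t ^ 5 / 5 - t ^ 7 / 7)"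
  proof (rule DERIV_nonneg_imp_nondecreasing[OF assms])
    fix s :: real
    have "inverse (1 + s\<^sup>2) - (1 - s\<^sup>2 + s ^ 4 - s ^ 6) = s ^ 8 * inverse (1 + s\<^sup>2)"
      by (simp add: field_simps add_pos_nonneg less_imp_neq[symmetric])
    then have "inverse (1 + s\<^sup>2) - (1 - s\<^sup>2 + s ^ 4 - s ^ 6) \<ge> 0"
      by simp
    moreover have "((\<lambda>t. arctan t - (t - t ^ 3 / 3 + t ^ 5 / 5 - t ^ 7 / 7)) has_real_derivative inverse (1 + s\<^sup>2) - (1 - s\<^sup>2 + s ^ 4 - s ^ 6)) (at s)"
      by (auto intro!: derivative_eq_intros)
    ultimately show "\<exists>y. ((\<lambda>t. arctan t - (t - t ^ 3 / 3 + t ^ 5 / 5 - t ^ 7 / 7)) has_real_derivative y) (at s) \<and> 0 \<le> y"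
      by blast
  qed
  then show "t - t ^ 3 / 3 + t ^ 5 / 5 - t ^ 7 / 7 \<le> arctan t"
    by simp
  have "(0 - 0 ^ 3 / 3 + 0 ^ 5 / 5) - arctan 0 \<le> (t - t ^ 3 / 3 + t ^ 5 / 5) - arctan t"
  proof (rule DERIV_nonneg_imp_nondecreasing[OF assms])
    fix s :: real
    have "(1 - s\<^sup>2 + s ^ 4) - inverse (1 + s\<^sup>2) = s ^ 6 * inverse (1 + s\<^sup>2)"
      by (simp add: field_simps add_pos_nonneg less_imp_neq[symmetric])
    then have "(1 - s\<^sup>2 + s ^ 4) - inverse (1 + s\<^sup>2) \<ge> 0"
      by simp
    moreover have "((\<lambda>t. (t - t ^ 3 / 3 + t ^ 5 / 5) - arctan t) has_real_derivative (1 - s\<^sup>2 + s ^ 4) - inverse (1 + s\<^sup>2)) (at s)"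
      by (auto intro!: derivative_eq_intros)
    ultimately show "\<exists>y. ((\<lambda>t. (t - t ^ 3 / 3 + t ^ 5 / 5) - arctan t) has_real_derivative y) (at s) \<and> 0 \<le> y"
      by blast
  qed
  then show "arctan t \<le> t - t ^ 3 / 3 + t ^ 5 / 5"
    by simp
qed

text \<open>Machin's formula, with the arctangents at 1/5 and 1/239 enclosed by Taylor
  polynomials.\<close>

lemma pi_bounds: "3.1415 < pi" "pi < 3.1417"
  using machin arctan_Taylor_bounds[of "1 / 5"] arctan_Taylor_bounds[of "1 / 239"]
  by (simp_all add: power_divide)

definition partition_gf :: "complex \<Rightarrow> complex" where
  "partition_gf q = (\<Sum>n. of_nat (num_partitions n) * q ^ n)"

section \<open>The infinite Euler product and bounds for its modulus\<close>

lemma suminf_tendsto_dominated: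
  fixes a :: "nat \<Rightarrow> nat \<Rightarrow> 'a :: {real_normed_algebra, banach}"
  assumes "\<And>k. a k \<longlonglongrightarrow> b k" "\<And>k n. norm (a k n) \<le> M k" "summable M"
  shows "(\<lambda>n. \<Sum>k. a k n) \<longlonglongrightarrow> suminf b"
  using tannerys_theorem[OF assms(1), of "\<lambda>k. k" M] assms(2,3) by (simp add: case_prod_unfold)

text \<open>The logarithm of a finite product is a double sum over \<open>i\<close> and
  \<open>j < k\<close>. For fixed \<open>i\<close> the sum over \<open>j\<close> is a partial
  geometric sum bounded by its limit \<open>M i\<close>, so dominated convergence gives the limit in
  \<open>k\<close>.\<close>

lemma euler_product_tendsto:
  assumes "x > 0"
  shows "(\<lambda>k. \<Prod>j<k. 1 / (1 - exp (-x) ^ Suc j)) \<longlonglongrightarrow> exp (lambert_log x)"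
proof -
  define y where "y = exp (-x)"
  have y: "0 < y" "y < 1"
    using assms by (auto simp: y_def)
  have pow: "0 < y ^ Suc j" "y ^ Suc j < 1" for j
    using y power_less_one_iff[of y "Suc j"] by (auto simp del: power_Suc)
  define a where "a = (\<lambda>i k. 1 / real (Suc i) * (\<Sum>j<k. (y ^ Suc i) ^ Suc j))"
  define M where "M = (\<lambda>i. 1 / (real (Suc i) * (exp (real (Suc i) * x) - 1)))"
  have geo: "(\<lambda>j. (y ^ Suc i) ^ Suc j) sums (1 / (exp (real (Suc i) * x) - 1))" for i
  proof -
    define z where "z = y ^ Suc i"
    define e where "e = exp (real (Suc i) * x)"
    have z: "z = 1 / e"
      unfolding z_def e_def y_def exp_of_nat_mult[symmetric] by (simp add: exp_minus inverse_eq_divide del: of_nat_Suc)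
    have e: "e > 1"
      using assms by (simp add: e_def del: of_nat_Suc)
    have "(\<lambda>j. z * z ^ j) sums (z * (1 / (1 - z)))"
      using pow[of i] by (intro sums_mult geometric_sums) (auto simp: z_def simp del: power_Suc)
    moreover have "z * (1 / (1 - z)) = 1 / (e - 1)"
      using e by (simp add: z field_simps)
    ultimately show ?thesis
      by (simp only: z_def e_def power_Suc)
  qed
  have lim: "a i \<longlonglongrightarrow> M i" for i
    using sums_mult[OF geo[of i], of "1 / real (Suc i)"]
    by (simp add: sums_def a_def M_def sum_distrib_left del: of_nat_Suc power_Suc)
  have le: "norm (a i k) \<le> M i" for i k
  proof -
    have "(\<Sum>j<k. (y ^ Suc i) ^ Suc j) \<le> 1 / (exp (real (Suc i) * x) - 1)"
      using sum_le_suminf[OF sums_summable[OF geo[of i]], of "{..<k}"] sums_unique[OF geo[of i]] y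
      by (simp del: of_nat_Suc power_Suc)
    then have "1 / real (Suc i) * (\<Sum>j<k. (y ^ Suc i) ^ Suc j) \<le> 1 / real (Suc i) * (1 / (exp (real (Suc i) * x) - 1))"
      by (intro mult_left_mono) auto
    moreover have "0 \<le> a i k"
      unfolding a_def using y by (intro mult_nonneg_nonneg sum_nonneg) auto
    ultimately show ?thesis
      by (simp add: a_def M_def del: of_nat_Suc power_Suc)
  qed
  have "(\<lambda>k. \<Sum>i. a i k) \<longlonglongrightarrow> suminf M"
    using lim le by (rule suminf_tendsto_dominated) (use summable_lambert_log[OF assms] in \<open>simp add: M_def\<close>)
  moreover have "(\<Sum>i. a i k) = (\<Sum>j<k. - ln (1 - y ^ Suc j))" for k
  proof -
    have "(\<lambda>i. \<Sum>j<k. (y ^ Suc j) ^ Suc i / real (Suc i)) sums (\<Sum>j<k. - ln (1 - y ^ Suc j))"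
    proof (rule sums_sum)
      fix j
      have "(\<lambda>n. (y ^ Suc j) ^ n / real n) sums - ln (1 - y ^ Suc j)"
        using sums_minus[OF ln_series'[of "- (y ^ Suc j)"]] pow[of j] by (simp del: power_Suc)
      then show "(\<lambda>i. (y ^ Suc j) ^ Suc i / real (Suc i)) sums - ln (1 - y ^ Suc j)"
        by (subst sums_Suc_iff) simp
    qed
    moreover have "(\<Sum>j<k. (y ^ Suc j) ^ Suc i / real (Suc i)) = a i k" for i
      unfolding a_def sum_distrib_left by (intro sum.cong refl) (simp add: power_mult[symmetric] mult_ac del: of_nat_Suc power_Suc)
    ultimately show ?thesis
      by (simp add: sums_iff)
  qed
  ultimately have "(\<lambda>k. exp (\<Sum>j<k. - ln (1 - y ^ Suc j))) \<longlonglongrightarrow> exp (lambert_log x)"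
    by (intro tendsto_exp) (simp add: lambert_log_def M_def)
  moreover have "exp (\<Sum>j<k. - ln (1 - y ^ Suc j)) = (\<Prod>j<k. 1 / (1 - y ^ Suc j))" for k
    using pow by (simp add: exp_sum exp_minus inverse_eq_divide del: power_Suc)
  ultimately show ?thesis
    by (simp add: y_def)
qed

lemma euler_product_le:
  assumes "x > 0"
  shows "(\<Prod>j<k. 1 / (1 - exp (-x) ^ Suc j)) \<le> exp (lambert_log x)"
proof (rule incseq_le[OF _ euler_product_tendsto[OF assms]])
  have *: "0 < 1 - exp (-x) ^ Suc j" "1 - exp (-x) ^ Suc j \<le> 1" for j
    using assms power_less_one_iff[of "exp (-x)" "Suc j"] by (auto simp del: power_Suc)
  show "incseq (\<lambda>k. \<Prod>j<k. 1 / (1 - exp (-x) ^ Suc j))"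
  proof (rule incseq_SucI)
    fix k
    have "(\<Prod>j<k. 1 / (1 - exp (-x) ^ Suc j)) * 1 \<le> (\<Prod>j<k. 1 / (1 - exp (-x) ^ Suc j)) * (1 / (1 - exp (-x) ^ Suc k))"
      using * by (intro mult_left_mono prod_nonneg) (auto simp: less_imp_le le_divide_eq simp del: power_Suc)
    then show "(\<Prod>j<k. 1 / (1 - exp (-x) ^ Suc j)) \<le> (\<Prod>j<Suc k. 1 / (1 - exp (-x) ^ Suc j))"
      by (simp del: power_Suc)
  qed
qed

text \<open>A partition of some n up to \<open>m\<close> has no part above \<open>m\<close>, so the
  partial sum is one for bounded parts; the finite products that bound it stay below their
  limit.\<close>

lemma summable_num_partitions:
  fixes q :: complex
  assumes "norm q < 1"
  shows "summable (\<lambda>n. norm (of_nat (num_partitions n) * q ^ n))"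
proof (cases "q = 0")
  case True
  then show ?thesis
    by (intro summable_finite[of "{0}"]) auto
next
  case False
  define x where "x = - ln (norm q)"
  have x: "x > 0" "exp (-x) = norm q"
    using False assms by (auto simp: x_def)
  show ?thesis
  proof (rule bounded_imp_summable)
    fix m
    have "(\<Sum>n\<le>m. norm (of_nat (num_partitions n) * q ^ n)) = (\<Sum>n<Suc m. real (num_partitions_le m n) * norm q ^ n)"
      by (auto simp: norm_mult norm_power num_partitions_le_eq lessThan_Suc_atMost intro!: sum.cong)
    also have "\<dots> \<le> (\<Prod>j<m. 1 / (1 - exp (-x) ^ Suc j))"
      unfolding x using assms by (intro sum_num_partitions_le_le) auto
    also have "\<dots> \<le> exp (lambert_log x)"
      by (rule euler_product_le[OF x(1)])
    finally show "(\<Sum>n\<le>m. norm (of_nat (num_partitions n) * q ^ n)) \<le> exp (lambert_log x)" .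
  qed auto
qed

lemma partition_gf_sums:
  assumes "norm q < 1"
  shows "(\<lambda>n. of_nat (num_partitions n) * q ^ n) sums partition_gf q"
  unfolding partition_gf_def by (rule summable_sums[OF summable_norm_cancel[OF summable_num_partitions[OF assms]]])

lemma partition_gf_product_tendsto:
  assumes "norm q < 1"
  shows "(\<lambda>k. \<Prod>j<k. 1 / (1 - q ^ Suc j)) \<longlonglongrightarrow> partition_gf q"
proof -
  have lim: "(\<lambda>k. of_nat (num_partitions_le k n) * q ^ n) \<longlonglongrightarrow> of_nat (num_partitions n) * q ^ n" for n
  proof (rule tendsto_eventually)
    show "\<forall>\<^sub>F k in sequentially. of_nat (num_partitions_le k n) * q ^ n = of_nat (num_partitions n) * q ^ n"
      using eventually_ge_at_top[of n] by eventually_elim (simp add: num_partitions_le_eq)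
  qed
  have "norm (of_nat (num_partitions_le k n) * q ^ n) \<le> norm (of_nat (num_partitions n) * q ^ n)" for k n
    by (simp add: norm_mult mult_right_mono num_partitions_le_le)
  with lim have "(\<lambda>k. \<Sum>n. of_nat (num_partitions_le k n) * q ^ n) \<longlonglongrightarrow> partition_gf q"
    unfolding partition_gf_def by (rule suminf_tendsto_dominated[OF _ _ summable_num_partitions[OF assms]])
  then show ?thesis
    by (simp add: partitions_le_gf(2)[OF assms] del: power_Suc)
qed

lemma partition_gf_exp_real:
  assumes "x > 0"
  shows "partition_gf (exp (- of_real x)) = of_real (exp (lambert_log x))"
proof -
  have "norm (exp (- of_real x :: complex)) < 1"
    using assms by simp
  note partition_gf_product_tendsto[OF this]
  moreover have "(\<lambda>k. complex_of_real (\<Prod>j<k. 1 / (1 - exp (-x) ^ Suc j))) \<longlonglongrightarrow> of_real (exp (lambert_log x))"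
    by (intro tendsto_of_real euler_product_tendsto assms)
  moreover have "complex_of_real (\<Prod>j<k. 1 / (1 - exp (-x) ^ Suc j)) = (\<Prod>j<k. 1 / (1 - exp (- of_real x) ^ Suc j))" for k
    by (simp add: exp_of_real[symmetric])
  ultimately show ?thesis
    using LIMSEQ_unique by simp
qed

text \<open>
  \<open>|1 - w|\<^sup>2 = (1 - |w|)\<^sup>2 + 2d\<close> with \<open>d = |w| - Re w\<close>, so this is a comparison of the convex function
  \<open>(1 - |w|)\<^sup>2 exp (2d)\<close> with an affine one, which holds at both ends of \<open>0 \<le> d \<le> 2|w|\<close>.
\<close>

lemma one_minus_norm_exp_le:
  fixes w :: complex
  assumes "norm w < 1"
  shows "(1 - norm w) * exp (norm w - Re w) \<le> norm (1 - w)"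
proof -
  define r where "r = norm w"
  define d where "d = r - Re w"
  define f where "f = (\<lambda>t. (1 - r)\<^sup>2 * exp (2 * t))"
  have r: "0 \<le> r" "r < 1" and d: "0 \<le> d" "d \<le> 2 * r"
    using assms complex_Re_le_cmod[of w] abs_Re_le_cmod[of w] by (auto simp: r_def d_def)
  have sq: "(norm (1 - w))\<^sup>2 = (1 - r)\<^sup>2 + 2 * d"
    using cmod_power2[of w] cmod_power2[of "1 - w"] by (simp add: r_def d_def power2_eq_square algebra_simps)
  have endpoint: "f (2 * r) \<le> (1 - r)\<^sup>2 + 2 * (2 * r)"
  proof -
    define g where "g = (\<lambda>t::real. ln (1 + t) - ln (1 - t) - 2 * t)"
    have "g 0 \<le> g r"
    proof (rule DERIV_nonneg_imp_nondecreasing[OF r(1)])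
      fix t assume t: "0 \<le> t" "t \<le> r"
      then have "t < 1" using r by simp
      then have "t * t < 1" using t by (metis mult_le_one mult_strict_mono' order_less_le_trans mult_1 linorder_not_le)
      then have "1 / (1 + t) + 1 / (1 - t) - 2 = 2 * t * t / ((1 + t) * (1 - t))"
        using t \<open>t < 1\<close> by (simp add: field_simps)
      moreover have "\<dots> \<ge> 0"
        using t \<open>t < 1\<close> by simp
      moreover have "(g has_real_derivative 1 / (1 + t) + 1 / (1 - t) - 2) (at t)"
        unfolding g_def using t \<open>t < 1\<close> by (auto intro!: derivative_eq_intros)
      ultimately show "\<exists>y. (g has_real_derivative y) (at t) \<and> 0 \<le> y"
        by metis
    qed
    then have "2 * r \<le> ln ((1 + r) / (1 - r))"
      using r by (simp add: g_def ln_div)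
    then have "exp (2 * r) \<le> (1 + r) / (1 - r)"
      using r by (simp add: ln_ge_iff)
    then have "(1 - r) * exp (2 * r) \<le> 1 + r"
      using r by (simp add: field_simps)
    then have "((1 - r) * exp (2 * r))\<^sup>2 \<le> (1 + r)\<^sup>2"
      using r by (intro power_mono) auto
    then show ?thesis
      by (simp add: f_def power_mult_distrib exp_double[symmetric] power2_eq_square algebra_simps mult_exp_exp)
  qed
  have "f d \<le> (1 - r)\<^sup>2 + 2 * d"
  proof (cases "r = 0")
    case True
    then show ?thesis using d by (simp add: f_def)
  next
    case False
    define s where "s = d / (2 * r)"
    have s: "0 \<le> s" "s \<le> 1" "d = (1 - s) * 0 + s * (2 * r)"
      using d r False by (auto simp: s_def)
    have "convex_on UNIV f"
      unfolding f_def by (intro convex_on_cmul f''_ge0_imp_convex[where f' = "\<lambda>t. 2 * exp (2 * t)" and f'' = "\<lambda>t. 4 * exp (2 * t)"])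
        (auto intro!: derivative_eq_intros)
    then have "f d \<le> (1 - s) * f 0 + s * f (2 * r)"
      using convex_onD[of UNIV f s 0 "2 * r"] s by simp
    also have "\<dots> \<le> (1 - s) * (1 - r)\<^sup>2 + s * ((1 - r)\<^sup>2 + 2 * (2 * r))"
      using endpoint s by (intro add_mono mult_left_mono) (auto simp: f_def)
    also have "\<dots> = (1 - r)\<^sup>2 + 2 * d"
      using s(3) by (simp add: algebra_simps)
    finally show ?thesis .
  qed
  then have "((1 - r) * exp d)\<^sup>2 \<le> (norm (1 - w))\<^sup>2"
    by (simp add: sq f_def power_mult_distrib exp_double)
  then show ?thesis
    unfolding r_def d_def by (rule power2_le_imp_le) simp
qed

text \<open>Applying \<open>one_minus_norm_exp_le\<close> to every factor yields two geometric
  series in the exponent. In effect only the first term of \<open>lambert_log\<close>, which is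
  \<open>1 / (exp x - 1)\<close>, is replaced by the real part belonging to \<open>q\<close>; all
  later terms keep their values at \<open>norm q\<close>.\<close>

lemma norm_partition_gf_le:
  fixes q :: complex
  assumes "x > 0" "norm q = exp (-x)"
  shows "norm (partition_gf q) \<le> exp (lambert_log x - 1 / (exp x - 1) + Re (q / (1 - q)))"
proof -
  define r where "r = norm q"
  have r: "0 \<le> r" "r < 1" "r = exp (-x)"
    using assms by (auto simp: r_def)
  have pow: "r ^ Suc j < 1" for j
    using r by (intro power_less_one_iff[THEN iffD2]) auto
  have "(\<lambda>j. r * r ^ j) sums (r * (1 / (1 - r)))"
    using r by (intro sums_mult geometric_sums) auto
  then have geo1: "(\<lambda>j. r ^ Suc j) sums (1 / (exp x - 1))"
    using assms by (simp add: r exp_minus field_simps)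
  have "(\<lambda>j. q * q ^ j) sums (q * (1 / (1 - q)))"
    using r by (intro sums_mult geometric_sums) (auto simp: r_def)
  then have geo2: "(\<lambda>j. Re (q ^ Suc j)) sums Re (q / (1 - q))"
    by (intro sums_Re) simp
  have "(\<lambda>k. norm (\<Prod>j<k. 1 / (1 - q ^ Suc j))) \<longlonglongrightarrow> norm (partition_gf q)"
    using r by (intro tendsto_norm partition_gf_product_tendsto) (simp add: r_def)
  moreover have "(\<lambda>k. (\<Prod>j<k. 1 / (1 - r ^ Suc j)) * exp (- (\<Sum>j<k. r ^ Suc j) + (\<Sum>j<k. Re (q ^ Suc j))))
      \<longlonglongrightarrow> exp (lambert_log x) * exp (- (1 / (exp x - 1)) + Re (q / (1 - q)))"
    unfolding r(3) using geo1 geo2 unfolding sums_def r(3)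
    by (intro tendsto_mult tendsto_exp tendsto_add tendsto_minus euler_product_tendsto assms)
  moreover have "norm (\<Prod>j<k. 1 / (1 - q ^ Suc j)) \<le> (\<Prod>j<k. 1 / (1 - r ^ Suc j)) * exp (- (\<Sum>j<k. r ^ Suc j) + (\<Sum>j<k. Re (q ^ Suc j)))" for k
  proof -
    have "norm (\<Prod>j<k. 1 / (1 - q ^ Suc j)) = (\<Prod>j<k. 1 / norm (1 - q ^ Suc j))"
      by (simp add: prod_norm[symmetric] norm_divide del: power_Suc)
    also have "\<dots> \<le> (\<Prod>j<k. 1 / (1 - r ^ Suc j) * exp (- (r ^ Suc j) + Re (q ^ Suc j)))"
    proof (intro prod_mono conjI)
      fix j
      have n: "norm (q ^ Suc j) = r ^ Suc j"
        by (simp add: r_def norm_power norm_mult)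
      have "(1 - r ^ Suc j) * exp (r ^ Suc j - Re (q ^ Suc j)) \<le> norm (1 - q ^ Suc j)"
        using one_minus_norm_exp_le[of "q ^ Suc j"] pow[of j] unfolding n by blast
      moreover have "0 < (1 - r ^ Suc j) * exp (r ^ Suc j - Re (q ^ Suc j))"
        using pow[of j] by (simp del: power_Suc)
      ultimately have "1 / norm (1 - q ^ Suc j) \<le> 1 / ((1 - r ^ Suc j) * exp (r ^ Suc j - Re (q ^ Suc j)))"
        by (intro frac_le) (auto simp del: power_Suc)
      also have "\<dots> = 1 / (1 - r ^ Suc j) * exp (- (r ^ Suc j) + Re (q ^ Suc j))"
        using exp_minus[of "r ^ Suc j - Re (q ^ Suc j)"] by (simp add: divide_inverse del: power_Suc)
      finally show "1 / norm (1 - q ^ Suc j) \<le> 1 / (1 - r ^ Suc j) * exp (- (r ^ Suc j) + Re (q ^ Suc j))" .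
    qed simp
    also have "\<dots> = (\<Prod>j<k. 1 / (1 - r ^ Suc j)) * exp (- (\<Sum>j<k. r ^ Suc j) + (\<Sum>j<k. Re (q ^ Suc j)))"
      by (simp only: prod.distrib exp_sum[symmetric] finite_lessThan sum.distrib sum_negf)
    finally show ?thesis .
  qed
  ultimately have "norm (partition_gf q) \<le> exp (lambert_log x) * exp (- (1 / (exp x - 1)) + Re (q / (1 - q)))"
    by (intro LIMSEQ_le) auto
  also have "\<dots> = exp (lambert_log x + (- (1 / (exp x - 1)) + Re (q / (1 - q))))"
    by (rule exp_add[symmetric])
  finally show ?thesis
    by (simp only: diff_conv_add_uminus add.assoc)
qed

lemma holomorphic_partition_gf: "partition_gf holomorphic_on ball 0 1"
  by (rule power_series_holomorphic[where a = "\<lambda>n. of_nat (num_partitions n)"])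
     (use partition_gf_sums in auto)

lemma lambert_log_le:
  assumes "x > 0"
  shows "lambert_log x \<le> pi\<^sup>2 / (6 * x)"
proof -
  have "lambert_log x \<le> (\<Sum>k. 1 / x * (1 / (real (Suc k))\<^sup>2))"
    unfolding lambert_log_def
    by (intro suminf_le lambert_log_term_bounds summable_lambert_log summable_mult summable_inverse_Suc_squared assms)
  also have "\<dots> = 1 / x * (pi\<^sup>2 / 6)"
  proof -
    have "(\<Sum>k. 1 / (real (Suc k))\<^sup>2) = pi\<^sup>2 / 6"
      using inverse_squares_sums by (simp add: sums_iff add.commute)
    then show ?thesis
      by (simp only: suminf_mult[OF summable_inverse_Suc_squared])
  qed
  finally show ?thesis
    by simp
qed

text \<open>The series without its constant term is divisible by \<open>q\<close> and has
  nonnegative coefficients, so its modulus divided by \<open>norm q\<close> is largest at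
  \<open>c = exp (-1)\<close>. There the whole series is at most \<open>exp (pi^2 / 6)\<close>,
  below \<open>exp 2\<close>, and dividing by \<open>c\<close> contributes another
  \<open>exp 1\<close>.\<close>

lemma norm_partition_gf_minus_1_le:
  fixes q :: complex
  assumes "norm q \<le> exp (-1)"
  shows "norm (partition_gf q - 1) \<le> exp 3 * norm q"
proof -
  define c :: complex where "c = exp (- of_real 1)"
  have c: "norm c = exp (-1)" "norm c < 1" "norm q < 1" "c = of_real (exp (-1))"
    using assms order_le_less_trans[of "norm q" "exp (-1)" 1] by (auto simp: c_def exp_of_real[symmetric])
  have sq: "summable (\<lambda>n. norm (of_nat (num_partitions (Suc n)) * q ^ Suc n))"
    using summable_num_partitions[OF c(3)] by (subst summable_Suc_iff)
  have sc: "summable (\<lambda>n. norm (of_nat (num_partitions (Suc n)) * c ^ Suc n))"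
    using summable_num_partitions[OF c(2)] by (subst summable_Suc_iff)
  have "norm (partition_gf q - 1) = norm (\<Sum>n. of_nat (num_partitions (Suc n)) * q ^ Suc n)"
    using suminf_split_head[OF sums_summable[OF partition_gf_sums[OF c(3)]]]
    by (simp add: partition_gf_def num_partitions_0)
  also have "\<dots> \<le> (\<Sum>n. norm (of_nat (num_partitions (Suc n)) * q ^ Suc n))"
    by (rule summable_norm[OF sq])
  also have "\<dots> \<le> (\<Sum>n. exp 1 * norm q * norm (of_nat (num_partitions (Suc n)) * c ^ Suc n))"
  proof (rule suminf_le[OF _ sq summable_mult[OF sc]])
    fix n
    have "norm q * norm q ^ n \<le> norm q * exp (-1) ^ n"
      using assms by (intro mult_left_mono power_mono) auto
    also have "\<dots> = exp 1 * norm q * (exp (-1) * exp (-1) ^ n)"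
      by (simp add: mult_exp_exp flip: mult.assoc)
    finally have "real (num_partitions (Suc n)) * (norm q * norm q ^ n) \<le> real (num_partitions (Suc n)) * (exp 1 * norm q * (exp (-1) * exp (-1) ^ n))"
      by (intro mult_left_mono) auto
    then show "norm (of_nat (num_partitions (Suc n)) * q ^ Suc n) \<le> exp 1 * norm q * norm (of_nat (num_partitions (Suc n)) * c ^ Suc n)"
      unfolding norm_mult norm_power norm_of_nat c(1) power_Suc by (simp only: mult_ac)
  qed
  also have "\<dots> = exp 1 * norm q * (\<Sum>n. norm (of_nat (num_partitions (Suc n)) * c ^ Suc n))"
    by (rule suminf_mult[OF sc])
  also have "(\<Sum>n. norm (of_nat (num_partitions (Suc n)) * c ^ Suc n)) \<le> exp 2"
  proof -
    have "(\<lambda>n. complex_of_real (real (num_partitions n) * exp (-1) ^ n)) sums of_real (exp (lambert_log 1))"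
      using partition_gf_sums[OF c(2)] partition_gf_exp_real[of 1] by (simp add: c_def exp_of_real[symmetric])
    then have s: "(\<lambda>n. real (num_partitions n) * exp (-1) ^ n) sums exp (lambert_log 1)"
      by (subst (asm) sums_of_real_iff)
    have "(\<Sum>n. norm (of_nat (num_partitions (Suc n)) * c ^ Suc n)) = (\<Sum>n. real (num_partitions (Suc n)) * exp (-1) ^ Suc n)"
      by (simp add: norm_mult norm_power c)
    also have "\<dots> \<le> exp (lambert_log 1)"
      using suminf_split_head[OF sums_summable[OF s]] sums_unique[OF s] by (simp add: num_partitions_0)
    also have "\<dots> \<le> exp (pi\<^sup>2 / 6)"
      using lambert_log_le[of 1] by simp
    also have "\<dots> \<le> exp 2"
    proof -
      have "pi * pi \<le> 3.2 * 3.2"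
        using pi_bounds by (intro mult_mono) auto
      then show ?thesis by (simp add: power2_eq_square)
    qed
    finally show ?thesis .
  qed
  finally have "norm (partition_gf q - 1) \<le> exp 1 * norm q * exp 2"
    by (simp add: mult_left_mono)
  also have "\<dots> = exp 3 * norm q"
    by (simp add: mult_exp_exp mult_ac)
  finally show ?thesis .
qed

lemma partition_gf_functional_equation:
  fixes z :: complex
  assumes "Re z > 0"
  shows "partition_gf (exp (-z)) =
    csqrt (z / (2 * pi)) * exp (pi\<^sup>2 / (6 * z) - z / 24) * partition_gf (exp (- (4 * pi\<^sup>2 / z)))"
proof -
  define S where "S = {z. Re z > 0}"
  define U where "U = complex_of_real ` {0<..}"
  define f where "f = (\<lambda>z::complex. partition_gf (exp (-z)) -
    csqrt (z / (2 * pi)) * exp (pi\<^sup>2 / (6 * z) - z / 24) * partition_gf (exp (- (4 * pi\<^sup>2 / z))))"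
  have nz: "z \<noteq> 0" if "z \<in> S" for z
    using that by (auto simp: S_def)
  have Re_quot: "Re (4 * complex_of_real pi ^ 2 / z) > 0" if "z \<in> S" for z
  proof -
    have "Re (complex_of_real (4 * pi\<^sup>2) / z) = 4 * pi\<^sup>2 * Re z / (norm z)\<^sup>2"
      by (simp only: Re_divide cmod_power2) simp
    then show ?thesis
      using that nz[OF that] by (simp add: S_def)
  qed
  \<comment> \<open>The right half-plane avoids the cut, so the principal root is holomorphic and
    agrees with the positive root on the real ray \<open>U\<close>.\<close>
  have slit: "z / (2 * pi) \<notin> \<real>\<^sub>\<le>\<^sub>0" if "z \<in> S" for z
  proof -
    have "Re (z / complex_of_real (2 * pi)) > 0"
      using that by (simp only: Re_divide_of_real) (simp add: S_def)
    then show ?thesis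
      by (auto simp: complex_nonpos_Reals_iff)
  qed
  have "f z = 0"
  proof (rule analytic_continuation[of f S U 1])
    have "(partition_gf \<circ> (\<lambda>z. exp (-z))) holomorphic_on S"
      by (rule holomorphic_on_compose_gen[OF _ holomorphic_partition_gf]) (auto intro!: holomorphic_intros simp: S_def)
    moreover have "(partition_gf \<circ> (\<lambda>z. exp (- (4 * pi\<^sup>2 / z)))) holomorphic_on S"
      by (rule holomorphic_on_compose_gen[OF _ holomorphic_partition_gf])
         (use nz Re_quot in \<open>auto intro!: holomorphic_intros\<close>)
    moreover have "(\<lambda>z. csqrt (z / (2 * pi))) holomorphic_on S"
      using slit by (intro holomorphic_on_csqrt' holomorphic_intros) auto
    ultimately show "f holomorphic_on S"
      unfolding f_def o_def using nz slit by (intro holomorphic_intros) auto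
    show "open S"
      unfolding S_def by (simp add: open_halfspace_Re_gt)
    show "connected S"
      unfolding S_def by (intro convex_connected convex_halfspace_Re_gt)
    show "U \<subseteq> S" "1 \<in> S"
      by (auto simp: U_def S_def)
    show "z \<in> S"
      using assms by (simp add: S_def)
    show "1 islimpt U"
      unfolding islimpt_approachable
    proof (intro allI impI)
      fix e :: real assume "e > 0"
      then have "complex_of_real (1 + e / 2) \<in> U"
        unfolding U_def by (intro imageI) auto
      then show "\<exists>x'\<in>U. x' \<noteq> 1 \<and> dist x' 1 < e"
        by (rule bexI[rotated]) (use \<open>e > 0\<close> in \<open>auto simp: dist_norm\<close>)
    qed
    show "f w = 0" if "w \<in> U" for w
    proof -
      obtain x where "w = of_real x" "x \<in> {0<..}"
        using \<open>w \<in> U\<close> unfolding U_def by (rule imageE)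
      then have x: "x > 0" "w = of_real x"
        by simp_all
      have "exp (lambert_log x) = exp (ln (x / (2 * pi)) / 2 + (pi\<^sup>2 / (6 * x) - x / 24) + lambert_log (4 * pi\<^sup>2 / x))"
        using lambert_log_reciprocity[OF x(1)] by (simp add: algebra_simps)
      also have "\<dots> = sqrt (x / (2 * pi)) * exp (pi\<^sup>2 / (6 * x) - x / 24) * exp (lambert_log (4 * pi\<^sup>2 / x))"
      proof -
        have "sqrt (x / (2 * pi)) = exp (ln (x / (2 * pi)) / 2)"
          using x by (simp add: ln_sqrt[symmetric])
        then show ?thesis
          by (simp only: exp_add)
      qed
      finally have "complex_of_real (exp (lambert_log x)) = of_real (sqrt (x / (2 * pi))) * of_real (exp (pi\<^sup>2 / (6 * x) - x / 24)) * of_real (exp (lambert_log (4 * pi\<^sup>2 / x)))"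
        by (simp only: of_real_mult)
      moreover have "csqrt (complex_of_real x / (2 * pi)) = of_real (sqrt (x / (2 * pi)))"
        using of_real_sqrt[of "x / (2 * pi)"] x by simp
      moreover have "partition_gf (exp (- (4 * complex_of_real pi ^ 2 / x))) = of_real (exp (lambert_log (4 * pi\<^sup>2 / x)))"
        using partition_gf_exp_real[of "4 * pi\<^sup>2 / x"] x by simp
      ultimately show ?thesis
        using partition_gf_exp_real[OF x(1)] by (simp add: f_def x exp_of_real[symmetric])
    qed
  qed
  then show ?thesis
    by (simp add: f_def)
qed

text \<open>Cauchy's coefficient formula with \<open>q = exp (- z)\<close>: the segment is one turn
  of the circle of radius \<open>exp (- r)\<close>. The series converges uniformly on it, and each
  term with \<open>k\<close> different from \<open>n\<close> has a primitive of period
  \<open>2 * pi * \<i>\<close>.\<close>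

lemma contour_integral_partition_gf:
  assumes "r > 0"
  shows "contour_integral (linepath (Complex r (-pi)) (Complex r pi)) (\<lambda>z. partition_gf (exp (-z)) * exp (of_nat n * z))
     = 2 * pi * \<i> * of_nat (num_partitions n)"
proof -
  let ?\<gamma> = "linepath (Complex r (-pi)) (Complex r pi)"
  define t where "t = (\<lambda>k z. of_nat (num_partitions k) * exp ((of_nat n - of_nat k) * z) :: complex)"
  define F where "F = (\<lambda>K z. \<Sum>k<K. t k z)"
  have q: "norm (exp (- of_real r) :: complex) < 1"
    using assms by simp
  have Re: "Re z = r" if "z \<in> path_image ?\<gamma>" for z
    using that by (force simp: path_image_linepath closed_segment_def left_diff_distrib)
  have t_eq: "t k z = (of_nat (num_partitions k) * exp (-z) ^ k) * exp (of_nat n * z)" for k z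
  proof -
    have "exp ((of_nat n - of_nat k) * z) = exp (-z) ^ k * exp (of_nat n * z)"
      unfolding exp_of_nat_mult[of k "-z", symmetric] exp_add[symmetric] by (simp add: algebra_simps)
    then show ?thesis
      by (simp add: t_def)
  qed
  have lim: "uniform_limit (path_image ?\<gamma>) F (\<lambda>z. \<Sum>k. t k z) sequentially"
    unfolding F_def
  proof (rule Weierstrass_m_test)
    show "summable (\<lambda>k. norm (of_nat (num_partitions k) * exp (- of_real r :: complex) ^ k) * exp (real n * r))"
      by (intro summable_mult2 summable_num_partitions q)
    show "norm (t k z) \<le> norm (of_nat (num_partitions k) * exp (- of_real r :: complex) ^ k) * exp (real n * r)" if "z \<in> path_image ?\<gamma>" for k z
      using Re[OF that] by (simp add: t_eq norm_mult norm_power)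
  qed
  have int_t: "(t k has_contour_integral (if k = n then 2 * pi * \<i> * of_nat (num_partitions n) else 0)) ?\<gamma>" for k
  proof (cases "k = n")
    case True
    have "((\<lambda>z. of_nat (num_partitions n)) has_contour_integral of_nat (num_partitions n) * (Complex r pi - Complex r (-pi))) ?\<gamma>"
      by (rule has_contour_integral_const_linepath)
    also have "of_nat (num_partitions n) * (Complex r pi - Complex r (-pi)) = 2 * pi * \<i> * of_nat (num_partitions n)"
      by (simp add: complex_eq_iff)
    finally show ?thesis
      using True by (simp add: t_def)
  next
    case False
    define c where "c = (of_nat n - of_nat k :: complex)"
    have c: "c \<noteq> 0"
      using False by (simp add: c_def)
    define P where "P = (\<lambda>z. of_nat (num_partitions k) * exp (c * z) / c)"
    have "(t k has_contour_integral P (pathfinish ?\<gamma>) - P (pathstart ?\<gamma>)) ?\<gamma>"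
    proof (rule contour_integral_primitive)
      show "(P has_field_derivative t k z) (at z within UNIV)" for z
        unfolding P_def t_def c_def[symmetric] using c by (auto intro!: derivative_eq_intros)
    qed auto
    moreover have "exp (c * Complex r pi) = exp (c * Complex r (-pi))"
    proof -
      have "c * Complex r pi = c * Complex r (-pi) + complex_of_real (2 * of_int (int n - int k) * pi) * \<i>"
        by (simp add: c_def complex_eq_iff algebra_simps)
      then show ?thesis
        unfolding exp_eq by (intro exI[of _ "int n - int k"]) simp
    qed
    ultimately show ?thesis
      using False by (simp add: P_def)
  qed
  have F_int: "(F K has_contour_integral (\<Sum>k<K. if k = n then 2 * pi * \<i> * of_nat (num_partitions n) else 0)) ?\<gamma>" for K
    unfolding F_def by (intro has_contour_integral_sum int_t) auto
  have "(\<lambda>K. contour_integral ?\<gamma> (F K)) \<longlonglongrightarrow> contour_integral ?\<gamma> (\<lambda>z. \<Sum>k. t k z)"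
  proof (rule contour_integral_uniform_limit(2)[OF _ lim])
    show "\<forall>\<^sub>F K in sequentially. F K contour_integrable_on ?\<gamma>"
      by (intro always_eventually allI has_contour_integral_integrable[OF F_int])
    show "norm (vector_derivative ?\<gamma> (at s)) \<le> norm (Complex r pi - Complex r (-pi))" if "s \<in> {0..1}" for s
      by simp
  qed auto
  moreover have "(\<lambda>K. contour_integral ?\<gamma> (F K)) \<longlonglongrightarrow> 2 * pi * \<i> * of_nat (num_partitions n)"
  proof (rule tendsto_eventually)
    show "\<forall>\<^sub>F K in sequentially. contour_integral ?\<gamma> (F K) = 2 * pi * \<i> * of_nat (num_partitions n)"
      using eventually_gt_at_top[of n]
      by eventually_elim (simp add: contour_integral_unique[OF F_int])
  qed
  ultimately have "contour_integral ?\<gamma> (\<lambda>z. \<Sum>k. t k z) = 2 * pi * \<i> * of_nat (num_partitions n)"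
    using LIMSEQ_unique by blast
  moreover have "contour_integral ?\<gamma> (\<lambda>z. \<Sum>k. t k z) = contour_integral ?\<gamma> (\<lambda>z. partition_gf (exp (-z)) * exp (of_nat n * z))"
  proof (rule contour_integral_eq)
    fix z assume "z \<in> path_image ?\<gamma>"
    then have "norm (exp (-z)) < 1"
      using Re assms by simp
    from sums_mult2[OF partition_gf_sums[OF this], of "exp (of_nat n * z)"]
    show "(\<Sum>k. t k z) = partition_gf (exp (-z)) * exp (of_nat n * z)"
      by (simp add: t_eq[abs_def] sums_iff)
  qed
  ultimately show ?thesis
    by simp
qed

section \<open>The saddle point estimate\<close>

lemma gaussian_integral_bounds:
  fixes T :: real
  assumes "T > 0"
  shows "integral {-T..T} (\<lambda>x. exp (- x\<^sup>2)) \<le> sqrt pi"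
    and "sqrt pi - 2 * exp (- T\<^sup>2) / T \<le> integral {-T..T} (\<lambda>x. exp (- x\<^sup>2))"
proof -
  define h where "h = (\<lambda>x::real. exp (- x\<^sup>2))"
  have int: "h integrable_on {a..b}" for a b
    unfolding h_def by (intro integrable_continuous_real continuous_intros)
  have half: "(h has_integral sqrt pi / 2) {0..}"
  proof -
    have "has_bochner_integral lborel (\<lambda>x. indicator {0..} x *\<^sub>R exp (- x\<^sup>2)) (sqrt pi / 2)"
      by (rule gaussian_moment_0)
    then have "((\<lambda>x. indicator {0..} x *\<^sub>R exp (- x\<^sup>2)) has_integral sqrt pi / 2) (UNIV :: real set)"
      by (metis has_bochner_integral_iff has_integral_integral_lborel)
    also have "(\<lambda>x::real. indicator {0..} x *\<^sub>R exp (- x\<^sup>2)) = (\<lambda>x. if x \<in> {0..} then h x else 0)"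
      by (auto simp: h_def indicator_def)
    finally show ?thesis
      by (simp only: has_integral_restrict_UNIV)
  qed
  have "integral {-T..T} h = integral {-T..0} h + integral {0..T} h"
    using Henstock_Kurzweil_Integration.integral_combine[of "-T" 0 T h] int assms by simp
  also have "integral {-T..0} h = integral {0..T} h"
    using Henstock_Kurzweil_Integration.integral_reflect_real[of T 0 h] by (simp add: h_def)
  finally have eq: "integral {-T..T} h = 2 * integral {0..T} h"
    by simp
  have "(h has_integral integral {0..T} h) {0..T}"
    using int by (simp add: integrable_integral)
  then have le: "integral {0..T} h \<le> sqrt pi / 2"
    using half by (rule has_integral_subset_le[rotated]) (auto simp: h_def)
  \<comment> \<open>For \<open>x >= T\<close> one has \<open>x^2 >= T * x\<close>, so the tail is
    dominated by an exponential with an explicit integral.\<close>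
  have tail: "((\<lambda>x. exp (- T * x)) has_integral exp (- T * T) / T) {T..}"
    using has_integral_exp_minus_to_infinity[OF assms] by simp
  have majorant: "((\<lambda>x. (if x \<in> {0..T} then h x else 0) + (if x \<in> {T..} then exp (- T * x) else 0)) has_integral
      integral {0..T} h + exp (- T * T) / T) UNIV"
    using tail int by (intro has_integral_add) (simp_all only: has_integral_restrict_UNIV integrable_integral)
  have "((\<lambda>x. if x \<in> {0..} then h x else 0) has_integral sqrt pi / 2) UNIV"
    using half by (simp only: has_integral_restrict_UNIV)
  from has_integral_le[OF this majorant] have "sqrt pi / 2 \<le> integral {0..T} h + exp (- T * T) / T"
    by (rule meta_mp) (use assms in \<open>auto simp: h_def power2_eq_square mult_right_mono\<close>)
  then show "sqrt pi - 2 * exp (- T\<^sup>2) / T \<le> integral {-T..T} (\<lambda>x. exp (- x\<^sup>2))"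
    using eq by (simp add: h_def power2_eq_square)
  show "integral {-T..T} (\<lambda>x. exp (- x\<^sup>2)) \<le> sqrt pi"
    using eq le by (simp add: h_def)
qed

lemma norm_csqrt: "norm (csqrt z) = sqrt (norm z)"
proof -
  have "norm (csqrt z) ^ 2 = norm z"
    by (simp flip: norm_power)
  then show ?thesis
    by (intro real_sqrt_unique[symmetric]) auto
qed

lemma Re_of_real_times: "Re (of_real c * z) = c * Re z"
  by simp

lemma Re_of_real_over: "Re (of_real c / z) = c * Re (1 / z)"
  using Re_of_real_times[of c "1 / z"] by (simp only: times_divide_eq_right mult_1_right)

text \<open>The exponent \<open>\<pi>\<^sup>2 / (6 z) + (n - 1/24) z\<close> of the integrand is stationary at \<open>z = r\<close>, where both summands equal \<open>B\<close>.\<close>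

locale saddle_point =
  fixes n :: nat and r :: real
  assumes r_pos: "r > 0" and r_le: "r \<le> 1 / 33" and r_eq: "real n - 1 / 24 = pi\<^sup>2 / (6 * r\<^sup>2)"
begin

definition B :: real where "B = pi\<^sup>2 / (6 * r)"

definition f :: "complex \<Rightarrow> complex" where
  "f z = partition_gf (exp (-z)) * exp (of_nat n * z)"

text \<open>The integrand after the modular relation with the dual factor replaced by 1; the summand
  \<open>- z / 24\<close> of that relation is merged with \<open>n * z\<close>.\<close>

definition g :: "complex \<Rightarrow> complex" where
  "g z = csqrt (z / of_real (2 * pi)) * exp (of_real (pi\<^sup>2 / 6) / z + of_real (real n - 1 / 24) * z)"

lemma B_pos: "B > 0"
  using r_pos by (simp add: B_def)

lemma r_B: "pi\<^sup>2 / 6 / r = B" "(real n - 1 / 24) * r = B"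
  using r_pos by (simp_all add: B_def r_eq power2_eq_square)

lemma holomorphic_f: "f holomorphic_on {z. Re z > 0}"
proof -
  have "(partition_gf \<circ> (\<lambda>z. exp (-z))) holomorphic_on {z. Re z > 0}"
    by (rule holomorphic_on_compose_gen[OF _ holomorphic_partition_gf]) (auto intro!: holomorphic_intros)
  then show ?thesis
    unfolding f_def[abs_def] o_def by (intro holomorphic_intros)
qed

lemma f_eq:
  assumes "Re z > 0"
  shows "f z = g z * partition_gf (exp (- (of_real (4 * pi\<^sup>2) / z)))"
proof -
  have "z \<noteq> 0"
    using assms by auto
  have "exp (pi\<^sup>2 / (6 * z) - z / 24) * exp (of_nat n * z) = exp (of_real (pi\<^sup>2 / 6) / z + of_real (real n - 1 / 24) * z)"
    by (simp add: exp_add[symmetric] algebra_simps)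
  then show ?thesis
    unfolding f_def g_def partition_gf_functional_equation[OF assms] by (simp add: mult_ac)
qed

lemma norm_g: "norm (g z) = sqrt (norm z / (2 * pi)) * exp (pi\<^sup>2 / 6 * Re (1 / z) + (real n - 1 / 24) * Re z)"
proof -
  have "norm z / \<bar>2 * pi\<bar> = norm z / (2 * pi)"
    by simp
  then show ?thesis
    unfolding g_def norm_mult norm_csqrt norm_divide norm_of_real norm_exp_eq_Re
    by (simp only: plus_complex.sel Re_of_real_times Re_of_real_over)
qed

lemma norm_dual_minus_1_le:
  assumes "4 * pi\<^sup>2 * Re (1 / z) \<ge> 1"
  shows "norm (partition_gf (exp (- (of_real (4 * pi\<^sup>2) / z))) - 1) \<le> exp (3 - 4 * pi\<^sup>2 * Re (1 / z))"
proof -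
  have "norm (exp (- (of_real (4 * pi\<^sup>2) / z))) = exp (- (4 * pi\<^sup>2 * Re (1 / z)))"
    by (simp only: norm_exp_eq_Re uminus_complex.sel Re_of_real_over)
  then show ?thesis
    using norm_partition_gf_minus_1_le[of "exp (- (of_real (4 * pi\<^sup>2) / z))"] assms
    by (simp add: exp_diff exp_minus divide_inverse)
qed

text \<open>By \<open>norm_partition_gf_le\<close> it suffices to see how much of
  \<open>1 / (exp r - 1)\<close> is lost off the real axis; from height \<open>5 * r\<close> on it
  is at least 95 percent, hence about \<open>0.95 / r\<close>. The 1/2 in the exponent absorbs
  \<open>95 / 200 + r / 24\<close>.\<close>

lemma norm_f_vertical_le:
  assumes "5 * r \<le> \<bar>y\<bar>" "\<bar>y\<bar> \<le> pi"
  shows "norm (f (Complex r y)) \<le> sqrt (r / (2 * pi)) * exp (2 * B + 1 / 2 - 95 / 100 / r)"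
proof -
  define q where "q = exp (- Complex r y)"
  define \<rho> where "\<rho> = exp (-r)"
  have \<rho>: "0 < \<rho>" "\<rho> < 1" "1 - \<rho> \<le> r"
    using r_pos exp_ge_add_one_self[of "-r"] by (auto simp: \<rho>_def)
  have q: "norm q = \<rho>" "Re q = \<rho> * cos y"
    by (simp_all add: q_def \<rho>_def Re_exp)
  \<comment> \<open>The true value of \<open>1 - cos (5 * r)\<close> is about
    \<open>12.5 * r^2\<close>. Using 2.45 in place of 5/2 covers the cubic error of the sine, and
    \<open>2 * 2.45^2\<close> still exceeds 12.\<close>
  have cos: "cos y \<le> 1 - 12 * r\<^sup>2"
  proof -
    have "cos y = cos \<bar>y\<bar>"
      by (simp add: abs_if)
    also have "\<dots> \<le> cos (5 * r)"
      using assms r_pos by (intro cos_monotone_0_pi_le) auto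
    also have "\<dots> = 1 - 2 * (sin (5 * r / 2))\<^sup>2"
      using cos_double_sin[of "5 * r / 2"] by simp
    also have "\<dots> \<le> 1 - 2 * (245 / 100 * r)\<^sup>2"
    proof -
      have "\<bar>sin (5 * r / 2) - 5 * r / 2\<bar> \<le> (5 * r / 2) ^ 3 / 6"
        using Maclaurin_sin_bound[of "5 * r / 2" 3] r_pos
        by (simp add: sin_coeff_def eval_nat_numeral power3_eq_cube)
      moreover have "(5 * r / 2) ^ 3 / 6 \<le> r * (5 / 100)"
      proof -
        have "r * r \<le> 1 / 33 * (1 / 33)"
          using r_pos r_le by (intro mult_mono) auto
        then have "r * (r * r * (125 / 48)) \<le> r * (5 / 100)"
          using r_pos by (intro mult_left_mono) auto
        then show ?thesis
          by (simp add: power3_eq_cube)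
      qed
      ultimately have "245 / 100 * r \<le> sin (5 * r / 2)"
        by linarith
      then show ?thesis
        using r_pos by (simp add: power_mono)
    qed
    also have "\<dots> \<le> 1 - 12 * r\<^sup>2"
      by (simp add: power2_eq_square)
    finally show ?thesis .
  qed
  have "Re (q / (1 - q)) \<le> 5 / 100 * (1 / (exp r - 1))"
  proof -
    \<comment> \<open>The second summand turns out to be at least 19 times the first, so the real
      part drops to at most 1/20 of its value at \<open>q = \<rho>\<close>.\<close>
    define D where "D = (1 - \<rho>)\<^sup>2 + 2 * \<rho> * (1 - cos y)"
    have norm: "(norm (1 - q))\<^sup>2 = D"
    proof -
      have "(norm (1 - q))\<^sup>2 = 1 - 2 * Re q + (norm q)\<^sup>2"
        unfolding cmod_power2 by (simp add: power2_eq_square algebra_simps)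
      then show ?thesis
        by (simp add: q D_def power2_eq_square algebra_simps)
    qed
    have "q \<noteq> 1"
      using q \<rho> by auto
    then have "D > 0"
      unfolding norm[symmetric] by simp
    have "Re (q / (1 - q)) = (Re q - (norm q)\<^sup>2) / D"
      unfolding norm[symmetric] Re_divide cmod_power2 by (simp add: power2_eq_square algebra_simps)
    also have "\<dots> = \<rho> * (cos y - \<rho>) / D"
      by (simp add: q power2_eq_square algebra_simps)
    also have "\<dots> \<le> 5 / 100 * (\<rho> / (1 - \<rho>))"
    proof -
      have "19 * (1 - \<rho>)\<^sup>2 \<le> 19 * r\<^sup>2"
        using \<rho> by (intro mult_left_mono power_mono) auto
      also have "\<dots> \<le> 2 * (32 / 33) * (12 * r\<^sup>2)"
        by simp
      also have "\<dots> \<le> 2 * \<rho> * (1 - cos y)"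
        using \<rho> r_le cos by (intro mult_mono) auto
      finally have "20 * (1 - \<rho>)\<^sup>2 \<le> D"
        by (simp add: D_def)
      moreover have "(cos y - \<rho>) * (1 - \<rho>) \<le> (1 - \<rho>)\<^sup>2"
        unfolding power2_eq_square using \<rho> by (intro mult_right_mono) auto
      ultimately have "20 * ((cos y - \<rho>) * (1 - \<rho>)) \<le> D"
        by linarith
      then have "(cos y - \<rho>) / D \<le> 5 / 100 * (1 / (1 - \<rho>))"
        using \<open>D > 0\<close> \<rho> by (simp add: field_simps)
      then have "\<rho> * ((cos y - \<rho>) / D) \<le> \<rho> * (5 / 100 * (1 / (1 - \<rho>)))"
        using \<rho> by (intro mult_left_mono) auto
      then show ?thesis
        by simp
    qed
    also have "\<rho> / (1 - \<rho>) = 1 / (exp r - 1)"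
      using r_pos by (simp add: \<rho>_def exp_minus field_simps)
    finally show ?thesis .
  qed
  then have "lambert_log r - 1 / (exp r - 1) + Re (q / (1 - q)) \<le> lambert_log r - 95 / 100 * (1 / (exp r - 1))"
    by linarith
  moreover have "norm (partition_gf q) \<le> exp (lambert_log r - 1 / (exp r - 1) + Re (q / (1 - q)))"
    using norm_partition_gf_le[OF r_pos, of q] q by (simp add: \<rho>_def)
  ultimately have "norm (partition_gf q) \<le> exp (lambert_log r - 95 / 100 * (1 / (exp r - 1)))"
    by (meson exp_le_cancel_iff order_trans)
  \<comment> \<open>Reciprocity expresses \<open>lambert_log r\<close> through \<open>B\<close>; the
    dual value is at most \<open>r / 24\<close> and is cancelled by the term
    \<open>- r / 24\<close>. The partial fractions give
    \<open>1 / (exp r - 1) >= 1 / r - 1 / 2\<close>.\<close>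
  also have "\<dots> \<le> exp (B + ln (r / (2 * pi)) / 2 - 95 / 100 * (1 / r - 1 / 2))"
  proof -
    define a b where "a = 1 / (exp r - 1)" and "b = 1 / r"
    have "0 \<le> (\<Sum>k. 2 * r / (r\<^sup>2 + (2 * pi * real (Suc k))\<^sup>2))"
      using r_pos by (intro suminf_nonneg sums_summable[OF sums_inverse_exp_minus_1]) auto
    then have "1 / r - 1 / 2 \<le> 1 / (exp r - 1)"
      using sums_unique[OF sums_inverse_exp_minus_1[OF r_pos]] by simp
    moreover have "lambert_log (4 * pi\<^sup>2 / r) \<le> r / 24"
      using lambert_log_le[of "4 * pi\<^sup>2 / r"] r_pos by simp
    ultimately show ?thesis
      using lambert_log_reciprocity[OF r_pos] unfolding exp_le_cancel_iff B_def a_def[symmetric] b_def[symmetric] by argo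
  qed
  finally have "norm (partition_gf q) \<le> exp (B + ln (r / (2 * pi)) / 2 - 95 / 100 * (1 / r - 1 / 2))" .
  moreover have "norm (exp (of_nat n * Complex r y)) = exp (B + r / 24)"
  proof -
    have "real n * r = B + r / 24"
      using r_B(2) by (simp add: algebra_simps)
    then show ?thesis
      by simp
  qed
  ultimately have "norm (f (Complex r y)) \<le> exp (B + ln (r / (2 * pi)) / 2 - 95 / 100 * (1 / r - 1 / 2)) * exp (B + r / 24)"
    unfolding f_def q_def norm_mult by (intro mult_mono) auto
  also have "\<dots> = exp (ln (r / (2 * pi)) / 2) * exp (2 * B + (r / 24 + 95 / 200) - 95 / 100 / r)"
    unfolding exp_add[symmetric] by (rule arg_cong[where f = exp]) argo
  also have "exp (ln (r / (2 * pi)) / 2) = sqrt (r / (2 * pi))"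
    using r_pos by (simp add: ln_sqrt[symmetric])
  also have "sqrt (r / (2 * pi)) * exp (2 * B + (r / 24 + 95 / 200) - 95 / 100 / r) \<le> sqrt (r / (2 * pi)) * exp (2 * B + 1 / 2 - 95 / 100 / r)"
    using r_pos r_le by (intro mult_left_mono) auto
  finally show ?thesis .
qed

lemma saddle_exponent:
  assumes "z = of_real r * \<zeta>"
  shows "pi\<^sup>2 / 6 * Re (1 / z) + (real n - 1 / 24) * Re z = B * (Re (1 / \<zeta>) + Re \<zeta>)"
proof -
  have "Re (1 / z) = Re (1 / \<zeta>) / r"
    using Re_of_real_times[of "1 / r" "1 / \<zeta>"] by (simp add: assms)
  moreover have "Re z = r * Re \<zeta>"
    by (simp add: assms)
  moreover have "pi\<^sup>2 / 6 * (Re (1 / \<zeta>) / r) = pi\<^sup>2 / 6 / r * Re (1 / \<zeta>)"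
    by simp
  moreover have "(real n - 1 / 24) * (r * Re \<zeta>) = (real n - 1 / 24) * r * Re \<zeta>"
    by (simp only: mult.assoc)
  ultimately show ?thesis
    by (simp only: r_B distrib_left)
qed

text \<open>Since \<open>Re (1 / \<zeta>)\<close> is at most \<open>1 / (2 * |Im \<zeta>|)\<close>,
  the sum \<open>Re (1 / \<zeta>) + Re \<zeta>\<close> stays below 1.11 on the segment, far from its
  value 2 at the saddle point. The dual factor is at most 2 in modulus because
  \<open>Re (1 / z)\<close> remains large.\<close>

lemma norm_f_segment_le:
  assumes "\<zeta> \<in> closed_segment (Complex (1 / 2) (\<sigma> * (sqrt 3 / 2))) (Complex 1 (\<sigma> * 5))" "\<sigma> = 1 \<or> \<sigma> = -1"
  shows "norm (f (of_real r * \<zeta>)) \<le> 2 * sqrt r * exp (111 / 100 * B)"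
proof -
  define z where "z = of_real r * \<zeta>"
  obtain s where s: "0 \<le> s" "s \<le> 1" and \<zeta>: "\<zeta> = (1 - s) *\<^sub>R Complex (1 / 2) (\<sigma> * (sqrt 3 / 2)) + s *\<^sub>R Complex 1 (\<sigma> * 5)"
    using assms(1) by (auto simp: closed_segment_def)
  define b where "b = (1 - s) * (sqrt 3 / 2) + 5 * s"
  have Re: "Re \<zeta> = (1 + s) / 2"
    by (simp add: \<zeta> field_simps)
  have Im: "(Im \<zeta>)\<^sup>2 = b\<^sup>2"
  proof -
    have "Im \<zeta> = \<sigma> * b"
      by (simp add: \<zeta> b_def field_simps)
    then show ?thesis
      using assms(2) by (auto simp: power_mult_distrib)
  qed
  have sqrt3: "172 / 100 \<le> sqrt 3" "sqrt 3 \<le> 2"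
    by (intro real_le_rsqrt real_le_lsqrt; simp add: power2_eq_square)+
  have b: "86 / 100 + 4 * s \<le> b" "b \<le> 5"
  proof -
    have *: "(1 - s) * (86 / 100) \<le> (1 - s) * (sqrt 3 / 2)" "(1 - s) * (sqrt 3 / 2) \<le> (1 - s) * 1"
      using s sqrt3 by (intro mult_left_mono; simp)+
    show "86 / 100 + 4 * s \<le> b"
      using * s unfolding b_def by argo
    show "b \<le> 5"
      using * s unfolding b_def by argo
  qed
  have norm: "(norm \<zeta>)\<^sup>2 = ((1 + s) / 2)\<^sup>2 + b\<^sup>2"
    by (simp add: cmod_power2 Re Im)
  have norm_le: "(norm \<zeta>)\<^sup>2 \<le> 26"
  proof -
    have "((1 + s) / 2)\<^sup>2 \<le> 1\<^sup>2" "b\<^sup>2 \<le> 5\<^sup>2"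
      using s b by (intro power_mono; simp)+
    then show ?thesis
      by (simp add: norm)
  qed
  have inv: "Re (1 / \<zeta>) = ((1 + s) / 2) / (norm \<zeta>)\<^sup>2"
    by (simp add: Re_divide cmod_power2 Re)
  have norm_pos: "(norm \<zeta>)\<^sup>2 > 0"
    using b s by (simp add: norm add_pos_nonneg)
  have "4 * pi\<^sup>2 * Re (1 / z) \<ge> 4"
  proof -
    have "(1 / 2) / 26 \<le> Re (1 / \<zeta>)"
      unfolding inv using s norm_le norm_pos by (intro frac_le) auto
    moreover have "9 \<le> pi\<^sup>2"
      using pi_gt3 power_mono[of 3 pi 2] by simp
    ultimately have *: "9 * ((1 / 2) / 26) \<le> pi\<^sup>2 * Re (1 / \<zeta>)"
      by (intro mult_mono) auto
    have "33 \<le> 1 / r"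
      using r_pos r_le by (simp add: field_simps)
    from mult_mono[OF this *] have "33 * (9 * ((1 / 2) / 26)) \<le> 1 / r * (pi\<^sup>2 * Re (1 / \<zeta>))"
      using r_pos by simp
    moreover have "Re (1 / z) = 1 / r * Re (1 / \<zeta>)"
      using Re_of_real_times[of "1 / r" "1 / \<zeta>"] by (simp add: z_def)
    then have "4 * pi\<^sup>2 * Re (1 / z) = 4 * (1 / r * (pi\<^sup>2 * Re (1 / \<zeta>)))"
      by simp
    ultimately show ?thesis
      by linarith
  qed
  then have "norm (partition_gf (exp (- (of_real (4 * pi\<^sup>2) / z))) - 1) \<le> 1"
    using norm_dual_minus_1_le[of z] by (auto elim!: order_trans)
  then have Q: "norm (partition_gf (exp (- (of_real (4 * pi\<^sup>2) / z)))) \<le> 2"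
    using norm_triangle_sub[of "partition_gf (exp (- (of_real (4 * pi\<^sup>2) / z)))" 1] by simp
  have "Re (1 / \<zeta>) + Re \<zeta> \<le> 111 / 100"
  proof -
    have "2 * ((1 + s) / 2) * b \<le> (norm \<zeta>)\<^sup>2"
      unfolding norm by (rule sum_squares_bound)
    then have "Re (1 / \<zeta>) \<le> 1 / (2 * b)"
      unfolding inv using norm_pos b s by (simp add: field_simps)
    also have "\<dots> \<le> 1 / (2 * (86 / 100 + 4 * s))"
      using b s by (intro frac_le) auto
    finally have "Re (1 / \<zeta>) + Re \<zeta> \<le> 1 / (2 * (86 / 100 + 4 * s)) + (1 + s) / 2"
      by (simp add: Re)
    \<comment> \<open>After clearing denominators the left side is a convex quadratic in
      \<open>s\<close>; replacing \<open>s * s\<close> by \<open>s\<close> reduces the claim to the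
      ends \<open>s = 0\<close> and \<open>s = 1\<close>, where the values are about 1.08 and
      1.10.\<close>
    also have "\<dots> \<le> 111 / 100"
    proof -
      have "s * s \<le> s * 1"
        using s by (intro mult_left_mono) auto
      then show ?thesis
        using s by (simp add: field_simps)
    qed
    finally show ?thesis .
  qed
  then have "exp (B * (Re (1 / \<zeta>) + Re \<zeta>)) \<le> exp (111 / 100 * B)"
    using B_pos by (simp add: mult.commute)
  moreover have "sqrt (norm z / (2 * pi)) \<le> sqrt r"
  proof -
    have "norm \<zeta> \<le> 6"
      using norm_le by (intro power2_le_imp_le[of "norm \<zeta>" 6]) auto
    then have "norm \<zeta> \<le> 2 * pi"
      using pi_gt3 by linarith
    then have "r * norm \<zeta> \<le> r * (2 * pi)"
      using r_pos by (intro mult_left_mono) auto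
    then show ?thesis
      using r_pos by (simp add: z_def norm_mult field_simps)
  qed
  ultimately have "norm (g z) \<le> sqrt r * exp (111 / 100 * B)"
    unfolding norm_g saddle_exponent[OF z_def] using r_pos by (intro mult_mono) auto
  with Q have "norm (g z) * norm (partition_gf (exp (- (of_real (4 * pi\<^sup>2) / z)))) \<le> sqrt r * exp (111 / 100 * B) * 2"
    using r_pos by (intro mult_mono) auto
  moreover have "Re z > 0"
    using r_pos s by (simp add: z_def Re)
  ultimately show ?thesis
    unfolding z_def[symmetric] by (simp add: f_eq norm_mult)
qed

text \<open>On the circle the two summands of the exponent are \<open>B * cis (- \<phi>)\<close> and
  \<open>B * cis \<phi>\<close>, whose sum is real. The restriction on the angle puts
  \<open>cis (\<phi> / 2)\<close> in the right half-plane, which identifies the principal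
  root.\<close>

lemma g_arc:
  assumes "\<bar>\<phi>\<bar> < pi"
  shows "g (of_real r * cis \<phi>) = of_real (sqrt (r / (2 * pi)) * exp (2 * B * cos \<phi>)) * cis (\<phi> / 2)"
proof -
  have "csqrt (of_real r * cis \<phi> / of_real (2 * pi)) = of_real (sqrt (r / (2 * pi))) * cis (\<phi> / 2)"
  proof (rule csqrt_unique)
    have "(complex_of_real (sqrt (r / (2 * pi))) * cis (\<phi> / 2))\<^sup>2 = of_real ((sqrt (r / (2 * pi)))\<^sup>2) * cis \<phi>"
      by (simp add: power_mult_distrib power2_eq_square[of "cis _"] cis_mult)
    also have "(sqrt (r / (2 * pi)))\<^sup>2 = r / (2 * pi)"
      using r_pos by simp
    finally show "(complex_of_real (sqrt (r / (2 * pi))) * cis (\<phi> / 2))\<^sup>2 = of_real r * cis \<phi> / of_real (2 * pi)"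
      by simp
    have "cos (\<phi> / 2) > 0"
      using assms by (intro cos_gt_zero_pi) auto
    then show "0 < Re (complex_of_real (sqrt (r / (2 * pi))) * cis (\<phi> / 2)) \<or>
        Re (complex_of_real (sqrt (r / (2 * pi))) * cis (\<phi> / 2)) = 0 \<and> 0 \<le> Im (complex_of_real (sqrt (r / (2 * pi))) * cis (\<phi> / 2))"
      using r_pos by simp
  qed
  moreover have "of_real (pi\<^sup>2 / 6) / (of_real r * cis \<phi>) + of_real (real n - 1 / 24) * (of_real r * cis \<phi>) = of_real (2 * B * cos \<phi>)"
  proof -
    have "of_real (pi\<^sup>2 / 6) / (of_real r * cis \<phi>) = of_real (pi\<^sup>2 / 6) / of_real r * (1 / cis \<phi>)"
      by (simp only: times_divide_times_eq mult_1_right)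
    also have "\<dots> = of_real (pi\<^sup>2 / 6 / r) * cis (- \<phi>)"
      by (simp only: of_real_divide cis_inverse flip: inverse_eq_divide)
    finally have "of_real (pi\<^sup>2 / 6) / (of_real r * cis \<phi>) = of_real (pi\<^sup>2 / 6 / r) * cis (- \<phi>)" .
    moreover have "of_real (real n - 1 / 24) * (of_real r * cis \<phi>) = of_real ((real n - 1 / 24) * r) * cis \<phi>"
      by (simp only: of_real_mult mult.assoc)
    moreover have "of_real B * cis (- \<phi>) + of_real B * cis \<phi> = of_real (2 * B * cos \<phi>)"
      by (simp add: complex_eq_iff)
    ultimately show ?thesis
      by (simp only: r_B)
  qed
  ultimately have "g (of_real r * cis \<phi>) = of_real (sqrt (r / (2 * pi))) * cis (\<phi> / 2) * exp (of_real (2 * B * cos \<phi>))"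
    by (simp only: g_def)
  then show ?thesis
    by (simp only: exp_of_real of_real_mult[of "sqrt (r / (2 * pi))"] mult.assoc mult.commute[of "cis _"])
qed

end

section \<open>The integral along the arc and the assembly of the contour\<close>

context saddle_point
begin

text \<open>Over the whole line the integrand has integral
  \<open>(1 - 1 / (2 * B)) * sqrt pi / (2 * sqrt B)\<close>, and stopping at 1/2 costs terms of size
  \<open>exp (- B)\<close>. A primitive is provided instead of an integral so that the arc can be
  treated by bounding a derivative.\<close>

lemma gaussian_primitive:
  obtains W where
    "\<And>s. \<bar>s\<bar> < 1 \<Longrightarrow> (W has_real_derivative (1 - 4 * s\<^sup>2) * exp (- 4 * B * s\<^sup>2)) (at s)"
    "\<bar>W (1 / 2) - W (- 1 / 2) - (1 - 1 / (2 * B)) * sqrt pi / (2 * sqrt B)\<bar> \<le> 3 / (2 * B) * exp (- B)"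
proof
  define T where "T = sqrt B"
  have T: "T > 0" "T\<^sup>2 = B"
    using B_pos by (auto simp: T_def)
  define h where "h = (\<lambda>x::real. exp (- x\<^sup>2))"
  \<comment> \<open>Starting at \<open>-2 * T\<close>, beyond the needed end \<open>- T\<close>,
    makes \<open>G\<close> differentiable on an open interval that corresponds to
    \<open>|s| < 1\<close>.\<close>
  define G where "G = (\<lambda>t. integral {-2 * T..t} h)"
  \<comment> \<open>The derivative of \<open>s * exp (- 4 * B * s^2)\<close> carries the factor
    \<open>1 - 8 * B * s^2\<close>, and \<open>1 - 4 * s^2 = (1 - 8 * B * s^2) / (2 * B) + (1 - 1 /
    (2 * B))\<close>.\<close>
  define W where "W = (\<lambda>s. 1 / (2 * B) * (s * exp (- 4 * B * s\<^sup>2)) + (1 - 1 / (2 * B)) / (2 * T) * G (2 * T * s))"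
  have G: "(G has_real_derivative h t) (at t)" if "\<bar>t\<bar> < 2 * T" for t
  proof -
    have "(G has_real_derivative h t) (at t within {-2 * T..2 * T})"
      unfolding G_def h_def using that by (intro integral_has_real_derivative continuous_intros) auto
    moreover have "at t within {-2 * T..2 * T} = at t"
      using that by (intro at_within_interior) auto
    ultimately show ?thesis
      by simp
  qed
  show "(W has_real_derivative (1 - 4 * s\<^sup>2) * exp (- 4 * B * s\<^sup>2)) (at s)" if "\<bar>s\<bar> < 1" for s
  proof -
    define e where "e = exp (- 4 * B * s\<^sup>2)"
    have "((\<lambda>s. 2 * T * s) has_real_derivative 2 * T) (at s)"
      by (auto intro!: derivative_eq_intros)
    moreover have "(G has_real_derivative h (2 * T * s)) (at (2 * T * s))"
      using that T by (intro G) (simp add: abs_mult)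
    ultimately have "((\<lambda>s. G (2 * T * s)) has_real_derivative h (2 * T * s) * (2 * T)) (at s)"
      by (rule DERIV_chain2[rotated])
    moreover have "h (2 * T * s) = e"
      using T by (simp add: h_def e_def power_mult_distrib)
    moreover have "((\<lambda>s. s * exp (- 4 * B * s\<^sup>2)) has_real_derivative e - 8 * B * s\<^sup>2 * e) (at s)"
      unfolding e_def by (auto intro!: derivative_eq_intros simp: power2_eq_square)
    ultimately have "(W has_real_derivative 1 / (2 * B) * (e - 8 * B * s\<^sup>2 * e) + (1 - 1 / (2 * B)) / (2 * T) * (e * (2 * T))) (at s)"
      unfolding W_def by (intro DERIV_add DERIV_cmult) auto
    also have "1 / (2 * B) * (e - 8 * B * s\<^sup>2 * e) + (1 - 1 / (2 * B)) / (2 * T) * (e * (2 * T)) = (1 - 4 * s\<^sup>2) * e"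
      using B_pos T by (simp add: field_simps)
    finally show ?thesis
      by (simp add: e_def)
  qed
  define I where "I = integral {-T..T} h"
  have W_diff: "W (1 / 2) - W (- 1 / 2) = exp (- B) / (2 * B) + (1 - 1 / (2 * B)) / (2 * T) * I"
  proof -
    have "I = G T - G (- T)"
      using Henstock_Kurzweil_Integration.integral_combine[of "-2 * T" "-T" T h] T
      unfolding G_def I_def by (simp add: h_def integrable_continuous_real continuous_intros)
    moreover have "W (1 / 2) - W (- 1 / 2) = exp (- B) / (2 * B) + (1 - 1 / (2 * B)) / (2 * T) * (G T - G (- T))"
      by (simp add: W_def power_divide right_diff_distrib)
    ultimately show ?thesis
      by simp
  qed
  have I: "I \<le> sqrt pi" "sqrt pi - 2 * exp (- B) / T \<le> I"
    using gaussian_integral_bounds[OF T(1)] T(2) by (simp_all add: I_def h_def)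
  have "1 \<le> 2 * B"
  proof -
    have "9 \<le> pi\<^sup>2"
      using pi_gt3 power_mono[of 3 pi 2] by simp
    then show ?thesis
      using r_pos r_le by (simp add: B_def field_simps)
  qed
  then have c: "0 \<le> 1 - 1 / (2 * B)" "1 - 1 / (2 * B) \<le> 1"
    using B_pos by (auto simp: field_simps)
  have eq: "W (1 / 2) - W (- 1 / 2) - (1 - 1 / (2 * B)) * sqrt pi / (2 * T) = exp (- B) / (2 * B) - (1 - 1 / (2 * B)) / (2 * T) * (sqrt pi - I)"
    unfolding W_diff by (simp add: right_diff_distrib)
  have "(1 - 1 / (2 * B)) / (2 * T) * (sqrt pi - I) \<le> 1 / (2 * T) * (2 * exp (- B) / T)"
    using c I T by (intro mult_mono divide_right_mono) auto
  also have "\<dots> = exp (- B) / B"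
    using T by (simp add: power2_eq_square)
  finally have le: "(1 - 1 / (2 * B)) / (2 * T) * (sqrt pi - I) \<le> exp (- B) / B" .
  have ge: "0 \<le> (1 - 1 / (2 * B)) / (2 * T) * (sqrt pi - I)" "0 \<le> exp (- B) / (2 * B)"
    using c I T B_pos by (intro mult_nonneg_nonneg divide_nonneg_nonneg; simp)+
  have abs_diff_le: "\<bar>a - k\<bar> \<le> a + b" if "0 \<le> k" "0 \<le> a" "k \<le> b" for a b k :: real
    using that by linarith
  have "3 / (2 * B) * exp (- B) = exp (- B) / (2 * B) + exp (- B) / B"
    using B_pos by (simp add: field_simps)
  then show "\<bar>W (1 / 2) - W (- 1 / 2) - (1 - 1 / (2 * B)) * sqrt pi / (2 * sqrt B)\<bar> \<le> 3 / (2 * B) * exp (- B)"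
    unfolding T_def[symmetric] eq using abs_diff_le[OF ge le] by simp
qed

text \<open>The error is \<open>g\<close> times the deviation of the dual factor from 1. Their
  exponents in units of \<open>pi^2 * cos \<phi> / r\<close> are 1/3 and -4, so the product decays
  and \<open>exp 3\<close> is left. The angle \<open>3 * \<phi> / 2\<close> combines the root with
  the derivative of the path.\<close>

lemma arc_derivative_error:
  assumes "\<bar>\<phi>\<bar> \<le> pi / 3"
  shows "\<bar>Im (f (of_real r * cis \<phi>) * (of_real r * (cis \<phi> * \<i>))) -
      r * sqrt (r / (2 * pi)) * exp (2 * B * cos \<phi>) * cos (3 * \<phi> / 2)\<bar> \<le> r * sqrt (r / (2 * pi)) * exp 3"
proof -
  define z where "z = of_real r * cis \<phi>"
  define Q where "Q = partition_gf (exp (- (of_real (4 * pi\<^sup>2) / z)))"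
  have cos: "cos \<phi> \<ge> 1 / 2"
  proof -
    have "cos (pi / 3) \<le> cos \<bar>\<phi>\<bar>"
      using assms by (intro cos_monotone_0_pi_le) auto
    then show ?thesis
      by (simp add: cos_60 abs_if split: if_splits)
  qed
  have inv: "Re (1 / z) = cos \<phi> / r"
  proof -
    have "1 / z = of_real (1 / r) * cis (- \<phi>)"
      by (simp add: z_def divide_inverse)
    then show ?thesis
      by (simp only: Re_of_real_times) simp
  qed
  have g: "g z = of_real (sqrt (r / (2 * pi)) * exp (2 * B * cos \<phi>)) * cis (\<phi> / 2)"
    unfolding z_def using assms by (intro g_arc) (simp add: abs_if split: if_splits; use pi_gt_zero in linarith)
  have f: "f z = g z * Q"
    unfolding Q_def using cos r_pos by (intro f_eq) (simp add: z_def)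
  have main: "Im (g z * (of_real r * (cis \<phi> * \<i>))) = r * sqrt (r / (2 * pi)) * exp (2 * B * cos \<phi>) * cos (3 * \<phi> / 2)"
  proof -
    have "cis (\<phi> / 2) * cis \<phi> = cis (3 * \<phi> / 2)"
      by (simp add: cis_mult)
    then have eq: "g z * (of_real r * (cis \<phi> * \<i>)) = of_real (r * sqrt (r / (2 * pi)) * exp (2 * B * cos \<phi>)) * (cis (3 * \<phi> / 2) * \<i>)"
      by (simp add: g mult_ac)
    show ?thesis
      unfolding eq by simp
  qed
  have "norm (g z) = sqrt (r / (2 * pi)) * exp (2 * B * cos \<phi>)"
    using r_pos by (simp add: g norm_mult)
  moreover have "norm (Q - 1) \<le> exp (3 - 4 * pi\<^sup>2 * (cos \<phi> / r))"
  proof -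
    have "1 * (1 / 2) \<le> 4 * pi\<^sup>2 * cos \<phi>"
      using cos pi_gt3 power_mono[of 3 pi 2] by (intro mult_mono) auto
    then have "4 * pi\<^sup>2 * (cos \<phi> / r) \<ge> 1"
      using r_pos r_le by (simp add: field_simps)
    then show ?thesis
      using norm_dual_minus_1_le[of z] by (simp add: inv Q_def)
  qed
  ultimately have "norm (g z) * norm (Q - 1) \<le> sqrt (r / (2 * pi)) * exp (2 * B * cos \<phi>) * exp (3 - 4 * pi\<^sup>2 * (cos \<phi> / r))"
    using r_pos by (intro mult_mono) auto
  also have "\<dots> = sqrt (r / (2 * pi)) * exp (3 - 11 / 3 * (pi\<^sup>2 * (cos \<phi> / r)))"
  proof -
    have "2 * B * cos \<phi> + (3 - 4 * pi\<^sup>2 * (cos \<phi> / r)) = 3 - 11 / 3 * (pi\<^sup>2 * (cos \<phi> / r))"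
      using r_pos by (simp add: B_def field_simps)
    then show ?thesis
      by (simp only: mult.assoc exp_add[symmetric])
  qed
  also have "\<dots> \<le> sqrt (r / (2 * pi)) * exp 3"
    using r_pos cos by (intro mult_left_mono) auto
  finally have bound: "norm (g z) * norm (Q - 1) \<le> sqrt (r / (2 * pi)) * exp 3" .
  have "Im (f z * (of_real r * (cis \<phi> * \<i>))) - r * sqrt (r / (2 * pi)) * exp (2 * B * cos \<phi>) * cos (3 * \<phi> / 2)
      = Im (g z * (Q - 1) * (of_real r * (cis \<phi> * \<i>)))"
    unfolding main[symmetric] f minus_complex.sel[symmetric] by (rule arg_cong[where f = Im]) (simp add: algebra_simps)
  also have "\<bar>\<dots>\<bar> \<le> norm (g z * (Q - 1) * (of_real r * (cis \<phi> * \<i>)))"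
    by (rule abs_Im_le_cmod)
  also have "\<dots> = r * (norm (g z) * norm (Q - 1))"
    using r_pos by (simp add: norm_mult)
  also have "\<dots> \<le> r * (sqrt (r / (2 * pi)) * exp 3)"
    using bound r_pos by (intro mult_left_mono) auto
  finally show ?thesis
    by (simp add: z_def)
qed

text \<open>The four errors come from the vertical pieces, the slanted segments, the dual factor on
  the arc, and the tails of the Gaussian integral.\<close>

theorem num_partitions_contour_estimate:
  "\<bar>2 * pi * real (num_partitions n) - r * sqrt (r / (2 * pi)) * exp (2 * B) * (1 - 1 / (2 * B)) * sqrt pi / sqrt B\<bar> \<le>
     2 * pi * sqrt (r / (2 * pi)) * exp (2 * B + 1 / 2 - 95 / 100 / r) + 20 * (r * sqrt r) * exp (111 / 100 * B)
     + 2 * pi / 3 * (r * sqrt (r / (2 * pi)) * exp 3) + 3 * (r * sqrt (r / (2 * pi))) / B * exp B"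
proof -
  define S where "S = {z. Re z > 0}"
  define c where "c = sqrt (r / (2 * pi))"
  have "convex S" "open S"
    by (auto simp: S_def convex_halfspace_Re_gt open_halfspace_Re_gt)
  have "f holomorphic_on S"
    unfolding S_def by (rule holomorphic_f)
  \<comment> \<open>A global primitive on the half-plane replaces the deformation of the contour:
    the increment between the end points is split at intermediate points off the line.\<close>
  have "\<exists>H. \<forall>z\<in>S. (H has_field_derivative f z) (at z within S)"
    by (rule holomorphic_convex_primitive'[OF \<open>convex S\<close> \<open>open S\<close> \<open>f holomorphic_on S\<close>]) blast
  then obtain H where H: "\<And>z. z \<in> S \<Longrightarrow> (H has_field_derivative f z) (at z within S)"
    by metis
  have H_at: "(H has_field_derivative f z) (at z)" if "Re z > 0" for z
  proof -
    have "z \<in> S"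
      using that by (simp add: S_def)
    then show ?thesis
      using H[OF \<open>z \<in> S\<close>] at_within_open[OF \<open>z \<in> S\<close> \<open>open S\<close>] by (simp only:)
  qed
  have segment_bound: "norm (H b - H a) \<le> K * norm (b - a)" if "\<And>z. z \<in> closed_segment a b \<Longrightarrow> Re z > 0 \<and> norm (f z) \<le> K" for a b K
  proof (rule field_differentiable_bound[of "closed_segment a b" H f])
    fix z assume "z \<in> closed_segment a b"
    then have "Re z > 0 \<and> norm (f z) \<le> K"
      by (rule that)
    then show "(H has_field_derivative f z) (at z within closed_segment a b)" "norm (f z) \<le> K"
      by (auto intro!: has_field_derivative_at_within H_at)
  qed auto
  have total: "H (Complex r pi) - H (Complex r (-pi)) = 2 * pi * \<i> * of_nat (num_partitions n)"
  proof -
    have "(f has_contour_integral H (pathfinish (linepath (Complex r (-pi)) (Complex r pi))) - H (pathstart (linepath (Complex r (-pi)) (Complex r pi))))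
        (linepath (Complex r (-pi)) (Complex r pi))"
    proof (rule contour_integral_primitive[OF H])
      show "path_image (linepath (Complex r (- pi)) (Complex r pi)) \<subseteq> S"
        unfolding path_image_linepath using \<open>convex S\<close> r_pos by (intro closed_segment_subset) (auto simp: S_def)
    qed auto
    then have "contour_integral (linepath (Complex r (-pi)) (Complex r pi)) f = H (Complex r pi) - H (Complex r (-pi))"
      by (simp add: contour_integral_unique)
    then show ?thesis
      using contour_integral_partition_gf[OF r_pos, of n] by (simp add: f_def[abs_def])
  qed
  have vertical: "norm (H (Complex r (\<sigma> * pi)) - H (Complex r (\<sigma> * (5 * r)))) \<le> pi * c * exp (2 * B + 1 / 2 - 95 / 100 / r)"
    if \<sigma>: "\<sigma> = 1 \<or> \<sigma> = -1" for \<sigma>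
  proof -
    have r5: "5 * r \<le> pi"
      using r_le pi_gt3 by linarith
    have "norm (H (Complex r (\<sigma> * pi)) - H (Complex r (\<sigma> * (5 * r)))) \<le>
        c * exp (2 * B + 1 / 2 - 95 / 100 / r) * norm (Complex r (\<sigma> * pi) - Complex r (\<sigma> * (5 * r)))"
    proof (rule segment_bound)
      fix z assume "z \<in> closed_segment (Complex r (\<sigma> * (5 * r))) (Complex r (\<sigma> * pi))"
      then obtain u where u: "0 \<le> u" "u \<le> 1" "z = (1 - u) *\<^sub>R Complex r (\<sigma> * (5 * r)) + u *\<^sub>R Complex r (\<sigma> * pi)"
        by (auto simp: closed_segment_def)
      define y where "y = (1 - u) * (5 * r) + u * pi"
      have z: "z = Complex r (\<sigma> * y)"
        unfolding u(3) y_def by (simp add: complex_eq_iff algebra_simps)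
      have "u * (5 * r) \<le> u * pi" "(1 - u) * (5 * r) \<le> (1 - u) * pi"
        using u r5 by (intro mult_left_mono; simp)+
      then have y: "5 * r \<le> y" "y \<le> pi"
        by (simp_all add: y_def algebra_simps)
      have "5 * r \<le> \<bar>\<sigma> * y\<bar>" "\<bar>\<sigma> * y\<bar> \<le> pi"
        using \<sigma> y r_pos by auto
      then show "Re z > 0 \<and> norm (f z) \<le> c * exp (2 * B + 1 / 2 - 95 / 100 / r)"
        unfolding z c_def using norm_f_vertical_le r_pos by simp
    qed
    also have "norm (Complex r (\<sigma> * pi) - Complex r (\<sigma> * (5 * r))) \<le> pi"
    proof -
      have "Complex r (\<sigma> * pi) - Complex r (\<sigma> * (5 * r)) = of_real (\<sigma> * (pi - 5 * r)) * \<i>"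
        by (simp add: complex_eq_iff algebra_simps)
      then have "norm (Complex r (\<sigma> * pi) - Complex r (\<sigma> * (5 * r))) = \<bar>\<sigma> * (pi - 5 * r)\<bar>"
        by (simp only: norm_mult norm_of_real norm_ii mult_1_right)
      then show ?thesis
        using \<sigma> r5 r_pos by auto
    qed
    finally show ?thesis
      using r_pos by (simp add: c_def mult_ac)
  qed
  have slanted: "norm (H (Complex r (\<sigma> * (5 * r))) - H (of_real r * cis (\<sigma> * (pi / 3)))) \<le> 10 * (r * sqrt r) * exp (111 / 100 * B)"
    if \<sigma>: "\<sigma> = 1 \<or> \<sigma> = -1" for \<sigma>
  proof -
    define a where "a = Complex (1 / 2) (\<sigma> * (sqrt 3 / 2))"
    define b where "b = Complex 1 (\<sigma> * 5)"
    have cis: "cis (\<sigma> * (pi / 3)) = a"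
      using \<sigma> by (auto simp: a_def complex_eq_iff cos_60 sin_60)
    have end_b: "Complex r (\<sigma> * (5 * r)) = of_real r * b"
      by (simp add: b_def complex_eq_iff)
    have "norm (H (of_real r * b) - H (of_real r * a)) \<le> 2 * sqrt r * exp (111 / 100 * B) * norm (of_real r * b - of_real r * a)"
    proof (rule segment_bound)
      fix z assume "z \<in> closed_segment (of_real r * a) (of_real r * b)"
      then obtain u where u: "0 \<le> u" "u \<le> 1" "z = (1 - u) *\<^sub>R (of_real r * a) + u *\<^sub>R (of_real r * b)"
        by (auto simp: closed_segment_def)
      define \<zeta> where "\<zeta> = (1 - u) *\<^sub>R a + u *\<^sub>R b"
      have z: "z = of_real r * \<zeta>"
        by (simp add: u \<zeta>_def scaleR_conv_of_real algebra_simps)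
      have "\<zeta> \<in> closed_segment a b"
        using u by (auto simp: \<zeta>_def closed_segment_def)
      moreover have "Re \<zeta> > 0"
        using u by (simp add: \<zeta>_def a_def b_def field_simps)
      ultimately show "Re z > 0 \<and> norm (f z) \<le> 2 * sqrt r * exp (111 / 100 * B)"
        using norm_f_segment_le[of \<zeta> \<sigma>] \<sigma> r_pos by (simp add: z a_def b_def)
    qed
    also have "norm (of_real r * b - of_real r * a) \<le> r * 5"
    proof -
      have "norm (b - a) \<le> \<bar>Re (b - a)\<bar> + \<bar>Im (b - a)\<bar>"
        by (rule cmod_le)
      also have "\<dots> \<le> 5"
      proof -
        define w where "w = sqrt 3"
        have "1 \<le> w" "w \<le> 2"
          by (auto simp: w_def intro: real_le_lsqrt)
        then show ?thesis
          using \<sigma> by (auto simp: a_def b_def w_def[symmetric])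
      qed
      finally show ?thesis
        using r_pos by (simp add: right_diff_distrib[symmetric] norm_mult)
    qed
    finally show ?thesis
      unfolding cis end_b using r_pos by (simp add: mult_ac)
  qed
  obtain W where W: "\<And>s. \<bar>s\<bar> < 1 \<Longrightarrow> (W has_real_derivative (1 - 4 * s\<^sup>2) * exp (- 4 * B * s\<^sup>2)) (at s)"
    and W_diff: "\<bar>W (1 / 2) - W (- 1 / 2) - (1 - 1 / (2 * B)) * sqrt pi / (2 * sqrt B)\<bar> \<le> 3 / (2 * B) * exp (- B)"
    using gaussian_primitive by blast
  \<comment> \<open>Since the total increment is purely imaginary, only imaginary parts matter.
    \<open>\<Phi>\<close> compares \<open>H\<close> along the arc with the explicit primitive, and
    its derivative is what \<open>arc_derivative_error\<close> bounds.\<close>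
  define \<Phi> where "\<Phi> = (\<lambda>\<phi>. Im (H (of_real r * cis \<phi>)) - 2 * r * c * exp (2 * B) * W (sin (\<phi> / 2)))"
  have arc: "\<bar>\<Phi> (pi / 3) - \<Phi> (- (pi / 3))\<bar> \<le> r * c * exp 3 * (2 * pi / 3)"
  proof -
    define \<Phi>' where "\<Phi>' = (\<lambda>\<phi>. Im (f (of_real r * cis \<phi>) * (of_real r * (cis \<phi> * \<i>))) - r * c * exp (2 * B * cos \<phi>) * cos (3 * \<phi> / 2))"
    have "norm (\<Phi> (pi / 3) - \<Phi> (- (pi / 3))) \<le> r * c * exp 3 * norm (pi / 3 - - (pi / 3))"
    proof (rule field_differentiable_bound[of "{- (pi / 3)..pi / 3}" \<Phi> \<Phi>'])
      fix \<phi> assume \<phi>: "\<phi> \<in> {- (pi / 3)..pi / 3}"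
      then have abs: "\<bar>\<phi>\<bar> \<le> pi / 3"
        by auto
      then show "norm (\<Phi>' \<phi>) \<le> r * c * exp 3"
        using arc_derivative_error[OF abs] by (simp add: \<Phi>'_def c_def)
      have cos_pos: "cos \<phi> > 0"
        using abs pi_gt_zero by (intro cos_gt_zero_pi; linarith)
      have "((\<lambda>w. H (of_real r * exp (\<i> * w))) has_field_derivative f (of_real r * exp (\<i> * of_real \<phi>)) * (of_real r * (exp (\<i> * of_real \<phi>) * \<i>))) (at (of_real \<phi>))"
      proof (rule DERIV_chain2[where f = H])
        show "(H has_field_derivative f (of_real r * exp (\<i> * of_real \<phi>))) (at (of_real r * exp (\<i> * of_real \<phi>)))"
          using cos_pos r_pos by (intro H_at) (simp add: Re_exp)
        show "((\<lambda>w. of_real r * exp (\<i> * w)) has_field_derivative of_real r * (exp (\<i> * of_real \<phi>) * \<i>)) (at (of_real \<phi>))"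
          by (auto intro!: derivative_eq_intros)
      qed
      then have "((\<lambda>\<phi>. H (of_real r * exp (\<i> * of_real \<phi>))) has_vector_derivative f (of_real r * exp (\<i> * of_real \<phi>)) * (of_real r * (exp (\<i> * of_real \<phi>) * \<i>))) (at \<phi>)"
        by (rule has_vector_derivative_real_field)
      then have "((\<lambda>\<phi>. H (of_real r * cis \<phi>)) has_vector_derivative f (of_real r * cis \<phi>) * (of_real r * (cis \<phi> * \<i>))) (at \<phi>)"
        by (simp only: cis_conv_exp)
      then have "((\<lambda>\<phi>. Im (H (of_real r * cis \<phi>))) has_real_derivative Im (f (of_real r * cis \<phi>) * (of_real r * (cis \<phi> * \<i>)))) (at \<phi>)"
        unfolding has_real_derivative_iff_has_vector_derivative
        by (rule bounded_linear.has_vector_derivative[OF bounded_linear_Im])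
      moreover have "((\<lambda>\<phi>. 2 * r * c * exp (2 * B) * W (sin (\<phi> / 2))) has_real_derivative r * c * exp (2 * B * cos \<phi>) * cos (3 * \<phi> / 2)) (at \<phi>)"
      proof -
        define s where "s = sin (\<phi> / 2)"
        have "\<bar>s\<bar> < 1"
        proof -
          have "cos (\<phi> / 2) > 0"
            using abs pi_gt_zero by (intro cos_gt_zero_pi; linarith)
          then have "s\<^sup>2 < 1"
            using zero_less_power[of "cos (\<phi> / 2)" 2] unfolding s_def sin_squared_eq by linarith
          then show ?thesis
            by (simp add: abs_square_less_1)
        qed
        have "((\<lambda>\<phi>. sin (\<phi> / 2)) has_real_derivative cos (\<phi> / 2) / 2) (at \<phi>)"
          by (auto intro!: derivative_eq_intros)
        with W[OF \<open>\<bar>s\<bar> < 1\<close>] have "((\<lambda>\<phi>. W (sin (\<phi> / 2))) has_real_derivative (1 - 4 * s\<^sup>2) * exp (- 4 * B * s\<^sup>2) * (cos (\<phi> / 2) / 2)) (at \<phi>)"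
          unfolding s_def by (rule DERIV_chain2)
        then have "((\<lambda>\<phi>. 2 * r * c * exp (2 * B) * W (sin (\<phi> / 2))) has_real_derivative
            2 * r * c * exp (2 * B) * ((1 - 4 * s\<^sup>2) * exp (- 4 * B * s\<^sup>2) * (cos (\<phi> / 2) / 2))) (at \<phi>)"
          by (rule DERIV_cmult)
        moreover have "2 * r * c * exp (2 * B) * ((1 - 4 * s\<^sup>2) * exp (- 4 * B * s\<^sup>2) * (cos (\<phi> / 2) / 2)) =
            r * c * (exp (2 * B) * exp (- 4 * B * s\<^sup>2)) * ((1 - 4 * s\<^sup>2) * cos (\<phi> / 2))"
          by (simp add: mult_ac)
        moreover have "exp (2 * B) * exp (- 4 * B * s\<^sup>2) = exp (2 * B * cos \<phi>)"
        proof -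
          have "cos \<phi> = 1 - 2 * s\<^sup>2"
            using cos_double_sin[of "\<phi> / 2"] by (simp add: s_def)
          then have "2 * B + - 4 * B * s\<^sup>2 = 2 * B * cos \<phi>"
            by (simp only: right_diff_distrib)
          then show ?thesis
            by (simp only: exp_add[symmetric])
        qed
        \<comment> \<open>The triple angle formula: the factor \<open>cos (\<phi> / 2)\<close> is
          the derivative of the substitution, up to 1/2, and the rest is a polynomial in
          \<open>s\<close>.\<close>
        moreover have "(1 - 4 * s\<^sup>2) * cos (\<phi> / 2) = cos (3 * \<phi> / 2)"
        proof -
          have "cos (3 * \<phi> / 2) = 4 * cos (\<phi> / 2) ^ 3 - 3 * cos (\<phi> / 2)"
            using cos_treble_cos[of "\<phi> / 2"] by simp
          also have "\<dots> = (4 * (cos (\<phi> / 2))\<^sup>2 - 3) * cos (\<phi> / 2)"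
            by (simp add: power2_eq_square power3_eq_cube algebra_simps)
          also have "4 * (cos (\<phi> / 2))\<^sup>2 - 3 = 1 - 4 * s\<^sup>2"
            by (simp add: cos_squared_eq s_def)
          finally show ?thesis
            by simp
        qed
        ultimately show ?thesis
          by (simp only:)
      qed
      ultimately show "(\<Phi> has_field_derivative \<Phi>' \<phi>) (at \<phi> within {- (pi / 3)..pi / 3})"
        unfolding \<Phi>_def \<Phi>'_def by (rule has_field_derivative_at_within[OF DERIV_diff])
    qed (use pi_gt_zero in auto)
    then show ?thesis
      by simp
  qed
  have main: "\<bar>2 * r * c * exp (2 * B) * (W (1 / 2) - W (- 1 / 2)) - r * c * exp (2 * B) * (1 - 1 / (2 * B)) * sqrt pi / sqrt B\<bar> \<le> 3 * (r * c) / B * exp B"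
  proof -
    have "2 * r * c * exp (2 * B) * (W (1 / 2) - W (- 1 / 2)) - r * c * exp (2 * B) * (1 - 1 / (2 * B)) * sqrt pi / sqrt B =
        2 * r * c * exp (2 * B) * (W (1 / 2) - W (- 1 / 2) - (1 - 1 / (2 * B)) * sqrt pi / (2 * sqrt B))"
      by (simp add: right_diff_distrib)
    also have "\<bar>\<dots>\<bar> = 2 * r * c * exp (2 * B) * \<bar>W (1 / 2) - W (- 1 / 2) - (1 - 1 / (2 * B)) * sqrt pi / (2 * sqrt B)\<bar>"
      using r_pos by (simp add: abs_mult c_def)
    also have "\<dots> \<le> 2 * r * c * exp (2 * B) * (3 / (2 * B) * exp (- B))"
      using r_pos W_diff by (intro mult_left_mono) (auto simp: c_def)
    also have "\<dots> = 3 * (r * c) / B * (exp (2 * B) * exp (- B))"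
      by simp
    also have "exp (2 * B) * exp (- B) = exp B"
      by (simp add: exp_add[symmetric])
    finally show ?thesis .
  qed
  \<comment> \<open>The factors 1 and -1 match the two instances of \<open>vertical\<close> and
    \<open>slanted\<close>; the increments telescope to the total.\<close>
  define V1 where "V1 = H (Complex r (1 * pi)) - H (Complex r (1 * (5 * r)))"
  define V2 where "V2 = H (Complex r (-1 * pi)) - H (Complex r (-1 * (5 * r)))"
  define S1 where "S1 = H (Complex r (1 * (5 * r))) - H (of_real r * cis (1 * (pi / 3)))"
  define S2 where "S2 = H (Complex r (-1 * (5 * r))) - H (of_real r * cis (-1 * (pi / 3)))"
  have "2 * pi * real (num_partitions n) = Im (H (Complex r pi) - H (Complex r (-pi)))"
    unfolding total by simp
  also have "\<dots> = Im V1 - Im V2 + (Im S1 - Im S2) + (\<Phi> (pi / 3) - \<Phi> (- (pi / 3))) + 2 * r * c * exp (2 * B) * (W (1 / 2) - W (- 1 / 2))"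
    by (simp add: V1_def V2_def S1_def S2_def \<Phi>_def sin_30 right_diff_distrib)
  finally have "2 * pi * real (num_partitions n) = Im V1 - Im V2 + (Im S1 - Im S2) + (\<Phi> (pi / 3) - \<Phi> (- (pi / 3))) + 2 * r * c * exp (2 * B) * (W (1 / 2) - W (- 1 / 2))" .
  moreover have "\<bar>Im V1\<bar> \<le> pi * c * exp (2 * B + 1 / 2 - 95 / 100 / r)"
    using vertical[of 1] abs_Im_le_cmod[of V1] unfolding V1_def by linarith
  moreover have "\<bar>Im V2\<bar> \<le> pi * c * exp (2 * B + 1 / 2 - 95 / 100 / r)"
    using vertical[of "-1"] abs_Im_le_cmod[of V2] unfolding V2_def by linarith
  moreover have "\<bar>Im S1\<bar> \<le> 10 * (r * sqrt r) * exp (111 / 100 * B)"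
    using slanted[of 1] abs_Im_le_cmod[of S1] unfolding S1_def by linarith
  moreover have "\<bar>Im S2\<bar> \<le> 10 * (r * sqrt r) * exp (111 / 100 * B)"
    using slanted[of "-1"] abs_Im_le_cmod[of S2] unfolding S2_def by linarith
  moreover define v where "v = pi * c * exp (2 * B + 1 / 2 - 95 / 100 / r)"
  moreover define w where "w = 10 * (r * sqrt r) * exp (111 / 100 * B)"
  ultimately have "\<bar>2 * pi * real (num_partitions n) - r * c * exp (2 * B) * (1 - 1 / (2 * B)) * sqrt pi / sqrt B\<bar>
      \<le> 2 * v + 2 * w + r * c * exp 3 * (2 * pi / 3) + 3 * (r * c) / B * exp B"
    using arc main by linarith
  also have "2 * v = 2 * pi * c * exp (2 * B + 1 / 2 - 95 / 100 / r)"
    by (simp add: v_def)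
  also have "2 * w = 20 * (r * sqrt r) * exp (111 / 100 * B)"
    by (simp add: w_def)
  also have "r * c * exp 3 * (2 * pi / 3) = 2 * pi / 3 * (r * c * exp 3)"
    by simp
  finally show ?thesis
    by (simp only: c_def)
qed

end

section \<open>Numerical form of the error bound\<close>

lemma exp_1_ge: "27 / 10 \<le> exp (1 :: real)"
proof -
  have "(1 + 1 / 8 + (1 / 8)\<^sup>2 / 2) ^ 8 \<le> exp (1 / 8 :: real) ^ 8"
    by (intro power_mono exp_lower_Taylor_quadratic) auto
  also have "exp (1 / 8 :: real) ^ 8 = exp 1"
    by (simp flip: exp_of_nat_mult)
  finally show ?thesis
    by (rule order_trans[rotated]) (simp add: eval_nat_numeral)
qed

text \<open>The exponent 7 is 2 for the factor \<open>r^2\<close> of the main term plus 5 for the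
  admissible relative error. With \<open>X = 33 * w\<close> and \<open>w <= exp (w - 1)\<close> the
  claim reduces to \<open>50 * 33 ^ 7 <= exp 31\<close> and the comparison of slopes 7/33 and
  0.95.\<close>

lemma exp_dominates_power7:
  fixes X :: real
  assumes "X \<ge> 33"
  shows "50 * X ^ 7 \<le> exp (95 / 100 * X)"
proof -
  have "X / 33 \<le> exp (X / 33 - 1)"
    using exp_ge_add_one_self[of "X / 33 - 1"] by simp
  then have "(X / 33) ^ 7 \<le> exp (X / 33 - 1) ^ 7"
    using assms by (intro power_mono) auto
  also have "\<dots> = exp (7 * (X / 33 - 1))"
    by (simp flip: exp_of_nat_mult)
  finally have "50 * X ^ 7 \<le> 50 * 33 ^ 7 * exp (7 * (X / 33 - 1))"
    by (simp add: power_divide)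
  also have "\<dots> \<le> exp 31 * exp (7 * (X / 33 - 1))"
  proof (intro mult_right_mono)
    have "50 * 33 ^ 7 \<le> (27 / 10 :: real) ^ 31"
      by (simp add: power_divide)
    also have "\<dots> \<le> exp 1 ^ 31"
      by (intro power_mono exp_1_ge) auto
    also have "\<dots> = exp (31 :: real)"
      by (simp flip: exp_of_nat_mult)
    finally show "50 * 33 ^ 7 \<le> exp (31 :: real)" .
  qed auto
  also have "\<dots> = exp (31 + 7 * (X / 33 - 1))"
    by (rule exp_add[symmetric])
  also have "\<dots> \<le> exp (95 / 100 * X)"
    using assms by simp
  finally show ?thesis .
qed

lemma pi_squared_bounds: "984 / 100 \<le> pi\<^sup>2" "pi\<^sup>2 \<le> 988 / 100"
  using mult_mono[of "3.1415" pi "3.1415" pi] mult_mono[of pi "3.1417" pi "3.1417"] pi_bounds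
  by (auto simp: power2_eq_square)

context saddle_point
begin

text \<open>The leading Hardy-Ramanujan term: with \<open>t = real n - 1 / 24\<close> the factor in
  front is \<open>1 / (4 * sqrt 3 * t)\<close> and
  \<open>2 * B = pi * sqrt (2 * t / 3)\<close>.\<close>

definition main_term :: real where
  "main_term = sqrt 3 * r\<^sup>2 / (2 * pi\<^sup>2) * exp (2 * B) * (1 - 1 / (2 * B))"

lemma main_term_eq:
  "r * sqrt (r / (2 * pi)) * exp (2 * B) * (1 - 1 / (2 * B)) * sqrt pi / sqrt B = 2 * pi * main_term"
proof -
  have "sqrt (r / (2 * pi)) * sqrt pi / sqrt B = sqrt (r / (2 * pi) * pi / B)"
    by (simp only: real_sqrt_mult real_sqrt_divide)
  also have "r / (2 * pi) * pi / B = 3 * (r / pi)\<^sup>2"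
    using r_pos by (simp add: B_def power2_eq_square field_simps)
  also have "sqrt (3 * (r / pi)\<^sup>2) = sqrt 3 * (r / pi)"
    using r_pos by (simp add: real_sqrt_mult)
  finally have eq: "sqrt (r / (2 * pi)) * sqrt pi / sqrt B = sqrt 3 * (r / pi)" .
  have "r * sqrt (r / (2 * pi)) * exp (2 * B) * (1 - 1 / (2 * B)) * sqrt pi / sqrt B =
      r * (sqrt (r / (2 * pi)) * sqrt pi / sqrt B) * exp (2 * B) * (1 - 1 / (2 * B))"
    by simp
  also have "\<dots> = r * (sqrt 3 * (r / pi)) * exp (2 * B) * (1 - 1 / (2 * B))"
    unfolding eq ..
  also have "\<dots> = 2 * pi * main_term"
    by (simp add: main_term_def power2_eq_square field_simps)
  finally show ?thesis .
qed

lemma B_ge: "B \<ge> 164 / 100 / r" "B \<ge> 54"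
proof -
  have "164 / 100 / r \<le> pi\<^sup>2 / 6 / r"
    using pi_squared_bounds r_pos by (intro divide_right_mono) auto
  then show 1: "B \<ge> 164 / 100 / r"
    by (simp add: B_def)
  have "54 \<le> 164 / 100 / r"
    using r_pos r_le by (simp add: field_simps)
  with 1 show "B \<ge> 54"
    by linarith
qed

text \<open>In units of \<open>r^7 * exp (2 * B)\<close> the vertical pieces cost 0.02, and the
  other three errors, each at most \<open>exp (1.11 * B)\<close>, together 0.007. As
  \<open>2 * pi * main_term\<close> is at least \<open>0.54 * r^2 * exp (2 * B)\<close>, the total
  0.027 is at most \<open>r^5 / 20\<close> of it.\<close>

theorem num_partitions_estimate:
  "main_term > 0" "\<bar>real (num_partitions n) - main_term\<bar> \<le> r ^ 5 / 20 * main_term"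
proof -
  define c where "c = sqrt (r / (2 * pi))"
  define e where "e = exp (2 * B)"
  have e: "e > 0"
    by (simp add: e_def)
  have c: "0 \<le> c" "c \<le> 1 / 2" "2 * pi * c \<le> 1 / 2"
  proof -
    show "0 \<le> c"
      using r_pos by (simp add: c_def)
    have "(2 * pi * c)\<^sup>2 = 2 * pi * r"
      using r_pos by (simp add: c_def power_mult_distrib power2_eq_square[of pi])
    also have "\<dots> \<le> 2 * 3.1417 * (1 / 33)"
      using r_pos r_le pi_bounds by (intro mult_mono) auto
    also have "\<dots> \<le> (1 / 2)\<^sup>2"
      by (simp add: power2_eq_square)
    finally show *: "2 * pi * c \<le> 1 / 2"
      by (rule power2_le_imp_le) simp
    have "1 * c \<le> 2 * pi * c"
      using pi_gt3 \<open>0 \<le> c\<close> by (intro mult_right_mono) auto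
    then show "c \<le> 1 / 2"
      using * by simp
  qed
  have main_ge: "54 / 100 * r\<^sup>2 * e \<le> 2 * pi * main_term"
  proof -
    have "54 / 100 * r\<^sup>2 * e \<le> sqrt 3 / pi * (1 - 1 / (2 * B)) * (r\<^sup>2 * e)"
    proof -
      have "173 / 100 \<le> sqrt 3"
        by (rule real_le_rsqrt) (simp add: power2_eq_square)
      then have "173 / 100 / 3.1417 \<le> sqrt 3 / pi"
        using pi_bounds by (intro frac_le) auto
      moreover have "99 / 100 \<le> 1 - 1 / (2 * B)"
        using B_ge(2) by (simp add: field_simps)
      ultimately have "173 / 100 / 3.1417 * (99 / 100) \<le> sqrt 3 / pi * (1 - 1 / (2 * B))"
        by (intro mult_mono) auto
      then have "54 / 100 \<le> sqrt 3 / pi * (1 - 1 / (2 * B))"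
        by simp
      then have "54 / 100 * (r\<^sup>2 * e) \<le> sqrt 3 / pi * (1 - 1 / (2 * B)) * (r\<^sup>2 * e)"
        using e by (intro mult_right_mono) auto
      then show ?thesis
        by (simp only: mult.assoc)
    qed
    also have "\<dots> = 2 * pi * main_term"
      by (simp add: main_term_def e_def power2_eq_square)
    finally show ?thesis .
  qed
  have "0 < 54 / 100 * r\<^sup>2 * e"
    using r_pos e by simp
  with main_ge have "0 < 2 * pi * main_term"
    by linarith
  then show pos: "main_term > 0"
    by (simp add: zero_less_mult_iff)
  have key: "50 * exp (- (95 / 100 / r)) \<le> r ^ 7"
  proof -
    have "1 / r \<ge> 33"
      using r_pos r_le by (simp add: field_simps)
    from exp_dominates_power7[OF this] have "50 * (1 / r) ^ 7 \<le> exp (95 / 100 / r)"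
      by simp
    then show ?thesis
      using r_pos by (simp add: exp_minus power_divide field_simps)
  qed
  have E1: "2 * pi * c * exp (2 * B + 1 / 2 - 95 / 100 / r) \<le> 2 / 100 * (r ^ 7 * e)"
  proof -
    have "exp (1 / 2 :: real) \<le> 2"
    proof (rule power2_le_imp_le)
      have "(exp (1 / 2 :: real))\<^sup>2 = exp 1"
        by (simp flip: exp_of_nat_mult)
      then show "(exp (1 / 2 :: real))\<^sup>2 \<le> 2\<^sup>2"
        using exp_le by simp
    qed simp
    then have "2 * pi * c * exp (1 / 2) \<le> 1 / 2 * 2"
      using c by (intro mult_mono) auto
    then have "2 * pi * c * exp (1 / 2) * (e * exp (- (95 / 100 / r))) \<le> 1 * (e * exp (- (95 / 100 / r)))"
      using e by (intro mult_right_mono) auto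
    also have "1 * (e * exp (- (95 / 100 / r))) \<le> 2 / 100 * (r ^ 7 * e)"
      using key e by simp
    also have "2 * pi * c * exp (1 / 2) * (e * exp (- (95 / 100 / r))) = 2 * pi * c * exp (2 * B + 1 / 2 - 95 / 100 / r)"
    proof -
      have "2 * B + 1 / 2 - 95 / 100 / r = 1 / 2 + (2 * B + - (95 / 100 / r))"
        by simp
      then show ?thesis
        by (simp only: e_def exp_add mult.assoc)
    qed
    finally show ?thesis .
  qed
  have E2: "20 * (r * sqrt r) * exp (111 / 100 * B) \<le> exp (111 / 100 * B)"
  proof -
    have "sqrt r \<le> 1"
      using r_le by (simp add: real_le_lsqrt)
    then have "r * sqrt r \<le> 1 / 33 * 1"
      using r_pos r_le by (intro mult_mono) auto
    then show ?thesis
      by simp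
  qed
  have E3: "2 * pi / 3 * (r * c * exp 3) \<le> exp (111 / 100 * B)"
  proof -
    have "exp 3 = exp (1 :: real) ^ 3"
      by (simp flip: exp_of_nat_mult)
    also have "\<dots> \<le> 3 ^ 3"
      by (intro power_mono exp_le) auto
    finally have bound: "r * c * exp 3 \<le> 1 / 33 * (1 / 2) * 27"
      using r_pos r_le c by (intro mult_mono) auto
    have "2 * pi / 3 \<le> 2 * 3.1417 / 3"
      using pi_bounds by simp
    from mult_mono[OF this bound] have "2 * pi / 3 * (r * c * exp 3) \<le> 2 * 3.1417 / 3 * (1 / 33 * (1 / 2) * 27)"
      using r_pos c by simp
    also have "\<dots> \<le> 1"
      by simp
    also have "1 \<le> exp (111 / 100 * B)"
      using B_pos by simp
    finally show ?thesis .
  qed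
  have E4: "3 * (r * c) / B * exp B \<le> exp (111 / 100 * B)"
  proof -
    have "3 * (r * c) \<le> 3 * (1 / 33 * (1 / 2))"
      using r_pos r_le c by (intro mult_mono) auto
    then have "3 * (r * c) / B \<le> 1"
      using B_ge(2) by (simp add: field_simps)
    then have "3 * (r * c) / B * exp B \<le> 1 * exp B"
      by (intro mult_right_mono) auto
    also have "\<dots> \<le> exp (111 / 100 * B)"
      using B_pos by simp
    finally show ?thesis .
  qed
  \<comment> \<open>Here \<open>1.11 * B = 2 * B - 0.89 * B\<close>, and \<open>0.89 * B\<close> is
    at least \<open>1.4596 / r\<close>. The excess over \<open>0.95 / r\<close> is more than 16
    because \<open>1 / r >= 33\<close>.\<close>
  have "3 * exp (111 / 100 * B) \<le> 7 / 1000 * (r ^ 7 * e)"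
  proof -
    have "exp (111 / 100 * B) = e * exp (- (89 / 100 * B))"
      by (simp add: e_def exp_add[symmetric])
    also have "\<dots> \<le> e * (exp (- (95 / 100 / r)) * exp (- 16))"
    proof (rule mult_left_mono)
      have "33 \<le> 1 / r"
        using r_pos r_le by (simp add: field_simps)
      moreover have "89 / 100 * (164 / 100 / r) \<le> 89 / 100 * B"
        using B_ge by (intro mult_left_mono) auto
      ultimately have "95 / 100 / r + 16 \<le> 89 / 100 * B"
        by simp
      then show "exp (- (89 / 100 * B)) \<le> exp (- (95 / 100 / r)) * exp (- 16)"
        by (simp add: exp_add[symmetric])
    qed (use e in simp)
    also have "\<dots> \<le> e * (r ^ 7 / 50 * (1 / 16))"
    proof (intro mult_left_mono mult_mono)
      have "16 \<le> exp (16 :: real)"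
        using exp_ge_add_one_self[of 16] by linarith
      then show "exp (- 16) \<le> 1 / (16 :: real)"
        by (simp add: exp_minus field_simps)
    qed (use key e r_pos in auto)
    finally have "exp (111 / 100 * B) \<le> 1 / 800 * (r ^ 7 * e)"
      by (simp add: mult.commute)
    moreover have "0 < r ^ 7 * e"
      using e r_pos by simp
    ultimately show ?thesis
      by linarith
  qed
  with E2 E3 E4 have "20 * (r * sqrt r) * exp (111 / 100 * B) + 2 * pi / 3 * (r * c * exp 3) + 3 * (r * c) / B * exp B \<le> 7 / 1000 * (r ^ 7 * e)"
    by linarith
  with E1 num_partitions_contour_estimate[folded c_def, unfolded main_term_eq[folded c_def]]
  have "\<bar>2 * pi * real (num_partitions n) - 2 * pi * main_term\<bar> \<le> 27 / 1000 * (r ^ 7 * e)"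
    by linarith
  also have "27 / 1000 * (r ^ 7 * e) = r ^ 5 / 20 * (54 / 100 * r\<^sup>2 * e)"
    by (simp add: eval_nat_numeral)
  also have "\<dots> \<le> r ^ 5 / 20 * (2 * pi * main_term)"
    using main_ge r_pos by (intro mult_left_mono) auto
  also have "\<dots> = 2 * pi * (r ^ 5 / 20 * main_term)"
    by simp
  finally have "2 * pi * \<bar>real (num_partitions n) - main_term\<bar> \<le> 2 * pi * (r ^ 5 / 20 * main_term)"
    by (simp add: abs_mult flip: right_diff_distrib)
  then show "\<bar>real (num_partitions n) - main_term\<bar> \<le> r ^ 5 / 20 * main_term"
    by (rule mult_left_le_imp_le) simp
qed

end

section \<open>The inequality for large arguments\<close>

text \<open>The mean value theorem is used twice: for \<open>f t - f (t - 1)\<close> on a unit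
  interval, then for \<open>f'\<close>.\<close>

lemma second_difference_mean_value:
  fixes f f' f'' :: "real \<Rightarrow> real"
  assumes "\<And>t. x - 1 \<le> t \<Longrightarrow> t \<le> x + 1 \<Longrightarrow> (f has_real_derivative f' t) (at t)"
    and "\<And>t. x - 1 \<le> t \<Longrightarrow> t \<le> x + 1 \<Longrightarrow> (f' has_real_derivative f'' t) (at t)"
  shows "\<exists>\<xi>. x - 1 \<le> \<xi> \<and> \<xi> \<le> x + 1 \<and> f (x + 1) - 2 * f x + f (x - 1) = f'' \<xi>"
proof -
  have "\<exists>z>x. z < x + 1 \<and> (f (x + 1) - f (x + 1 - 1)) - (f x - f (x - 1)) = (x + 1 - x) * (f' z - f' (z - 1))"
  proof (rule MVT2)
    fix t assume t: "x \<le> t" "t \<le> x + 1"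
    have "((\<lambda>t. f (t - 1)) has_real_derivative f' (t - 1) * 1) (at t)"
      by (rule DERIV_chain2[where f = f]) (use t in \<open>auto intro!: assms derivative_eq_intros\<close>)
    then show "((\<lambda>t. f t - f (t - 1)) has_real_derivative f' t - f' (t - 1)) (at t)"
      using t by (intro DERIV_diff assms) auto
  qed simp
  then obtain z where z: "x < z" "z < x + 1" "f (x + 1) - 2 * f x + f (x - 1) = f' z - f' (z - 1)"
    by auto
  have "\<exists>\<xi>>z - 1. \<xi> < z \<and> f' z - f' (z - 1) = (z - (z - 1)) * f'' \<xi>"
    using z by (intro MVT2 assms) auto
  then obtain \<xi> where "z - 1 < \<xi>" "\<xi> < z" "f' z - f' (z - 1) = f'' \<xi>"
    by auto
  with z show ?thesis
    by (intro exI[of _ \<xi>]) auto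
qed

definition hr_const :: real where "hr_const = pi * sqrt (2 / 3)"

lemma hr_const_bounds: "5 / 2 \<le> hr_const" "hr_const \<le> 13 / 5"
proof -
  have sq: "hr_const\<^sup>2 = 2 / 3 * pi\<^sup>2"
    by (simp add: hr_const_def power_mult_distrib)
  have pos: "hr_const \<ge> 0"
    by (simp add: hr_const_def)
  show "5 / 2 \<le> hr_const"
    by (rule power2_le_imp_le[OF _ pos]) (use pi_squared_bounds in \<open>simp add: sq power_divide\<close>)
  show "hr_const \<le> 13 / 5"
    by (rule power2_le_imp_le) (use pi_squared_bounds in \<open>simp_all add: sq power_divide\<close>)
qed

text \<open>The logarithm of the main term is \<open>log_main + log_corr\<close> up to a constant. Only \<open>log_main\<close> needs an exact third
  difference; for \<open>log_corr\<close> the size of the second differences is enough.\<close>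

definition log_main :: "real \<Rightarrow> real" where
  "log_main t = hr_const * sqrt t - ln t"

definition log_corr :: "real \<Rightarrow> real" where
  "log_corr t = ln (1 - 1 / (hr_const * sqrt t))"

lemma log_main_derivs:
  assumes "t > 0"
  shows "(log_main has_real_derivative hr_const / 2 * t powr (- 1 / 2) - t powr (- 1)) (at t)"
    and "((\<lambda>t. hr_const / 2 * t powr (- 1 / 2) - t powr (- 1)) has_real_derivative - (hr_const / 4 * t powr (- 3 / 2)) + t powr (- 2)) (at t)"
    and "((\<lambda>t. - (hr_const / 4 * t powr (- 3 / 2)) + t powr (- 2)) has_real_derivative 3 / 8 * hr_const * t powr (- 5 / 2) - 2 * t powr (- 3)) (at t)"
proof -
  have pw: "((\<lambda>t. t powr a) has_real_derivative a * t powr (a - 1)) (at t)" for a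
    using assms by (rule has_real_derivative_powr)
  have "((\<lambda>t. hr_const * t powr (1 / 2) - ln t) has_real_derivative hr_const * (1 / 2 * t powr (1 / 2 - 1)) - 1 / t) (at t)"
    by (intro DERIV_diff DERIV_cmult pw DERIV_ln_divide assms)
  moreover have "eventually (\<lambda>t. hr_const * t powr (1 / 2) - ln t = log_main t) (nhds t)"
  proof -
    have "eventually (\<lambda>t. t \<in> {0<..}) (nhds t)"
      using assms by (intro eventually_nhds_in_open) auto
    then show ?thesis
      by eventually_elim (simp add: log_main_def powr_half_sqrt)
  qed
  ultimately have "(log_main has_real_derivative hr_const * (1 / 2 * t powr (1 / 2 - 1)) - 1 / t) (at t)"
    by (simp add: DERIV_cong_ev[OF refl _ refl])
  moreover have "1 / t = t powr (- 1)"
    using assms by (simp add: powr_minus_divide)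
  ultimately show "(log_main has_real_derivative hr_const / 2 * t powr (- 1 / 2) - t powr (- 1)) (at t)"
    by simp
  show "((\<lambda>t. hr_const / 2 * t powr (- 1 / 2) - t powr (- 1)) has_real_derivative - (hr_const / 4 * t powr (- 3 / 2)) + t powr (- 2)) (at t)"
    by (rule DERIV_cong[OF DERIV_diff[OF DERIV_cmult[OF pw] pw]]) simp
  show "((\<lambda>t. - (hr_const / 4 * t powr (- 3 / 2)) + t powr (- 2)) has_real_derivative 3 / 8 * hr_const * t powr (- 5 / 2) - 2 * t powr (- 3)) (at t)"
    by (rule DERIV_cong[OF DERIV_add[OF DERIV_minus[OF DERIV_cmult[OF pw]] pw]]) simp
qed

lemma log_corr_derivs:
  assumes "t \<ge> 1"
  defines "b \<equiv> 1 / hr_const"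
  shows "(log_corr has_real_derivative b / (2 * (t * sqrt t - b * t))) (at t)"
    and "((\<lambda>t. b / (2 * (t * sqrt t - b * t))) has_real_derivative - (b * (3 / 2 * sqrt t - b) / (2 * (t * sqrt t - b * t)\<^sup>2))) (at t)"
proof -
  define s where "s = sqrt t"
  have s: "s \<ge> 1" "t = s\<^sup>2"
    using assms(1) by (auto simp: s_def)
  have b: "0 < b" "b < 1" "1 / (hr_const * u) = b / u" for u
    using hr_const_bounds by (auto simp: b_def)
  have sb: "s - b > 0"
    using s b by linarith
  have den: "t * s - b * t = s\<^sup>2 * (s - b)" "s\<^sup>2 * (s - b) > 0"
    using s sb by (auto simp: algebra_simps)
  have "((\<lambda>t. 1 - b / sqrt t) has_real_derivative b / (2 * (t * sqrt t))) (at t)"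
    using s(1) apply (auto intro!: derivative_eq_intros simp: s(2))
    by (simp add: power2_eq_square divide_simps)
  moreover have "1 - b / sqrt t > 0"
    using s sb by (simp add: s_def[symmetric] field_simps)
  ultimately have "((\<lambda>t. ln (1 - b / sqrt t)) has_real_derivative 1 / (1 - b / sqrt t) * (b / (2 * (t * sqrt t)))) (at t)"
    by (intro DERIV_chain2[OF DERIV_ln_divide])
  also have "1 / (1 - b / sqrt t) * (b / (2 * (t * sqrt t))) = b / (2 * (t * sqrt t - b * t))"
    unfolding s_def[symmetric] den(1) using s sb by (simp add: power2_eq_square divide_simps)
  finally show "(log_corr has_real_derivative b / (2 * (t * sqrt t - b * t))) (at t)"
    unfolding log_corr_def[abs_def] b(3) .
  have "((\<lambda>t. 2 * (t * sqrt t - b * t)) has_real_derivative 2 * (3 / 2 * sqrt t - b)) (at t)"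
    using s(1) apply (auto intro!: derivative_eq_intros simp: s(2))
    by (simp add: power2_eq_square divide_simps)
  moreover have "2 * (t * sqrt t - b * t) \<noteq> 0"
    using den unfolding s_def by auto
  ultimately have "((\<lambda>t. b / (2 * (t * sqrt t - b * t))) has_real_derivative
      (0 * (2 * (t * sqrt t - b * t)) - b * (2 * (3 / 2 * sqrt t - b))) / (2 * (t * sqrt t - b * t) * (2 * (t * sqrt t - b * t)))) (at t)"
    by (intro DERIV_divide DERIV_const)
  also have "(0 * (2 * (t * sqrt t - b * t)) - b * (2 * (3 / 2 * sqrt t - b))) / (2 * (t * sqrt t - b * t) * (2 * (t * sqrt t - b * t))) =
      - (b * (3 / 2 * sqrt t - b) / (2 * (t * sqrt t - b * t)\<^sup>2))"
  proof -
    have "(0 * (2 * d) - b * (2 * k)) / (2 * d * (2 * d)) = - (b * k / (2 * d\<^sup>2))" for d k :: real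
      by (cases "d = 0") (simp_all add: power2_eq_square field_simps)
    then show ?thesis .
  qed
  finally show "((\<lambda>t. b / (2 * (t * sqrt t - b * t))) has_real_derivative - (b * (3 / 2 * sqrt t - b) / (2 * (t * sqrt t - b * t)\<^sup>2))) (at t)" .
qed

text \<open>With \<open>s = sqrt \<xi>\<close> the second derivative is about
  \<open>- 3 / 4 * b / s^5\<close>, where \<open>b <= 2 / 5\<close>. Sign and size together confine
  the value to an interval of length \<open>1 / 2 / sqrt q ^ 5\<close>, so two such values differ by
  no more than that. 1764 is \<open>42^2\<close>, the largest square below the values of
  \<open>q\<close> in \<open>turan_large\<close>.\<close>

lemma log_corr_second_difference:
  assumes "q \<ge> 1764" "x - 1 \<ge> q"
  shows "log_corr (x + 1) - 2 * log_corr x + log_corr (x - 1) \<le> 0"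
    and "- (1 / 2 / sqrt q ^ 5) \<le> log_corr (x + 1) - 2 * log_corr x + log_corr (x - 1)"
proof -
  define b where "b = 1 / hr_const"
  have b: "0 < b" "b \<le> 2 / 5"
    using hr_const_bounds by (auto simp: b_def field_simps)
  have "\<exists>\<xi>. x - 1 \<le> \<xi> \<and> \<xi> \<le> x + 1 \<and>
    log_corr (x + 1) - 2 * log_corr x + log_corr (x - 1) = - (b * (3 / 2 * sqrt \<xi> - b) / (2 * (\<xi> * sqrt \<xi> - b * \<xi>)\<^sup>2))"
    by (rule second_difference_mean_value[OF log_corr_derivs(1)[folded b_def] log_corr_derivs(2)[folded b_def]])
       (use assms in linarith)+
  then obtain \<xi> where \<xi>: "x - 1 \<le> \<xi>" "\<xi> \<le> x + 1"
    "log_corr (x + 1) - 2 * log_corr x + log_corr (x - 1) = - (b * (3 / 2 * sqrt \<xi> - b) / (2 * (\<xi> * sqrt \<xi> - b * \<xi>)\<^sup>2))"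
    by blast
  define s where "s = sqrt \<xi>"
  have "sqrt 1764 \<le> sqrt q" "sqrt q \<le> s"
    unfolding s_def using assms \<xi> by (intro real_sqrt_le_mono; linarith)+
  moreover have "sqrt 1764 = (42 :: real)"
    by (rule real_sqrt_unique) auto
  ultimately have s: "42 \<le> s" "42 \<le> sqrt q" "sqrt q \<le> s"
    by auto
  have "\<xi> = s\<^sup>2"
    using assms \<xi> by (simp add: s_def)
  then have den: "\<xi> * s - b * \<xi> = s\<^sup>2 * (s - b)"
    by (simp add: algebra_simps)
  have val: "log_corr (x + 1) - 2 * log_corr x + log_corr (x - 1) = - (b * (3 / 2 * s - b) / (2 * (s\<^sup>2 * (s - b))\<^sup>2))"
    using \<xi>(3) unfolding s_def[symmetric] den .
  have num: "0 \<le> b * (3 / 2 * s - b)" "b * (3 / 2 * s - b) \<le> 3 / 5 * s"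
  proof -
    show "0 \<le> b * (3 / 2 * s - b)"
      using b s by (intro mult_nonneg_nonneg) auto
    have "b * (3 / 2 * s - b) \<le> 2 / 5 * (3 / 2 * s)"
      using b s by (intro mult_mono) auto
    then show "b * (3 / 2 * s - b) \<le> 3 / 5 * s"
      by simp
  qed
  then show "log_corr (x + 1) - 2 * log_corr x + log_corr (x - 1) \<le> 0"
    unfolding val by simp
  have "6 / 5 * s * sqrt q ^ 5 \<le> 2 * (s\<^sup>2 * (s - b))\<^sup>2"
  proof -
    have "6 / 5 * s * sqrt q ^ 5 \<le> 6 / 5 * s * s ^ 5"
      using s assms by (intro mult_left_mono power_mono) auto
    also have "\<dots> = 2 * (s\<^sup>2 * s)\<^sup>2 * (3 / 5)"
      by (simp add: eval_nat_numeral)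
    also have "\<dots> \<le> 2 * (s\<^sup>2 * s)\<^sup>2 * (99 / 100)\<^sup>2"
      by (intro mult_left_mono) (auto simp: power2_eq_square)
    also have "\<dots> = 2 * (s\<^sup>2 * (99 / 100 * s))\<^sup>2"
      by (simp only: power_mult_distrib mult_ac)
    also have "\<dots> \<le> 2 * (s\<^sup>2 * (s - b))\<^sup>2"
      using b s by (intro mult_left_mono power_mono) auto
    finally show ?thesis .
  qed
  moreover have "0 < sqrt q ^ 5" "0 < 2 * (s\<^sup>2 * (s - b))\<^sup>2"
    using s b assms by auto
  ultimately have "3 / 5 * s / (2 * (s\<^sup>2 * (s - b))\<^sup>2) \<le> 1 / 2 / sqrt q ^ 5"
    by (simp add: field_simps)
  moreover have "b * (3 / 2 * s - b) / (2 * (s\<^sup>2 * (s - b))\<^sup>2) \<le> 3 / 5 * s / (2 * (s\<^sup>2 * (s - b))\<^sup>2)"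
    using num by (intro divide_right_mono) auto
  ultimately show "- (1 / 2 / sqrt q ^ 5) \<le> log_corr (x + 1) - 2 * log_corr x + log_corr (x - 1)"
    unfolding val by linarith
qed

lemma powr_half_int:
  assumes "t > 0"
  shows "t powr (- (real k / 2)) = 1 / sqrt t ^ k"
proof -
  have "sqrt t ^ k = t powr (real k / 2)"
    using assms by (simp add: powr_half_sqrt[symmetric] powr_power)
  then show ?thesis
    by (simp add: powr_minus_divide)
qed

lemma sqrt_ge_42:
  assumes "q \<ge> 1764"
  shows "42 \<le> sqrt q"
  by (rule real_le_rsqrt) (use assms in simp)

text \<open>The intermediate point exceeds \<open>q\<close> by at most 0.2 percent, which lowers its
  power by less than 1 percent. The constant comes from
  \<open>5 / 8 * 0.99 - 1 / 42 > 0.59\<close>.\<close>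

lemma log_main_second_difference:
  assumes q: "q \<ge> 1764" and x: "q \<le> x - 1" "x + 1 \<le> q + 3"
  shows "log_main (x + 1) - 2 * log_main x + log_main (x - 1) \<le> - (59 / 100 / sqrt q ^ 3)"
proof -
  have "\<exists>\<xi>. x - 1 \<le> \<xi> \<and> \<xi> \<le> x + 1 \<and>
      log_main (x + 1) - 2 * log_main x + log_main (x - 1) = - (hr_const / 4 * \<xi> powr (- 3 / 2)) + \<xi> powr (- 2)"
    by (rule second_difference_mean_value[OF log_main_derivs(1) log_main_derivs(2)]) (use assms in linarith)+
  then obtain \<xi> where \<xi>: "x - 1 \<le> \<xi>" "\<xi> \<le> x + 1"
    "log_main (x + 1) - 2 * log_main x + log_main (x - 1) = - (hr_const / 4 * \<xi> powr (- 3 / 2)) + \<xi> powr (- 2)"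
    by blast
  have \<xi>': "q \<le> \<xi>" "\<xi> \<le> 1002 / 1000 * q" "0 < \<xi>" "0 < q"
    using \<xi> assms by linarith+
  have "99 / 100 * (1 / sqrt q ^ 3) \<le> \<xi> powr (- 3 / 2)"
  proof -
    have "99 / 100 \<le> (1002 / 1000) powr (- 2 :: real)"
      by (simp add: powr_minus_divide power2_eq_square)
    also have "\<dots> \<le> (1002 / 1000) powr (- 3 / 2)"
      by (intro powr_mono) auto
    finally have "99 / 100 * q powr (- 3 / 2) \<le> (1002 / 1000) powr (- 3 / 2) * q powr (- 3 / 2)"
      by (intro mult_right_mono) auto
    also have "\<dots> = (1002 / 1000 * q) powr (- 3 / 2)"
      using \<xi>' by (subst powr_mult) auto
    also have "\<dots> \<le> \<xi> powr (- 3 / 2)"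
      using \<xi>' by (intro powr_mono2') auto
    finally show ?thesis
      using powr_half_int[of q 3] \<xi>' by simp
  qed
  then have "5 / 8 * (99 / 100 * (1 / sqrt q ^ 3)) \<le> hr_const / 4 * \<xi> powr (- 3 / 2)"
    using hr_const_bounds \<xi>' by (intro mult_mono) auto
  moreover have "\<xi> powr (- 2) \<le> 1 / 42 * (1 / sqrt q ^ 3)"
  proof -
    have "\<xi> powr (- 2) \<le> q powr (- 2)"
      using \<xi>' by (intro powr_mono2') auto
    also have "q powr (- 2) = 1 / sqrt q ^ 4"
      using powr_half_int[of q 4] \<xi>' by simp
    also have "\<dots> = 1 / sqrt q * (1 / sqrt q ^ 3)"
      by (simp add: eval_nat_numeral)
    also have "\<dots> \<le> 1 / 42 * (1 / sqrt q ^ 3)"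
      using sqrt_ge_42[OF q] q by (intro mult_right_mono frac_le) auto
    finally show ?thesis .
  qed
  moreover have "0 \<le> 1 / sqrt q ^ 3" "59 / 100 / sqrt q ^ 3 = 59 / 100 * (1 / sqrt q ^ 3)"
    using \<xi>' by auto
  ultimately show ?thesis
    unfolding \<xi>(3) by linarith
qed

text \<open>One use of the mean value theorem turns the third difference into a second difference of
  the first derivative \<open>D\<close>, hence into a third derivative. Its leading coefficient is
  at most \<open>3 / 8 * 13 / 5 = 0.975\<close>.\<close>

lemma log_main_third_difference:
  assumes q: "q \<ge> 1764"
  defines "\<Delta> \<equiv> \<lambda>x. log_main (x + 1) - 2 * log_main x + log_main (x - 1)"
  shows "\<bar>\<Delta> (q + 2) - \<Delta> (q + 1)\<bar> \<le> 11 / 10 / sqrt q ^ 5"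
proof -
  define D where "D = (\<lambda>t. hr_const / 2 * t powr (- 1 / 2) - t powr (- 1))"
  have D: "(log_main has_real_derivative D t) (at t)" if "t > 0" for t
    unfolding D_def by (rule log_main_derivs(1)[OF that])
  have shift: "((\<lambda>x. log_main (x + c)) has_real_derivative D (x + c)) (at x)" if "x + c > 0" for x c
    using DERIV_shift[of log_main "D (x + c)" x c] D[OF that] by simp
  have "\<exists>z>q + 1. z < q + 2 \<and> \<Delta> (q + 2) - \<Delta> (q + 1) = (q + 2 - (q + 1)) * (D (z + 1) - 2 * D z + D (z - 1))"
  proof (rule MVT2)
    fix x assume "q + 1 \<le> x" "x \<le> q + 2"
    then show "(\<Delta> has_real_derivative D (x + 1) - 2 * D x + D (x - 1)) (at x)"
      unfolding \<Delta>_def using shift[of x 1] shift[of x "-1"] D[of x] q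
      by (intro DERIV_add DERIV_diff DERIV_cmult) auto
  qed simp
  then obtain z where z: "q + 1 < z" "z < q + 2" "\<Delta> (q + 2) - \<Delta> (q + 1) = D (z + 1) - 2 * D z + D (z - 1)"
    by auto
  have "\<exists>\<xi>. z - 1 \<le> \<xi> \<and> \<xi> \<le> z + 1 \<and> D (z + 1) - 2 * D z + D (z - 1) = 3 / 8 * hr_const * \<xi> powr (- 5 / 2) - 2 * \<xi> powr (- 3)"
    unfolding D_def by (rule second_difference_mean_value[OF log_main_derivs(2) log_main_derivs(3)]) (use z q in linarith)+
  then obtain \<xi> where \<xi>: "z - 1 \<le> \<xi>" "D (z + 1) - 2 * D z + D (z - 1) = 3 / 8 * hr_const * \<xi> powr (- 5 / 2) - 2 * \<xi> powr (- 3)"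
    by blast
  have \<xi>': "q \<le> \<xi>" "0 < \<xi>" "0 < q"
    using \<xi> z q by linarith+
  have "\<xi> powr (- 5 / 2) \<le> q powr (- 5 / 2)"
    using \<xi>' by (intro powr_mono2') auto
  also have "\<dots> = 1 / sqrt q ^ 5"
    using powr_half_int[of q 5] \<xi>' by simp
  finally have "3 / 8 * hr_const * \<xi> powr (- 5 / 2) \<le> 3 / 8 * (13 / 5) * (1 / sqrt q ^ 5)"
    using hr_const_bounds \<xi>' by (intro mult_mono) auto
  moreover have "\<xi> powr (- 3) \<le> 1 / 42 * (1 / sqrt q ^ 5)"
  proof -
    have "\<xi> powr (- 3) \<le> q powr (- 3)"
      using \<xi>' by (intro powr_mono2') auto
    also have "\<dots> = 1 / sqrt q ^ 6"
      using powr_half_int[of q 6] \<xi>' by simp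
    also have "\<dots> = 1 / sqrt q * (1 / sqrt q ^ 5)"
      by (simp add: eval_nat_numeral)
    also have "\<dots> \<le> 1 / 42 * (1 / sqrt q ^ 5)"
      using sqrt_ge_42[OF q] q by (intro mult_right_mono frac_le) auto
    finally show ?thesis .
  qed
  moreover have "0 \<le> 3 / 8 * hr_const * \<xi> powr (- 5 / 2)" "0 \<le> \<xi> powr (- 3)" "0 \<le> 1 / sqrt q ^ 5"
    "11 / 10 / sqrt q ^ 5 = 11 / 10 * (1 / sqrt q ^ 5)"
    using hr_const_bounds \<xi>' by auto
  ultimately show ?thesis
    unfolding z(3) \<xi>(2) by linarith
qed

section \<open>From the main term to the inequality\<close>

definition hr_main :: "real \<Rightarrow> real" where
  "hr_main t = exp (log_main t + log_corr t) / (4 * sqrt 3)"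

lemma hr_main_pos: "hr_main t > 0"
  by (simp add: hr_main_def)

text \<open>With \<open>pi^2 <= 9.88\<close> the requirement \<open>r <= 1 / 33\<close> is met from
  1794 on. The constant 0.175 is \<open>(pi / sqrt 6)^5 / 20\<close>, about 0.1735, rounded
  up.\<close>

lemma num_partitions_hr_main:
  assumes "n \<ge> 1794"
  shows "\<bar>real (num_partitions n) / hr_main (real n - 1 / 24) - 1\<bar> \<le> 175 / 1000 / sqrt (real n - 1 / 24) ^ 5"
proof -
  define t where "t = real n - 1 / 24"
  define r where "r = pi / sqrt (6 * t)"
  have t: "t > 1793.9"
    using assms by (simp add: t_def)
  have r2: "r\<^sup>2 = pi\<^sup>2 / (6 * t)"
    using t by (simp add: r_def power_divide)
  have r_pos: "r > 0"
    using t by (simp add: r_def)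
  interpret saddle_point n r
  proof
    show "r > 0" by (rule r_pos)
    show "r \<le> 1 / 33"
    proof (rule power2_le_imp_le)
      have "pi\<^sup>2 / (6 * t) \<le> 988 / 100 / (6 * 1793.9)"
        using t pi_squared_bounds by (intro frac_le) auto
      also have "\<dots> \<le> (1 / 33)\<^sup>2"
        by (simp add: power2_eq_square)
      finally show "r\<^sup>2 \<le> (1 / 33)\<^sup>2"
        by (simp add: r2)
    qed simp
    show "real n - 1 / 24 = pi\<^sup>2 / (6 * r\<^sup>2)"
      using t by (simp add: r2 t_def[symmetric])
  qed
  have st: "sqrt t > 0" "sqrt t * sqrt t = t"
    using t by auto
  have two_B: "2 * B = hr_const * sqrt t"
  proof -
    have "sqrt (6 * t) = sqrt 6 * sqrt t"
      by (rule real_sqrt_mult)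
    moreover have "sqrt (2 / 3) * 3 = sqrt (2 / 3 * 3\<^sup>2)"
      by (simp only: real_sqrt_mult) simp
    then have "sqrt 6 = 3 * sqrt (2 / 3)"
      by simp
    moreover have "2 * B = pi * sqrt (6 * t) / 3"
      unfolding B_def using t by (simp add: r_def power2_eq_square)
    ultimately have "2 * B = pi * (3 * sqrt (2 / 3) * sqrt t) / 3"
      by (simp only:)
    also have "\<dots> = pi * sqrt (2 / 3) * sqrt t"
      by simp
    finally show ?thesis
      by (simp only: hr_const_def)
  qed
  have main: "main_term = hr_main t"
  proof -
    have "exp (log_main t + log_corr t) = exp (2 * B) / t * (1 - 1 / (2 * B))"
    proof -
      have "1 - 1 / (2 * B) > 0"
        using B_ge(2) by (simp add: field_simps)
      then have "exp (log_corr t) = 1 - 1 / (2 * B)"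
        by (simp add: log_corr_def two_B[symmetric])
      moreover have "exp (log_main t) = exp (2 * B) / t"
        using t by (simp add: log_main_def two_B[symmetric] exp_diff)
      ultimately show ?thesis
        by (simp add: exp_add)
    qed
    moreover have "sqrt 3 * r\<^sup>2 / (2 * pi\<^sup>2) = 1 / (4 * sqrt 3 * t)"
      using t by (simp add: r2 field_simps)
    ultimately show ?thesis
      unfolding main_term_def hr_main_def by simp
  qed
  have "real (num_partitions n) / hr_main t - 1 = (real (num_partitions n) - hr_main t) / hr_main t"
    using hr_main_pos[of t] by (simp add: field_simps)
  also have "\<bar>\<dots>\<bar> = \<bar>real (num_partitions n) - hr_main t\<bar> / hr_main t"
    using hr_main_pos[of t] by simp
  also have "\<dots> \<le> r ^ 5 / 20 * hr_main t / hr_main t"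
    using num_partitions_estimate(2) hr_main_pos[of t] unfolding main by (intro divide_right_mono) auto
  also have "\<dots> = r ^ 5 / 20"
    using hr_main_pos[of t] by simp
  also have "\<dots> \<le> 175 / 1000 / sqrt t ^ 5"
  proof -
    have "r \<le> 1284 / 1000 / sqrt t"
    proof (rule power2_le_imp_le)
      have "pi\<^sup>2 / (6 * t) \<le> (988 / 100) / (6 * t)"
        using t pi_squared_bounds by (intro divide_right_mono) auto
      also have "\<dots> \<le> (1284 / 1000)\<^sup>2 / t"
        using t by (simp add: power2_eq_square field_simps)
      finally show "r\<^sup>2 \<le> (1284 / 1000 / sqrt t)\<^sup>2"
        using t by (simp add: r2 power_divide)
    qed (use st in simp)
    then have "r ^ 5 \<le> (1284 / 1000 / sqrt t) ^ 5"
      using r_pos by (intro power_mono) auto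
    also have "\<dots> = (1284 / 1000) ^ 5 * (1 / sqrt t ^ 5)"
      by (simp add: power_divide)
    also have "\<dots> \<le> 35 / 10 * (1 / sqrt t ^ 5)"
      using st by (intro mult_right_mono) (auto simp: power_divide)
    finally show ?thesis
      by simp
  qed
  finally show ?thesis
    by (simp add: t_def)
qed

text \<open>Nonnegativity of \<open>v\<close> gives \<open>b <= 1\<close>, so
  \<open>2 * (a + b) - a * b\<close> is at least \<open>a + 2 * b\<close>, hence at least
  \<open>3 * m\<close>; the product term therefore exceeds \<open>3 * m^3\<close>.\<close>

lemma turan_from_bounds:
  fixes u v m d :: real
  assumes "0 \<le> u" "0 \<le> v" "m > 0" "m \<le> 1 - u" "m \<le> 1 - v" "\<bar>u - v\<bar> \<le> d" "d\<^sup>2 < 3 * m ^ 3"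
  shows "4 * (1 - u) * (1 - v) - (1 - u * v)\<^sup>2 > 0"
proof -
  define a b where "a = 1 - u" and "b = 1 - v"
  have ab: "m \<le> a" "a \<le> 1" "m \<le> b" "b \<le> 1"
    using assms by (auto simp: a_def b_def)
  have "a * b \<le> a * 1"
    using ab assms by (intro mult_left_mono) auto
  then have "3 * m \<le> 2 * (a + b) - a * b"
    using ab by simp
  moreover have "m * m \<le> a * b"
    using ab assms by (intro mult_mono) auto
  ultimately have "m * m * (3 * m) \<le> a * b * (2 * (a + b) - a * b)"
    using assms ab by (intro mult_mono) auto
  moreover have "(a - b)\<^sup>2 \<le> d\<^sup>2"
    using assms by (intro power2_le_iff_abs_le[THEN iffD2]) (auto simp: a_def b_def)
  ultimately have "(a - b)\<^sup>2 < a * b * (2 * (a + b) - a * b)"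
    using assms by (simp add: power3_eq_cube)
  moreover have "4 * (1 - u) * (1 - v) - (1 - u * v)\<^sup>2 = a * b * (2 * (a + b) - a * b) - (a - b)\<^sup>2"
    by (simp add: a_def b_def power2_eq_square algebra_simps)
  ultimately show ?thesis
    by simp
qed

text \<open>To first order the error is \<open>4 * e\<close>; the fifth \<open>e\<close> pays for
  the higher order terms.\<close>

lemma perturbed_ratio_bound:
  fixes a b c e :: real
  assumes "\<bar>a - 1\<bar> \<le> e" "\<bar>b - 1\<bar> \<le> e" "\<bar>c - 1\<bar> \<le> e" "e \<le> 1 / 100"
  shows "\<bar>a * b / c\<^sup>2 - 1\<bar> \<le> 5 * e"
proof -
  have e: "0 \<le> e"
    using assms(1) by linarith
  have c: "1 - e \<le> c" "c \<le> 1 + e" "c > 0"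
    using assms by linarith+
  have "e * e \<le> 1 / 100 * e"
    using e assms by (intro mult_right_mono) auto
  have "a * b \<le> (1 + e) * (1 + e)"
    using assms by (intro mult_mono) linarith+
  also have "\<dots> \<le> (1 + 5 * e) * ((1 - e) * (1 - e))"
  proof -
    have "(1 + 5 * e) * ((1 - e) * (1 - e)) - (1 + e) * (1 + e) = e * (1 - 10 * e + 5 * (e * e))"
      by (simp add: algebra_simps)
    also have "\<dots> \<ge> 0"
      using e assms by (intro mult_nonneg_nonneg) auto
    finally show ?thesis
      by simp
  qed
  also have "\<dots> \<le> (1 + 5 * e) * (c * c)"
    using c e assms by (intro mult_left_mono mult_mono) auto
  finally have upper: "a * b \<le> (1 + 5 * e) * c\<^sup>2"
    by (simp add: power2_eq_square)
  have "(1 - 5 * e) * (c * c) \<le> (1 - 5 * e) * ((1 + e) * (1 + e))"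
    using c e assms by (intro mult_left_mono mult_mono) auto
  also have "\<dots> \<le> (1 - e) * (1 - e)"
  proof -
    have "(1 - e) * (1 - e) - (1 - 5 * e) * ((1 + e) * (1 + e)) = e * (1 + 10 * e + 5 * (e * e))"
      by (simp add: algebra_simps)
    also have "\<dots> \<ge> 0"
      using e by (intro mult_nonneg_nonneg add_nonneg_nonneg) auto
    finally show ?thesis
      by simp
  qed
  also have "\<dots> \<le> a * b"
    using assms by (intro mult_mono) linarith+
  finally have lower: "(1 - 5 * e) * c\<^sup>2 \<le> a * b"
    by (simp add: power2_eq_square)
  have "a * b / c\<^sup>2 \<le> 1 + 5 * e" "1 - 5 * e \<le> a * b / c\<^sup>2"
    using upper lower c(3) by (simp_all add: field_simps)
  then show ?thesis
    by linarith
qed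

lemma abs_exp_diff_le:
  fixes x y :: real
  assumes "x \<le> 0" "y \<le> 0"
  shows "\<bar>exp x - exp y\<bar> \<le> \<bar>x - y\<bar>"
proof -
  have *: "\<bar>exp x - exp y\<bar> \<le> \<bar>x - y\<bar>" if "x \<le> y" "y \<le> 0" for x y :: real
  proof -
    have "exp y - exp x = exp y * (1 - exp (x - y))"
      by (simp add: right_diff_distrib exp_add[symmetric])
    also have "\<dots> \<le> 1 * (y - x)"
    proof (intro mult_mono)
      show "1 - exp (x - y) \<le> y - x"
        using exp_ge_add_one_self[of "x - y"] by linarith
    qed (use that in auto)
    finally show ?thesis
      using that by simp
  qed
  show ?thesis
    using *[of x y] *[of y x] assms by (cases "x \<le> y") (auto simp: abs_minus_commute)
qed

lemma one_minus_exp_ge: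
  fixes y :: real
  assumes "0 \<le> y"
  shows "y - y\<^sup>2 \<le> 1 - exp (- y)"
proof -
  have "exp (- y) = 1 / exp y"
    by (simp add: exp_minus inverse_eq_divide)
  also have "\<dots> \<le> 1 / (1 + y)"
    using exp_ge_add_one_self[of y] assms by (intro frac_le) auto
  also have "\<dots> \<le> 1 - y + y\<^sup>2"
  proof -
    have "1 \<le> (1 - y + y\<^sup>2) * (1 + y)"
      using assms by (simp add: algebra_simps power2_eq_square)
    then show ?thesis
      using assms by (simp add: divide_le_eq)
  qed
  finally show ?thesis
    by simp
qed

text \<open>In terms of \<open>y = 1 / sqrt q\<close> both \<open>1 - u\<close> are at least
  \<open>0.57 * y^3\<close>. The difference is at most \<open>1.6 * y^5\<close> from the main term
  plus twice \<open>5 * \<epsilon>\<close>, together \<open>3.35 * y^5\<close>. Then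
  \<open>3.35^2 * y^10 < 3 * 0.57^3 * y^9\<close> follows from \<open>y <= 1 / 42\<close>. All
  arguments lie between \<open>q\<close>, which belongs to \<open>n - 1\<close>, and
  \<open>q + 3\<close>.\<close>

theorem turan_large:
  assumes "n \<ge> 1795"
  shows "4 * (1 - u_seq n) * (1 - u_seq (n + 1)) - (1 - u_seq n * u_seq (n + 1))\<^sup>2 > 0"
proof -
  define q where "q = real n - 1 - 1 / 24"
  define y where "y = 1 / sqrt q"
  define L where "L = (\<lambda>t. log_main t + log_corr t)"
  define \<Delta> where "\<Delta> = (\<lambda>x. L (x + 1) - 2 * L x + L (x - 1))"
  define P where "P = (\<lambda>k. real (num_partitions k))"
  define h where "h = (\<lambda>k. P k / hr_main (real k - 1 / 24))"
  define \<epsilon> where "\<epsilon> = 175 / 1000 * y ^ 5"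
  have q: "q \<ge> 1764"
    using assms by (simp add: q_def)
  have y: "0 < y" "y \<le> 1 / 42"
    using sqrt_ge_42[OF q] q by (auto simp: y_def field_simps)
  have y_pow: "1 / sqrt q ^ k = y ^ k" for k
    by (simp add: y_def power_divide)
  have y2: "y * y \<le> 1 / 42 * (1 / 42)"
    using y by (intro mult_mono) auto
  have y5: "y ^ 5 = y ^ 3 * (y * y)"
    by (simp add: eval_nat_numeral)
  have y3: "0 < y ^ 3" "y ^ 3 \<le> 1 / 74088"
    using y power_mono[of y "1 / 42" 3] by (auto simp: power_divide)
  have y5_le: "y ^ 5 \<le> y ^ 3 * (1 / 1764)"
    unfolding y5 using y2 y3 by (intro mult_left_mono) auto
  have \<epsilon>: "0 \<le> \<epsilon>" "\<epsilon> \<le> 1 / 100"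
    using y y5_le y3 unfolding \<epsilon>_def by (simp, linarith)
  have P_pos: "P k > 0" for k
    using num_partitions_pos by (simp add: P_def)
  have h_bound: "\<bar>h k - 1\<bar> \<le> \<epsilon>" if "k \<ge> n - 1" for k
  proof -
    have "q \<le> real k - 1 / 24"
      using that assms by (simp add: q_def)
    then have "1 / sqrt (real k - 1 / 24) ^ 5 \<le> 1 / sqrt q ^ 5"
      using q sqrt_ge_42[OF q] by (intro divide_left_mono power_mono mult_pos_pos zero_less_power) auto
    moreover have "\<bar>h k - 1\<bar> \<le> 175 / 1000 / sqrt (real k - 1 / 24) ^ 5"
      unfolding h_def P_def using that assms by (intro num_partitions_hr_main) auto
    ultimately show ?thesis
      unfolding \<epsilon>_def y_pow[symmetric] by simp
  qed
  have hr_ratio: "hr_main (x + 1) * hr_main (x - 1) / (hr_main x)\<^sup>2 = exp (\<Delta> x)" for x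
  proof -
    have "exp (\<Delta> x) = exp (L (x + 1)) * exp (L (x - 1)) / (exp (L x))\<^sup>2"
      by (simp add: \<Delta>_def exp_add exp_diff exp_double)
    then show ?thesis
      by (simp add: hr_main_def L_def power_divide power2_eq_square)
  qed
  have ratio: "\<bar>u_seq k - exp (\<Delta> (real k - 1 / 24))\<bar> \<le> 5 * \<epsilon>" if k: "k \<ge> n" and neg: "\<Delta> (real k - 1 / 24) \<le> 0" for k
  proof -
    have k1: "real (k - 1) = real k - 1"
      using k assms by simp
    have P_eq: "P k = h k * hr_main (real k - 1 / 24)" for k
      using hr_main_pos by (simp add: h_def less_imp_neq[symmetric])
    have "u_seq k = P (k + 1) * P (k - 1) / (P k)\<^sup>2"
      by (simp add: u_seq_def P_def)
    also have "\<dots> = h (k + 1) * h (k - 1) / (h k)\<^sup>2 * (hr_main (real (k + 1) - 1 / 24) * hr_main (real (k - 1) - 1 / 24) / (hr_main (real k - 1 / 24))\<^sup>2)"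
      unfolding P_eq by (simp add: power_mult_distrib)
    also have "hr_main (real (k + 1) - 1 / 24) * hr_main (real (k - 1) - 1 / 24) / (hr_main (real k - 1 / 24))\<^sup>2 = exp (\<Delta> (real k - 1 / 24))"
      unfolding hr_ratio[symmetric] k1 by (simp add: algebra_simps)
    finally have "u_seq k - exp (\<Delta> (real k - 1 / 24)) = (h (k + 1) * h (k - 1) / (h k)\<^sup>2 - 1) * exp (\<Delta> (real k - 1 / 24))"
      by (simp add: algebra_simps)
    also have "\<bar>\<dots>\<bar> \<le> 5 * \<epsilon> * 1"
      unfolding abs_mult using neg k \<epsilon>(1)
      by (intro mult_mono perturbed_ratio_bound h_bound \<epsilon>) auto
    finally show ?thesis
      by simp
  qed
  have \<Delta>_split: "\<Delta> x = (log_main (x + 1) - 2 * log_main x + log_main (x - 1)) + (log_corr (x + 1) - 2 * log_corr x + log_corr (x - 1))" for x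
    by (simp add: \<Delta>_def L_def)
  have \<Delta>_le: "\<Delta> x \<le> - (59 / 100 * y ^ 3)" if "q \<le> x - 1" "x + 1 \<le> q + 3" for x
    using log_main_second_difference[OF q that] log_corr_second_difference(1)[OF q that(1)] y_pow[of 3]
    unfolding \<Delta>_split by simp
  have y5_eq: "11 / 10 / sqrt q ^ 5 = 11 / 10 * y ^ 5" "1 / 2 / sqrt q ^ 5 = 1 / 2 * y ^ 5"
    unfolding y_pow[symmetric] by simp_all
  have "q \<le> q + 1 - 1" "q \<le> q + 2 - 1"
    by simp_all
  note corr = log_corr_second_difference[OF q this(1)] log_corr_second_difference[OF q this(2)]
  have \<Delta>_diff: "\<bar>\<Delta> (q + 2) - \<Delta> (q + 1)\<bar> \<le> 16 / 10 * y ^ 5"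
    using log_main_third_difference[OF q] corr unfolding \<Delta>_split y5_eq by linarith
  have idx: "real n - 1 / 24 = q + 1" "real (n + 1) - 1 / 24 = q + 2"
    by (simp_all add: q_def)
  have neg: "\<Delta> (q + 1) \<le> - (59 / 100 * y ^ 3)" "\<Delta> (q + 2) \<le> - (59 / 100 * y ^ 3)"
    by (rule \<Delta>_le; simp)+
  have nonpos: "\<Delta> (q + 1) \<le> 0" "\<Delta> (q + 2) \<le> 0"
    using neg y3 by linarith+
  have u: "\<bar>u_seq n - exp (\<Delta> (q + 1))\<bar> \<le> 5 * \<epsilon>" and v: "\<bar>u_seq (n + 1) - exp (\<Delta> (q + 2))\<bar> \<le> 5 * \<epsilon>"
    using ratio[of n] ratio[of "n + 1"] nonpos unfolding idx by auto
  have gap: "58 / 100 * y ^ 3 \<le> 1 - exp d" if "d \<le> - (59 / 100 * y ^ 3)" for d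
  proof -
    define z where "z = 59 / 100 * y ^ 3"
    have z: "0 \<le> z" "z \<le> 1 / 100"
      using y3 by (auto simp: z_def)
    have "z * z \<le> 1 / 100 * z"
      using z by (intro mult_right_mono) auto
    moreover have "58 / 100 * y ^ 3 \<le> 99 / 100 * z"
      using y3 by (simp add: z_def)
    ultimately have "58 / 100 * y ^ 3 \<le> z - z\<^sup>2"
      unfolding power2_eq_square by linarith
    also have "\<dots> \<le> 1 - exp (- z)"
      by (rule one_minus_exp_ge[OF z(1)])
    also have "\<dots> \<le> 1 - exp d"
      using that by (simp add: z_def)
    finally show ?thesis .
  qed
  have \<epsilon>5: "5 * \<epsilon> \<le> 1 / 100 * y ^ 3"
    using y5_le y3 unfolding \<epsilon>_def by linarith
  show ?thesis
  proof (rule turan_from_bounds)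
    show "0 \<le> u_seq n" "0 \<le> u_seq (n + 1)"
      by (simp_all add: u_seq_def)
    show "0 < 57 / 100 * y ^ 3"
      using y3 by simp
    show "57 / 100 * y ^ 3 \<le> 1 - u_seq n"
      using gap[OF neg(1)] u \<epsilon>5 by linarith
    show "57 / 100 * y ^ 3 \<le> 1 - u_seq (n + 1)"
      using gap[OF neg(2)] v \<epsilon>5 by linarith
    have "\<bar>exp (\<Delta> (q + 1)) - exp (\<Delta> (q + 2))\<bar> \<le> 16 / 10 * y ^ 5"
      using abs_exp_diff_le[OF nonpos] \<Delta>_diff by linarith
    then show "\<bar>u_seq n - u_seq (n + 1)\<bar> \<le> 335 / 100 * y ^ 5"
      using u v unfolding \<epsilon>_def by linarith
    have "(y ^ 5)\<^sup>2 = y ^ 9 * y"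
      by (simp add: eval_nat_numeral)
    then have "(335 / 100 * y ^ 5)\<^sup>2 = (335 / 100)\<^sup>2 * y ^ 9 * y"
      by (simp only: power_mult_distrib mult.assoc)
    also have "\<dots> \<le> (335 / 100)\<^sup>2 * y ^ 9 * (1 / 42)"
      using y by (intro mult_left_mono) auto
    also have "\<dots> < 3 * (57 / 100) ^ 3 * y ^ 9"
      using y by (simp add: power2_eq_square power3_eq_cube)
    also have "\<dots> = 3 * (57 / 100 * y ^ 3) ^ 3"
    proof -
      have "y ^ 9 = (y ^ 3) ^ 3"
        by (simp flip: power_mult)
      then show ?thesis
        by (simp only: power_mult_distrib mult.assoc)
    qed
    finally show "(335 / 100 * y ^ 5)\<^sup>2 < 3 * (57 / 100 * y ^ 3) ^ 3" .
  qed
qed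

section \<open>The pentagonal number recurrence\<close>

definition bounded_gf :: "nat \<Rightarrow> int fps" where
  "bounded_gf k = Abs_fps (\<lambda>n. int (num_partitions_le k n))"

definition euler_poly :: "nat \<Rightarrow> int fps" where
  "euler_poly k = (\<Prod>j=1..k. 1 - fps_X ^ j)"

lemma euler_poly_0 [simp]: "euler_poly 0 = 1"
  by (simp add: euler_poly_def)

lemma euler_poly_Suc: "euler_poly (Suc k) = euler_poly k * (1 - fps_X ^ Suc k)"
  by (simp add: euler_poly_def mult.commute)

lemma bounded_gf_times_euler_poly: "bounded_gf k * euler_poly k = 1"
proof (induction k)
  case 0
  show ?case
    by (simp add: bounded_gf_def num_partitions_le_0 fps_eq_iff)
next
  case (Suc k)
  have "bounded_gf (Suc k) * (1 - fps_X ^ Suc k) = bounded_gf k"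
  proof (rule fps_ext)
    fix n
    show "(bounded_gf (Suc k) * (1 - fps_X ^ Suc k)) $ n = bounded_gf k $ n"
      using num_partitions_le_Suc[of k n]
      by (auto simp: right_diff_distrib bounded_gf_def fps_X_power_mult_right_nth simp del: power_Suc)
  qed
  then have "bounded_gf (Suc k) * euler_poly (Suc k) = bounded_gf k * euler_poly k"
    by (simp add: euler_poly_Suc mult_ac del: power_Suc)
  with Suc show ?case
    by simp
qed

section \<open>Shanks' finite identity\<close>

fun triangular :: "nat \<Rightarrow> nat" where
  "triangular 0 = 0"
| "triangular (Suc s) = triangular s + Suc s"

text \<open>The product is \<open>euler_poly n\<close> divided by \<open>euler_poly s\<close>. The
  sum over \<open>s\<close> is known exactly, while up to degree \<open>n\<close> only
  \<open>s = 0\<close> contributes, and that summand is \<open>euler_poly n\<close>.\<close>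

definition shanks_term :: "nat \<Rightarrow> nat \<Rightarrow> int fps" where
  "shanks_term n s = (- 1) ^ s * (\<Prod>j=Suc s..n. 1 - fps_X ^ j) * fps_X ^ (s * n + triangular s)"

text \<open>Raising \<open>m\<close> by one changes the k-th summand by a difference of consecutive
  boundary terms, so only the last boundary term survives.\<close>

lemma shanks_telescope:
  "k \<le> Suc m \<Longrightarrow> (\<Sum>s<k. shanks_term (Suc m) s) = (\<Sum>s<k. shanks_term m s) +
     (if k = 0 then 0 else (- 1) ^ k * (\<Prod>j=k..m. 1 - fps_X ^ j) * fps_X ^ (k * m + triangular k))"
proof (induction k)
  case 0
  then show ?case by simp
next
  case (Suc k)
  define P :: "int fps" where "P = (\<Prod>j=Suc k..m. 1 - fps_X ^ j)"
  define E where "E = k * m + triangular k"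
  have k: "k \<le> m"
    using Suc.prems by simp
  have "(\<Prod>j=Suc k..Suc m. 1 - fps_X ^ j) = P * (1 - fps_X ^ Suc m :: int fps)"
    using k by (simp add: P_def mult.commute)
  then have 1: "shanks_term (Suc m) k = (- 1) ^ k * (P * (1 - fps_X ^ Suc m)) * fps_X ^ (E + k)"
    unfolding shanks_term_def E_def by (simp only: mult_Suc_right ac_simps)
  have 2: "shanks_term m k = (- 1) ^ k * P * fps_X ^ E"
    by (simp add: shanks_term_def P_def E_def)
  have 3: "Suc k * m + triangular (Suc k) = E + k + Suc m"
    by (simp add: E_def)
  \<comment> \<open>At \<open>k = 0\<close> the factor \<open>1 - fps_X ^ 0\<close> vanishes, so one
    formula covers both cases.\<close>
  have 4: "(if k = 0 then 0 else (- 1) ^ k * (\<Prod>j=k..m. 1 - fps_X ^ j) * fps_X ^ E) = (- 1) ^ k * (P * (1 - fps_X ^ k)) * (fps_X ^ E :: int fps)"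
  proof (cases "k = 0")
    case False
    have "(\<Prod>j=k..m. 1 - fps_X ^ j) = (1 - fps_X ^ k) * P"
      unfolding P_def using k by (rule prod.atLeast_Suc_atMost)
    then show ?thesis
      using False by (simp add: mult.commute)
  qed simp
  have step: "shanks_term (Suc m) k = shanks_term m k + (- 1) ^ Suc k * P * fps_X ^ (E + k + Suc m) - (- 1) ^ k * (P * (1 - fps_X ^ k)) * fps_X ^ E"
    unfolding 1 2 by (simp add: power_add algebra_simps)
  have IH: "(\<Sum>s<k. shanks_term (Suc m) s) = (\<Sum>s<k. shanks_term m s) + (- 1) ^ k * (P * (1 - fps_X ^ k)) * fps_X ^ E"
  proof -
    have "(\<Sum>s<k. shanks_term (Suc m) s) = (\<Sum>s<k. shanks_term m s) + (if k = 0 then 0 else (- 1) ^ k * (\<Prod>j=k..m. 1 - fps_X ^ j) * fps_X ^ E)"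
      unfolding E_def using Suc.IH k by simp
    then show ?thesis
      by (simp only: 4)
  qed
  have "(\<Sum>s<Suc k. shanks_term (Suc m) s) = (\<Sum>s<Suc k. shanks_term m s) + (- 1) ^ Suc k * P * fps_X ^ (E + k + Suc m)"
    unfolding sum.lessThan_Suc IH step by simp
  then show ?case
    unfolding 3 P_def[symmetric] by (simp only: nat.distinct if_False)
qed

text \<open>The pentagonal number \<open>j * (3 * j - 1) / 2\<close>; \<open>pent j + j\<close> is
  its companion \<open>j * (3 * j + 1) / 2\<close>.\<close>

fun pent :: "nat \<Rightarrow> nat" where
  "pent 0 = 0"
| "pent (Suc j) = pent j + 3 * j + 1"

lemma pent_Suc_eq: "pent (Suc m) = Suc m * m + triangular (Suc m)"
  by (induction m) (simp_all add: algebra_simps)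

lemma pent_plus_eq: "pent m + m = m * m + triangular m"
  by (cases m) (simp_all only: pent_Suc_eq, simp_all add: algebra_simps)

lemma pent_mono: "i \<le> j \<Longrightarrow> pent i \<le> pent j"
  by (rule lift_Suc_mono_le[of pent]) auto

definition pent_sum :: "nat \<Rightarrow> int fps" where
  "pent_sum n = 1 + (\<Sum>j=1..n. (- 1) ^ j * (fps_X ^ pent j + fps_X ^ (pent j + j)))"

text \<open>Raising \<open>n\<close> adds the boundary term of \<open>shanks_telescope\<close> and
  one new top summand; by \<open>pent_Suc_eq\<close> and \<open>pent_plus_eq\<close> their exponents
  are the next two pentagonal numbers.\<close>

theorem shanks_identity: "(\<Sum>s\<le>n. shanks_term n s) = pent_sum n"
proof (induction n)
  case 0
  then show ?case
    by (simp add: shanks_term_def pent_sum_def)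
next
  case (Suc n)
  have "(\<Sum>s\<le>Suc n. shanks_term (Suc n) s) = (\<Sum>s<Suc n. shanks_term (Suc n) s) + shanks_term (Suc n) (Suc n)"
    by (simp add: lessThan_Suc_atMost)
  also have "(\<Sum>s<Suc n. shanks_term (Suc n) s) = (\<Sum>s<Suc n. shanks_term n s) + (- 1) ^ Suc n * fps_X ^ pent (Suc n)"
    using shanks_telescope[of "Suc n" n] unfolding pent_Suc_eq by simp
  also have "shanks_term (Suc n) (Suc n) = (- 1) ^ Suc n * fps_X ^ (pent (Suc n) + Suc n)"
    unfolding pent_plus_eq shanks_term_def by simp
  finally show ?case
    using Suc.IH by (simp add: pent_sum_def lessThan_Suc_atMost distrib_left del: pent.simps)
qed

lemma euler_poly_nth:
  assumes "m \<le> n"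
  shows "euler_poly n $ m = pent_sum n $ m"
proof -
  have "shanks_term n s $ m = 0" if "s \<in> {1..n}" for s
  proof -
    have "m < s * n + triangular s"
    proof -
      have "1 * n \<le> s * n"
        using that by (intro mult_right_mono) auto
      moreover have "triangular s > 0"
        using that by (cases s) auto
      ultimately show ?thesis
        using assms by linarith
    qed
    then show ?thesis
      by (simp add: shanks_term_def fps_X_power_mult_right_nth)
  qed
  then have "(\<Sum>s\<in>{1..n}. shanks_term n s) $ m = 0"
    by (simp add: fps_sum_nth)
  moreover have "{..n} = insert 0 {1..n}"
    by auto
  then have "(\<Sum>s\<le>n. shanks_term n s) = shanks_term n 0 + (\<Sum>s\<in>{1..n}. shanks_term n s)"
    by simp
  moreover have "shanks_term n 0 = euler_poly n"
    by (simp add: shanks_term_def euler_poly_def)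
  ultimately show ?thesis
    using shanks_identity[of n] by (metis add_cancel_left_right fps_add_nth)
qed

text \<open>The guard encodes p = 0 at negative arguments; truncated subtraction alone would give
  \<open>num_partitions 0 = 1\<close>.\<close>

definition shifted_partitions :: "nat \<Rightarrow> nat \<Rightarrow> int" where
  "shifted_partitions m g = (if g \<le> m then int (num_partitions (m - g)) else 0)"

text \<open>Coefficient \<open>m\<close> of \<open>bounded_gf n * euler_poly n = 1\<close>. Taking
  \<open>n >= m\<close> makes both truncations invisible up to degree \<open>m\<close>, and
  \<open>n >= K\<close> makes the sum contain the range in question.\<close>

theorem pentagonal_recurrence:
  assumes "m > 0" "m < pent (Suc K)"
  shows "int (num_partitions m) = (\<Sum>j=1..K. - ((- 1) ^ j) * (shifted_partitions m (pent j) + shifted_partitions m (pent j + j)))"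
proof -
  define n where "n = max m K"
  have nth: "bounded_gf n $ i = int (num_partitions i)" if "i \<le> m" for i
    using that by (simp add: bounded_gf_def num_partitions_le_eq n_def)
  have shift: "(bounded_gf n * fps_X ^ g) $ m = shifted_partitions m g" for g
    using nth by (simp add: fps_X_power_mult_right_nth shifted_partitions_def)
  have "0 = (bounded_gf n * euler_poly n) $ m"
    using assms by (simp add: bounded_gf_times_euler_poly)
  also have "\<dots> = (bounded_gf n * pent_sum n) $ m"
    unfolding fps_mult_nth by (intro sum.cong refl) (auto simp: euler_poly_nth n_def)
  also have "\<dots> = int (num_partitions m) + (\<Sum>j=1..n. (bounded_gf n * ((- 1) ^ j * (fps_X ^ pent j + fps_X ^ (pent j + j)))) $ m)"
    by (simp add: pent_sum_def distrib_left sum_distrib_left fps_sum_nth nth)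
  also have "(\<Sum>j=1..n. (bounded_gf n * ((- 1) ^ j * (fps_X ^ pent j + fps_X ^ (pent j + j)))) $ m) =
      (\<Sum>j=1..n. (- 1) ^ j * (shifted_partitions m (pent j) + shifted_partitions m (pent j + j)))"
  proof (intro sum.cong refl)
    fix j
    have "(- 1) ^ j = fps_const ((- 1) ^ j :: int)"
      by (simp add: fps_const_power[symmetric] flip: fps_const_neg)
    then have "bounded_gf n * ((- 1) ^ j * (fps_X ^ pent j + fps_X ^ (pent j + j))) =
        fps_const ((- 1) ^ j) * (bounded_gf n * fps_X ^ pent j + bounded_gf n * fps_X ^ (pent j + j))"
      by (simp only: distrib_left mult_ac)
    then show "(bounded_gf n * ((- 1) ^ j * (fps_X ^ pent j + fps_X ^ (pent j + j)))) $ m =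
        (- 1) ^ j * (shifted_partitions m (pent j) + shifted_partitions m (pent j + j))"
      by (simp only: fps_mult_left_const_nth fps_add_nth shift)
  qed
  also have "\<dots> = (\<Sum>j=1..K. (- 1) ^ j * (shifted_partitions m (pent j) + shifted_partitions m (pent j + j)))"
  proof (rule sum.mono_neutral_right)
    show "\<forall>j\<in>{1..n} - {1..K}. (- 1) ^ j * (shifted_partitions m (pent j) + shifted_partitions m (pent j + j)) = 0"
    proof
      fix j assume "j \<in> {1..n} - {1..K}"
      then have "pent (Suc K) \<le> pent j"
        by (intro pent_mono) auto
      then show "(- 1) ^ j * (shifted_partitions m (pent j) + shifted_partitions m (pent j + j)) = 0"
        using assms by (simp add: shifted_partitions_def)
    qed
  qed (auto simp: n_def)
  finally have "int (num_partitions m) = - (\<Sum>j=1..K. (- 1) ^ j * (shifted_partitions m (pent j) + shifted_partitions m (pent j + j)))"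
    by linarith
  then show ?thesis
    by (simp add: sum_negf[symmetric])
qed

section \<open>The inequality for small arguments\<close>

text \<open>
  The recurrence occurs in \<open>turan_chain\<close> as the premise of an implication: simplification with \<open>imp_cong\<close> then turns every
  computed value into a rewrite rule for \<open>p\<close>. The lists \<open>ps\<close> and \<open>ns\<close> hold the indices \<open>n - g\<close> for the pentagonal numbers
  \<open>g \<le> n\<close> of positive and negative sign; they are incremented along with \<open>n\<close>, which is cheaper than subtracting. For
  \<open>n \<ge> 140\<close> the leading bits of the four values suffice, so they are divided by a growing power \<open>k\<close> of two.
\<close>

fun pent_offsets :: "nat \<Rightarrow> nat \<Rightarrow> nat \<Rightarrow> bool \<Rightarrow> (bool \<times> nat) list" where
  "pent_offsets 0 j g b = []"
| "pent_offsets (Suc k) j g b = (b, g) # (b, g + j) # pent_offsets k (j + 1) (g + 3 * j + 1) (\<not> b)"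

definition signed_shift :: "(nat \<Rightarrow> int) \<Rightarrow> nat \<Rightarrow> bool \<times> nat \<Rightarrow> int" where
  "signed_shift p m x = (if snd x \<le> m then (if fst x then 1 else - 1) * p (m - snd x) else 0)"

text \<open>The arguments \<open>g\<close> and \<open>b\<close> of \<open>pent_offsets\<close> stand
  for \<open>pent j\<close> and \<open>odd j\<close>, an invariant of its recursion: odd
  \<open>j\<close> carries the positive sign.\<close>

lemma sum_pent_offsets:
  "(\<Sum>x\<leftarrow>pent_offsets k j (pent j) (odd j). signed_shift (\<lambda>i. int (num_partitions i)) m x) =
   (\<Sum>i=j..<j + k. - ((- 1) ^ i) * (shifted_partitions m (pent i) + shifted_partitions m (pent i + i)))"
proof (induction k arbitrary: j)
  case (Suc k)
  have "pent (Suc j) = pent j + 3 * j + 1" "odd (Suc j) \<longleftrightarrow> \<not> odd j"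
    by simp_all
  with Suc[of "Suc j"] show ?case
    by (simp add: sum.atLeast_Suc_lessThan[of j] signed_shift_def shifted_partitions_def)
qed simp

lemma sorted_pent_offsets:
  assumes "j > 0"
  shows "sorted_wrt (<) (map snd (pent_offsets k j g b)) \<and> (\<forall>x\<in>set (pent_offsets k j g b). g \<le> snd x)"
  using assms
proof (induction k arbitrary: j g b)
  case (Suc k)
  from Suc.IH[of "j + 1" "g + 3 * j + 1" "\<not> b"] Suc.prems show ?case
    by (force simp: less_eq_Suc_le)
qed simp

text \<open>The equation for a single index avoids a final addition of 0 during evaluation.\<close>

fun index_sum :: "(nat \<Rightarrow> int) \<Rightarrow> nat list \<Rightarrow> int" where
  "index_sum p [] = 0"
| "index_sum p [i] = p i"
| "index_sum p (i # j # is) = p i + index_sum p (j # is)"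

fun incr_all :: "nat list \<Rightarrow> nat list" where
  "incr_all [] = []"
| "incr_all (i # is) = (i + 1) # incr_all is"

lemma index_sum_conv: "index_sum p is = (\<Sum>i\<leftarrow>is. p i)"
  by (induction p "is" rule: index_sum.induct) auto

lemma incr_all_conv: "incr_all is = map (\<lambda>i. i + 1) is"
  by (induction "is") auto

text \<open>For consecutive values \<open>a\<close>, \<open>b\<close>, \<open>c\<close>,
  \<open>d\<close> of p this is the claimed inequality multiplied by
  \<open>(b * c)^2\<close>.\<close>

definition turan_exact :: "int \<Rightarrow> int \<Rightarrow> int \<Rightarrow> int \<Rightarrow> bool" where
  "turan_exact a b c d \<longleftrightarrow> (b * c - a * d) * (b * c - a * d) < 4 * ((b * b - a * c) * (c * c - b * d))"

definition turan_cond :: "int \<Rightarrow> int \<Rightarrow> int \<Rightarrow> bool" where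
  "turan_cond S T t \<longleftrightarrow> 0 < S \<and> 0 < T \<and> t * t < 4 * (S * T)"

text \<open>Interval arithmetic: the arguments are quotients rounded down and adding 1 rounds up, so
  the first two entries are lower bounds and the third is an upper bound.\<close>

definition turan_rounded :: "int \<Rightarrow> int \<Rightarrow> int \<Rightarrow> int \<Rightarrow> bool" where
  "turan_rounded a b c d \<longleftrightarrow>
     turan_cond (b * b - (a + 1) * (c + 1)) (c * c - (b + 1) * (d + 1)) ((b + 1) * (c + 1) - a * d)"

lemma turan_rounded_imp_exact:
  assumes "a > 0" "b > 0" "c > 0" "d > 0" "k > 0"
    and "turan_rounded (a div k) (b div k) (c div k) (d div k)"
  shows "turan_exact a b c d"
proof -
  define A B C D where "A = a div k" and "B = b div k" and "C = c div k" and "D = d div k"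
  define S T t where "S = B * B - (A + 1) * (C + 1)" and "T = C * C - (B + 1) * (D + 1)" and "t = (B + 1) * (C + 1) - A * D"
  have STt: "0 < S" "0 < T" "t * t < 4 * (S * T)"
    using assms(6) by (auto simp: turan_rounded_def turan_cond_def A_def B_def C_def D_def S_def T_def t_def)
  have nonneg: "A \<ge> 0" "B \<ge> 0" "C \<ge> 0" "D \<ge> 0"
    using assms by (auto simp: A_def B_def C_def D_def pos_imp_zdiv_nonneg_iff)
  have div_mod: "x div k * k + x mod k = x" "0 \<le> x mod k" "x mod k < k" for x
    using assms(5) by simp_all
  have lower: "x div k * k \<le> x" for x
    using div_mod[of x] by linarith
  have upper: "x \<le> (x div k + 1) * k" for x
    using div_mod[of x] unfolding distrib_right by linarith
  have prods: "B * k * (B * k) \<le> b * b" "a * c \<le> (A + 1) * k * ((C + 1) * k)"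
    "C * k * (C * k) \<le> c * c" "b * d \<le> (B + 1) * k * ((D + 1) * k)"
    "b * c \<le> (B + 1) * k * ((C + 1) * k)" "A * k * (D * k) \<le> a * d"
    unfolding A_def B_def C_def D_def using assms nonneg[unfolded A_def B_def C_def D_def]
    by (intro mult_mono lower upper; simp)+
  have S: "S * (k * k) \<le> b * b - a * c" and T: "T * (k * k) \<le> c * c - b * d" and t: "b * c - a * d \<le> t * (k * k)"
    using prods unfolding S_def T_def t_def by (simp_all add: algebra_simps)
  have kk: "k * k > 0"
    using assms by simp
  have pos: "0 < S * (k * k)" "0 < T * (k * k)"
    using STt kk by auto
  have "a * c < b * b" "b * d < c * c"
    using S T pos by linarith+
  \<comment> \<open>The rounded data bound \<open>b * c - a * d\<close> only from above. Squaring
    also needs its sign, which follows by multiplying the two log-concavity inequalities.\<close>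
  then have "(a * c) * (b * d) < (b * b) * (c * c)"
    using assms(1-4) by (intro mult_strict_mono[of "a * c" "b * b"]) (assumption | simp)+
  then have "(b * c) * (a * d) < (b * c) * (b * c)"
    by (simp add: mult_ac)
  then have "a * d < b * c"
    using assms by (simp add: mult_less_cancel_left_pos)
  then have "(b * c - a * d) * (b * c - a * d) \<le> (t * (k * k)) * (t * (k * k))"
    using t by (intro mult_mono) auto
  also have "\<dots> = (t * t) * ((k * k) * (k * k))"
    by (simp add: mult_ac)
  also have "\<dots> < 4 * (S * T) * ((k * k) * (k * k))"
    using STt kk by (intro mult_strict_right_mono) auto
  also have "\<dots> = 4 * ((S * (k * k)) * (T * (k * k)))"
    by (simp add: mult_ac)
  also have "\<dots> \<le> 4 * ((b * b - a * c) * (c * c - b * d))"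
    using S T pos by (intro mult_left_mono mult_mono) auto
  finally show ?thesis
    unfolding turan_exact_def .
qed

text \<open>\<open>n\<close> is the index of the last value \<open>d\<close>, so 97 corresponds to
  the index 95 of the theorem.\<close>

definition turan_check :: "num \<Rightarrow> nat \<Rightarrow> int \<Rightarrow> int \<Rightarrow> int \<Rightarrow> int \<Rightarrow> bool" where
  "turan_check k n a b c d = (if n < 97 then True else if n < 140 then turan_exact a b c d
     else turan_rounded (a div numeral k) (b div numeral k) (c div numeral k) (d div numeral k))"

text \<open>Heuristically p(n) grows by about \<open>exp (pi / 2)\<close>, or 4.8, on average from
  one offset to the next. Quadrupling \<open>k\<close> at each offset therefore keeps the quotients
  short while they still gain precision.\<close>

function turan_chain :: "nat \<Rightarrow> (nat \<Rightarrow> int) \<Rightarrow> num \<Rightarrow> int \<Rightarrow> int \<Rightarrow> int \<Rightarrow> nat \<Rightarrow> nat list \<Rightarrow> nat list \<Rightarrow> (bool \<times> nat) list \<Rightarrow> bool" where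
  "turan_chain N p k a b c n ps ns [] = True"
| "turan_chain N p k a b c n ps ns ((s, w) # ws) =
    (if N \<le> n then True
     else if n = w then
       turan_chain N p (if n < 150 then k else num.Bit0 (num.Bit0 k)) a b c n
         (if s then 0 # ps else ps) (if s then ns else 0 # ns) ws
     else (p n = index_sum p ps - index_sum p ns \<longrightarrow>
       turan_check k n a b c (p n) \<and> turan_chain N p k b c (p n) (n + 1) (incr_all ps) (incr_all ns) ((s, w) # ws)))"
  by pat_completeness auto
termination
  by (relation "measures [\<lambda>(N, p, k, a, b, c, n, ps, ns, ws). N - n, \<lambda>(N, p, k, a, b, c, n, ps, ns, ws). length ws]") auto

declare turan_chain.simps [simp del]

text \<open>Invariant: \<open>gp\<close> and \<open>gn\<close> are the offsets already passed,
  \<open>ws\<close> those to come, and the recurrence is split accordingly. An offset of size at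
  least \<open>N\<close> in \<open>ws\<close> ensures that the list is not exhausted before
  \<open>N\<close> is reached; on the empty list \<open>turan_chain\<close> asserts nothing.\<close>

lemma turan_chain_sound:
  assumes "turan_chain N p k a b c n ps ns ws"
    and "\<And>m. n \<le> m \<Longrightarrow> m < N \<Longrightarrow> p m = (\<Sum>g\<leftarrow>gp. p (m - g)) - (\<Sum>g\<leftarrow>gn. p (m - g)) + (\<Sum>x\<leftarrow>ws. signed_shift p m x)"
    and "ps = map (\<lambda>g. n - g) gp" "ns = map (\<lambda>g. n - g) gn" "\<And>g. g \<in> set gp \<union> set gn \<Longrightarrow> g \<le> n"
    and "sorted_wrt (<) (map snd ws)" "\<And>x. x \<in> set ws \<Longrightarrow> n \<le> snd x"
    and "\<exists>x\<in>set ws. N \<le> snd x"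
    and "a = p (n - 3)" "b = p (n - 2)" "c = p (n - 1)" "n \<ge> 3"
    and "\<And>i. p i > 0"
    and "m \<in> {n..<N}" "m \<ge> 97"
  shows "turan_exact (p (m - 3)) (p (m - 2)) (p (m - 1)) (p m)"
  using assms
proof (induction N p k a b c n ps ns ws arbitrary: gp gn rule: turan_chain.induct)
  case (1 N p k a b c n ps ns)
  from "1.prems"(8) show ?case
    by simp
next
  case (2 N p k a b c n ps ns s w ws)
  note prems = "2.prems"
  have nN: "\<not> N \<le> n"
    using prems(14) by auto
  show ?case
  proof (cases "n = w")
    case True
    show ?thesis
    proof (rule "2.IH"(1)[OF nN True, where gp = "if s then n # gp else gp" and gn = "if s then gn else n # gn"])
      show "turan_chain N p (if n < 150 then k else num.Bit0 (num.Bit0 k)) a b c n (if s then 0 # ps else ps) (if s then ns else 0 # ns) ws"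
        using prems(1) nN True unfolding turan_chain.simps(2)[of N p k a b c n ps ns s w ws] by argo
      show "p m = (\<Sum>g\<leftarrow>(if s then n # gp else gp). p (m - g)) - (\<Sum>g\<leftarrow>(if s then gn else n # gn). p (m - g)) + (\<Sum>x\<leftarrow>ws. signed_shift p m x)"
        if "n \<le> m" "m < N" for m
        using prems(2)[OF that] that True by (cases s) (simp_all add: signed_shift_def)
      show "(if s then 0 # ps else ps) = map (\<lambda>g. n - g) (if s then n # gp else gp)"
        "(if s then ns else 0 # ns) = map (\<lambda>g. n - g) (if s then gn else n # gn)"
        using prems(3,4) by simp_all
      show "g \<le> n" if "g \<in> set (if s then n # gp else gp) \<union> set (if s then gn else n # gn)" for g
        using prems(5)[of g] that by (auto split: if_splits)
      show "sorted_wrt (<) (map snd ws)"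
        using prems(6) by simp
      show "n \<le> snd x" if "x \<in> set ws" for x
        using prems(7) that by simp
      show "\<exists>x\<in>set ws. N \<le> snd x"
        using prems(8) True nN by auto
    qed (fact prems(9-15))+
  next
    case False
    then have "n < w"
      using prems(7)[of "(s, w)"] by simp
    \<comment> \<open>Strict sorting puts all remaining offsets beyond \<open>n\<close>, so they
      contribute nothing to the recurrence at \<open>n\<close>.\<close>
    have gt: "n < snd x" if "x \<in> set ((s, w) # ws)" for x
    proof -
      have "x = (s, w) \<or> w < snd x"
        using that prems(6) by auto
      then show ?thesis
        using \<open>n < w\<close> by auto
    qed
    have "signed_shift p n x = 0" if "x \<in> set ((s, w) # ws)" for x
      using gt[OF that] by (simp add: signed_shift_def)
    then have "map (signed_shift p n) ((s, w) # ws) = map (\<lambda>_. 0) ((s, w) # ws)"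
      by (intro map_cong refl)
    then have "(\<Sum>x\<leftarrow>(s, w) # ws. signed_shift p n x) = 0"
      by (simp only: sum_list_0)
    moreover have "p n = (\<Sum>g\<leftarrow>gp. p (n - g)) - (\<Sum>g\<leftarrow>gn. p (n - g)) + (\<Sum>x\<leftarrow>(s, w) # ws. signed_shift p n x)"
      using prems(2)[of n] nN by simp
    ultimately have prem: "p n = index_sum p ps - index_sum p ns"
      unfolding prems(3,4) index_sum_conv by (simp add: o_def)
    have chain: "turan_check k n a b c (p n)" "turan_chain N p k b c (p n) (n + 1) (incr_all ps) (incr_all ns) ((s, w) # ws)"
      using prems(1) nN False prem unfolding turan_chain.simps(2)[of N p k a b c n ps ns s w ws] by argo+
    show ?thesis
    proof (cases "m = n")
      case True
      have "turan_exact a b c (p n)"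
      proof (cases "n < 140")
        case False
        then have "turan_rounded (a div numeral k) (b div numeral k) (c div numeral k) (p n div numeral k)"
          using chain(1) True prems(15) by (simp add: turan_check_def)
        then show ?thesis
          by (rule turan_rounded_imp_exact[rotated -1]) (simp_all only: prems(9-11,13) zero_less_numeral)
      qed (use chain(1) True prems(15) in \<open>simp add: turan_check_def\<close>)
      then show ?thesis
        unfolding prems(9-11) True .
    next
      case mn: False
      show ?thesis
      proof (rule "2.IH"(2)[OF nN False prem chain(2), where gp = gp and gn = gn])
        show "p i = (\<Sum>g\<leftarrow>gp. p (i - g)) - (\<Sum>g\<leftarrow>gn. p (i - g)) + (\<Sum>x\<leftarrow>(s, w) # ws. signed_shift p i x)"
          if "n + 1 \<le> i" "i < N" for i
          using prems(2)[of i] that by simp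
        have "map (\<lambda>i. i + 1) (map (\<lambda>g. n - g) l) = map (\<lambda>g. n + 1 - g) l" if "\<And>g. g \<in> set l \<Longrightarrow> g \<le> n" for l
          using that by (simp add: Suc_diff_le)
        then show "incr_all ps = map (\<lambda>g. n + 1 - g) gp" "incr_all ns = map (\<lambda>g. n + 1 - g) gn"
          unfolding prems(3,4) incr_all_conv using prems(5) by auto
        show "g \<le> n + 1" if "g \<in> set gp \<union> set gn" for g
          using prems(5)[OF that] by simp
        show "n + 1 \<le> snd x" if "x \<in> set ((s, w) # ws)" for x
          using gt[OF that] by simp
        show "b = p (n + 1 - 3)" "c = p (n + 1 - 2)" "p n = p (n + 1 - 1)" "3 \<le> n + 1"
          using prems(10-12) by (simp_all add: numeral_eq_Suc)
        show "m \<in> {n + 1..<N}"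
          using prems(14) mn by auto
      qed (fact prems(6,8,13,15))+
    qed
  qed
qed

lemma pent_offsets_numeral:
  "pent_offsets (numeral k) j g b = (b, g) # (b, g + j) # pent_offsets (pred_numeral k) (j + 1) (g + 3 * j + 1) (\<not> b)"
  by (simp add: numeral_eq_Suc)

text \<open>Division by a power of two drops one binary digit of both numerals at a time.\<close>

lemma numeral_div_Bit0:
  "numeral (num.Bit0 v) div numeral (num.Bit0 k) = (numeral v div numeral k :: int)"
  "numeral (num.Bit1 v) div numeral (num.Bit0 k) = (numeral v div numeral k :: int)"
  "x div numeral num.One = (x :: int)"
proof -
  have *: "(2 * x + y) div (2 * z) = x div z" if "y = 0 \<or> y = 1" "z > 0" for x y z :: int
  proof -
    have "(2 * x + y) div (2 * z) = (2 * x + y) div 2 div z"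
      using that by (subst zdiv_zmult2_eq) auto
    also have "(2 * x + y) div 2 = x"
      using that by auto
    finally show ?thesis .
  qed
  have bit0: "numeral (num.Bit0 w) = (2 * numeral w :: int)" and bit1: "numeral (num.Bit1 w) = (2 * numeral w + 1 :: int)" for w
    by (simp_all only: numeral_Bit0[of w] numeral_Bit1[of w] mult_2)
  show "numeral (num.Bit0 v) div numeral (num.Bit0 k) = (numeral v div numeral k :: int)"
    unfolding bit0[of v] bit0[of k] using *[of 0 "numeral k" "numeral v"] by simp
  show "numeral (num.Bit1 v) div numeral (num.Bit0 k) = (numeral v div numeral k :: int)"
    unfolding bit1[of v] bit0[of k] using *[of 1 "numeral k" "numeral v"] by simp
qed (simp only: numeral_One div_by_1)

lemmas turan_chain_eval_simps =
  turan_chain.simps index_sum.simps incr_all.simps turan_check_def turan_exact_def turan_rounded_def turan_cond_def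
  pent_offsets_numeral pent_offsets.simps(1) pred_numeral_simps numeral_div_Bit0 if_True if_False simp_thms
  add_0_left add_0_right diff_0_right mult_1_left mult_1_right one_add_one one_plus_numeral numeral_plus_one
  numeral_plus_numeral add_num_simps diff_numeral_simps diff_numeral_special sub_num_simps Num.dbl_simps Num.dbl_inc_simps Num.dbl_dec_simps BitM.simps
  numeral_times_numeral mult_num_simps
  numeral_eq_iff eq_num_simps numeral_le_iff le_num_simps numeral_less_iff less_num_simps zero_less_numeral

text \<open>At \<open>n = 3\<close> the offsets 1 and 2 are already passed, leaving the indices 2
  and 1, and the next offset is \<open>pent 2 = 5\<close> with negative sign. The 34 pairs end with
  \<open>j = 35\<close>, the first \<open>j\<close> for which \<open>pent j\<close> reaches
  1800.\<close>

lemma turan_chain_eval: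
  fixes p :: "nat \<Rightarrow> int"
  assumes "p 0 = 1" "p 1 = 1" "p 2 = 2"
  shows "turan_chain 1800 p num.One 1 1 2 3 [2, 1] [] (pent_offsets 34 2 5 False)"
  by (simp only: assms turan_chain_eval_simps cong: imp_cong if_weak_cong)

lemma turan_small:
  assumes "97 \<le> m" "m < 1800"
  defines "p \<equiv> \<lambda>i. int (num_partitions i)"
  shows "turan_exact (p (m - 3)) (p (m - 2)) (p (m - 1)) (p m)"
proof -
  have rec: "p i = (\<Sum>x\<leftarrow>pent_offsets 35 1 1 True. signed_shift p i x)" if "0 < i" "i < 1800" for i
  proof -
    have "pent (Suc 35) = 1926"
      by (simp add: numeral_eq_Suc)
    then have "p i = (\<Sum>j=1..35. - ((- 1) ^ j) * (shifted_partitions i (pent j) + shifted_partitions i (pent j + j)))"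
      unfolding p_def using that by (intro pentagonal_recurrence) auto
    also have "{1..35} = {1..<1 + 35 :: nat}"
      by auto
    also have "(\<Sum>j=1..<1 + 35. - ((- 1) ^ j) * (shifted_partitions i (pent j) + shifted_partitions i (pent j + j))) =
        (\<Sum>x\<leftarrow>pent_offsets 35 1 (pent 1) (odd (1 :: nat)). signed_shift p i x)"
      unfolding p_def by (rule sum_pent_offsets[symmetric])
    finally show ?thesis
      by simp
  qed
  have offsets: "pent_offsets 35 1 1 True = (True, 1) # (True, 2) # pent_offsets 34 2 5 False"
    by (simp add: pent_offsets_numeral numeral_eq_Suc)
  have p0: "p 0 = 1"
    by (simp add: p_def num_partitions_0)
  \<comment> \<open>All these offsets are at least 5, so the recurrence at 1 and 2 involves only the
    offsets 1 and 2.\<close>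
  have ws: "(\<Sum>x\<leftarrow>pent_offsets 34 2 5 False. signed_shift p i x) = 0" if "i < 5" for i
  proof -
    have "map (signed_shift p i) (pent_offsets 34 2 5 False) = map (\<lambda>_. 0) (pent_offsets 34 2 5 False)"
      using that sorted_pent_offsets[of 2 34 5 False] by (intro map_cong refl) (force simp: signed_shift_def)
    then show ?thesis
      by (simp only: sum_list_0)
  qed
  have p1: "p 1 = 1"
    using rec[of 1] ws[of 1] p0 unfolding offsets by (simp add: signed_shift_def)
  have p2: "p 2 = 2"
    using rec[of 2] ws[of 2] p0 p1 unfolding offsets by (simp add: signed_shift_def)
  show ?thesis
  proof (rule turan_chain_sound[OF turan_chain_eval[OF p0 p1 p2], where gp = "[1, 2]" and gn = "[]"])
    show "p i = (\<Sum>g\<leftarrow>[1, 2]. p (i - g)) - (\<Sum>g\<leftarrow>[]. p (i - g)) + (\<Sum>x\<leftarrow>pent_offsets 34 2 5 False. signed_shift p i x)"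
      if "3 \<le> i" "i < 1800" for i
      using rec[of i] that unfolding offsets by (simp add: signed_shift_def)
    show "sorted_wrt (<) (map snd (pent_offsets 34 2 5 False))"
      using sorted_pent_offsets[of 2 34 5 False] by simp
    show "3 \<le> snd x" if "x \<in> set (pent_offsets 34 2 5 False)" for x
      using sorted_pent_offsets[of 2 34 5 False] that by force
    show "\<exists>x\<in>set (pent_offsets 34 2 5 False). 1800 \<le> snd x"
      \<comment> \<open>1820 is \<open>pent 35\<close>.\<close>
      by (rule bexI[of _ "(True, 1820)"]) (simp_all add: pent_offsets_numeral)
    show "p i > 0" for i
      using num_partitions_pos by (simp add: p_def)
  qed (use assms p0 p1 p2 in auto)
qed

lemma turan_exact_u_seq:
  assumes "n \<ge> 1"
    and "turan_exact (int (num_partitions (n - 1))) (int (num_partitions n)) (int (num_partitions (n + 1))) (int (num_partitions (n + 2)))"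
  shows "4 * (1 - u_seq n) * (1 - u_seq (n + 1)) - (1 - u_seq n * u_seq (n + 1))\<^sup>2 > 0"
proof -
  define a b c d where "a = real (num_partitions (n - 1))" and "b = real (num_partitions n)"
    and "c = real (num_partitions (n + 1))" and "d = real (num_partitions (n + 2))"
  have pos: "b > 0" "c > 0"
    using num_partitions_pos by (auto simp: b_def c_def)
  have "real_of_int (int (num_partitions k)) = real (num_partitions k)" for k
    by simp
  then have less: "(b * c - a * d) * (b * c - a * d) < 4 * ((b * b - a * c) * (c * c - b * d))"
    using assms(2) unfolding turan_exact_def of_int_less_iff[where 'a = real, symmetric]
    by (simp only: of_int_mult of_int_diff of_int_numeral a_def b_def c_def d_def)
  have u: "u_seq n = c * a / b\<^sup>2" and v: "u_seq (n + 1) = d * b / c\<^sup>2"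
    by (simp_all add: u_seq_def a_def b_def c_def d_def)
  have "1 - u_seq n = (b * b - a * c) / b\<^sup>2" "1 - u_seq (n + 1) = (c * c - b * d) / c\<^sup>2"
    unfolding u v using pos by (simp_all add: field_simps power2_eq_square)
  moreover have "1 - u_seq n * u_seq (n + 1) = (b * c - a * d) / (b * c)"
    unfolding u v using pos by (simp add: field_simps power2_eq_square)
  moreover have "4 * (S / b\<^sup>2) * (T / c\<^sup>2) - (t / (b * c))\<^sup>2 = (4 * (S * T) - t * t) / (b * c)\<^sup>2" for S T t
    using pos by (simp add: field_simps power2_eq_square)
  ultimately have "4 * (1 - u_seq n) * (1 - u_seq (n + 1)) - (1 - u_seq n * u_seq (n + 1))\<^sup>2 =
      (4 * ((b * b - a * c) * (c * c - b * d)) - (b * c - a * d) * (b * c - a * d)) / (b * c)\<^sup>2"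
    by (simp only:)
  also have "\<dots> > 0"
    using less pos by (intro divide_pos_pos) auto
  finally show ?thesis .
qed

theorem theorem1p3:
  fixes n :: nat
  assumes "n \<ge> 95"
  shows "4 * (1 - u_seq n) * (1 - u_seq (n + 1)) - (1 - u_seq n * u_seq (n + 1))\<^sup>2 > 0"
proof (cases "n \<ge> 1795")
  case True
  then show ?thesis
    by (rule turan_large)
next
  case False
  then show ?thesis
    using assms turan_small[of "n + 2"] by (intro turan_exact_u_seq) simp_all
qed

end
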